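(* Let $\mathbb{G}$ be any Carnot group. For any $z\in\mathbb{R}^m$, $t>0$, and $(z',\sigma')\in\mathbb{G}$, we have $$\int_{\mathbb{R}^{N-m}}p\big((z,\sigma),(z',\sigma'),t\big)\,d\sigma=(4\pi t)^{-\frac m2}e^{-\frac{\|z-z'\|^2}{4t}} .$$
   Context: A Carnot group of step $r\in\mathbb{N}$ is a simply connected real Lie group $(\mathbb{G},\circ)$ whose Lie algebra $\mathfrak{g}$ is stratified and $r$-nilpotent: $\mathfrak{g}=\mathfrak{g}_1\oplus\dots\oplus\mathfrak{g}_r$ with $[\mathfrak{g}_1,\mathfrak{g}_j]=\mathfrak{g}_{j+1}$ for $j=1,\dots,r-1$ and $[\mathfrak{g}_1,\mathfrak{g}_r]=\{0\}$. The Lie algebra carries a scalar product for which the layers are mutually orthogonal; $m=\dim\mathfrak{g}_1$, $N=\dim\mathfrak{g}$, and $\{e_1,\dots,e_m\}$ is an orthonormal basis of $\mathfrak{g}_1$. Via the exponential map (a diffeomorphism) and orthonormal bases of the layers, $g\in\mathbb{G}$ is identified with its logarithmic coordinates $(z,\sigma)$, where $z\in\mathbb{R}^m$ are the coordinates of the $\mathfrak{g}_1$ component of $\exp^{-1}g$ and $\sigma\in\mathbb{R}^{N-m}$ those of the components in $\mathfrak{g}_2\oplus\dots\oplus\mathfrak{g}_r$. $dg=dz\,d\sigma$ is the bi-invariant Haar measure obtained by lifting Lebesgue measure on $\mathfrak{g}$. The left-invariant vector fields are $X_iu(g)=\frac{d}{ds}u(g\circ\exp(se_i))|_{s=0}$,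 $i=1,\dots,m$. The horizontal Laplacian is $\mathscr{L}=\sum_{i=1}^mX_i^2$, $P_t$ is the heat semigroup generated by $\mathscr{L}$ (so that $u(\cdot,t)=P_tf$ solves $\partial_tu=\mathscr{L}u$, $u(\cdot,0)=f$), and $p(g,g',t)$ is its (positive, smooth, symmetric) heat kernel: $P_tf(g)=\int_{\mathbb{G}}p(g,g',t)f(g')\,dg'$. *)

theory Defs
  imports "HOL-Analysis.Analysis"
begin

section \<open>Smooth maps on open subsets of Euclidean spaces\<close>

primrec Ck_on ::
    "nat \<Rightarrow> 'a::euclidean_space set \<Rightarrow> ('a \<Rightarrow> 'b::real_normed_vector) \<Rightarrow> bool" where
  "Ck_on 0 S f \<longleftrightarrow> continuous_on S f"
| "Ck_on (Suc k) S f \<longleftrightarrow> (\<forall>x\<in>S. f differentiable at x) \<and>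
     (\<forall>v. Ck_on k S (\<lambda>x. frechet_derivative f (at x) v))"

definition smooth_on :: "'a::euclidean_space set \<Rightarrow> ('a \<Rightarrow> 'b::real_normed_vector) \<Rightarrow> bool" where
  "smooth_on S f \<longleftrightarrow> open S \<and> (\<forall>k. Ck_on k S f)"

section \<open>Carnot groups in logarithmic coordinates\<close>

text \<open>
  The exponential map of a simply connected nilpotent Lie group is a diffeomorphism, and such a
  group is represented here on its Lie algebra by transporting the group law along it. The Lie
  algebra is the Euclidean space \<open>'a\<close>, whose inner product is the scalar product of the
  Lie algebra. The transported law is a smooth group law on \<open>'a\<close> with neutral element 0, and
  its exponential map is the identity: for each \<open>x\<close> the curve \<open>s \<mapsto> s x\<close> is the one-parameter
  subgroup with velocity \<open>x\<close> at 0. In particular \<open>- x\<close> is the group inverse of \<open>x\<close>.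
\<close>

definition lie_group_log :: "('a::euclidean_space \<Rightarrow> 'a \<Rightarrow> 'a) \<Rightarrow> bool" where
  "lie_group_log mul \<longleftrightarrow>
     (\<forall>x y z. mul (mul x y) z = mul x (mul y z)) \<and>
     (\<forall>x. mul 0 x = x \<and> mul x 0 = x) \<and>
     smooth_on UNIV (\<lambda>(x, y). mul x y) \<and>
     (\<forall>x s t. mul (s *\<^sub>R x) (t *\<^sub>R x) = (s + t) *\<^sub>R x)"

definition left_inv_field ::
    "('a::euclidean_space \<Rightarrow> 'a \<Rightarrow> 'a) \<Rightarrow> 'a \<Rightarrow> 'a \<Rightarrow> 'a" where
  "left_inv_field mul v g = vector_derivative (\<lambda>s. mul g (s *\<^sub>R v)) (at 0)"

text \<open>
  The Lie bracket of \<open>x\<close> and \<open>y\<close> is the value at the neutral element of the commutator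
  \<open>DY \<cdot> X - DX \<cdot> Y\<close> of the left-invariant fields \<open>X\<close>, \<open>Y\<close> with \<open>X 0 = x\<close>, \<open>Y 0 = y\<close>.
\<close>

definition lie_bracket ::
    "('a::euclidean_space \<Rightarrow> 'a \<Rightarrow> 'a) \<Rightarrow> 'a \<Rightarrow> 'a \<Rightarrow> 'a" where
  "lie_bracket mul x y =
     frechet_derivative (left_inv_field mul y) (at 0) x -
     frechet_derivative (left_inv_field mul x) (at 0) y"

definition bracket_space ::
    "('a::euclidean_space \<Rightarrow> 'a \<Rightarrow> 'a) \<Rightarrow> 'a set \<Rightarrow> 'a set \<Rightarrow> 'a set" where
  "bracket_space mul A B = span {lie_bracket mul x y | x y. x \<in> A \<and> y \<in> B}"

text \<open>
  \<open>V j\<close> is the \<open>j\<close>-th layer for \<open>1 \<le> j \<le> r\<close>; other values of \<open>V\<close> are irrelevant. The sum of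
  the layers is direct because they are mutually orthogonal.
\<close>

definition carnot_group ::
    "('a::euclidean_space \<Rightarrow> 'a \<Rightarrow> 'a) \<Rightarrow> nat \<Rightarrow> (nat \<Rightarrow> 'a set) \<Rightarrow> bool" where
  "carnot_group mul r V \<longleftrightarrow>
     lie_group_log mul \<and> 1 \<le> r \<and>
     (\<forall>j\<in>{1..r}. subspace (V j)) \<and>
     (\<forall>i\<in>{1..r}. \<forall>j\<in>{1..r}. i \<noteq> j \<longrightarrow> (\<forall>x\<in>V i. \<forall>y\<in>V j. x \<bullet> y = 0)) \<and>
     span (\<Union>j\<in>{1..r}. V j) = UNIV \<and>
     (\<forall>j\<in>{1..<r}. bracket_space mul (V 1) (V j) = V (Suc j)) \<and>
     bracket_space mul (V 1) (V r) = {0}"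

text \<open>
  Orthonormal bases \<open>e\<close> of the first layer (so \<open>m = CARD('m)\<close>) and \<open>f 0, \<dots>, f (N - m - 1)\<close>,
  \<open>N = DIM('a)\<close>, of the remaining layers. The case \<open>N = m\<close> is allowed.
\<close>

definition adapted_basis ::
    "nat \<Rightarrow> (nat \<Rightarrow> 'a::euclidean_space set) \<Rightarrow> ('m::finite \<Rightarrow> 'a) \<Rightarrow> (nat \<Rightarrow> 'a) \<Rightarrow> bool" where
  "adapted_basis r V e f \<longleftrightarrow>
     (\<forall>i j. e i \<bullet> e j = (if i = j then 1 else 0)) \<and>
     span (range e) = V 1 \<and>
     (\<forall>k<DIM('a) - CARD('m). \<forall>l<DIM('a) - CARD('m). f k \<bullet> f l = (if k = l then 1 else 0)) \<and>
     (\<forall>k<DIM('a) - CARD('m). \<exists>j\<in>{2..r}. f k \<in> V j) \<and>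
     (\<forall>j\<in>{2..r}. span {f k | k. k < DIM('a) - CARD('m) \<and> f k \<in> V j} = V j)"

text \<open>The group element with logarithmic coordinates \<open>(z, \<sigma>)\<close>; only \<open>\<sigma> k\<close>, \<open>k < N - m\<close>, matter.\<close>

definition log_point ::
    "('m::finite \<Rightarrow> 'a::euclidean_space) \<Rightarrow> (nat \<Rightarrow> 'a) \<Rightarrow> real^'m \<Rightarrow> (nat \<Rightarrow> real) \<Rightarrow> 'a" where
  "log_point e f z \<sigma> =
     (\<Sum>i\<in>UNIV. (z $ i) *\<^sub>R e i) + (\<Sum>k<DIM('a) - CARD('m). \<sigma> k *\<^sub>R f k)"

section \<open>Horizontal Laplacian, heat semigroup and heat kernel\<close>

text \<open>Since the exponential map is the identity, \<open>g \<circ> exp (s v)\<close> is \<open>mul g (s *\<^sub>R v)\<close>.\<close>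

definition left_inv_deriv ::
    "('a::euclidean_space \<Rightarrow> 'a \<Rightarrow> 'a) \<Rightarrow> 'a \<Rightarrow> ('a \<Rightarrow> real) \<Rightarrow> 'a \<Rightarrow> real" where
  "left_inv_deriv mul v u g = deriv (\<lambda>s. u (mul g (s *\<^sub>R v))) 0"

definition horizontal_laplacian ::
    "('a::euclidean_space \<Rightarrow> 'a \<Rightarrow> 'a) \<Rightarrow> ('m::finite \<Rightarrow> 'a) \<Rightarrow> ('a \<Rightarrow> real) \<Rightarrow> 'a \<Rightarrow> real" where
  "horizontal_laplacian mul e u g =
     (\<Sum>i\<in>UNIV. left_inv_deriv mul (e i) (left_inv_deriv mul (e i) u) g)"

definition C0_fun :: "('a::euclidean_space \<Rightarrow> real) \<Rightarrow> bool" where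
  "C0_fun u \<longleftrightarrow> continuous_on UNIV u \<and> (u \<longlongrightarrow> 0) at_infinity"

definition test_fun :: "('a::euclidean_space \<Rightarrow> real) \<Rightarrow> bool" where
  "test_fun u \<longleftrightarrow> smooth_on UNIV u \<and> compact (closure {x. u x \<noteq> 0})"

text \<open>Strongly continuous contraction semigroups on the Banach space of continuous functions
  vanishing at infinity, with the sup norm.\<close>

definition contraction_semigroup_C0 ::
    "(real \<Rightarrow> ('a::euclidean_space \<Rightarrow> real) \<Rightarrow> 'a \<Rightarrow> real) \<Rightarrow> bool" where
  "contraction_semigroup_C0 P \<longleftrightarrow>
     (\<forall>t\<ge>0. \<forall>u. C0_fun u \<longrightarrow> C0_fun (P t u)) \<and>
     (\<forall>t\<ge>0. \<forall>u v a b. C0_fun u \<longrightarrow> C0_fun v \<longrightarrow>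
        P t (\<lambda>x. a * u x + b * v x) = (\<lambda>x. a * P t u x + b * P t v x)) \<and>
     (\<forall>t\<ge>0. \<forall>u B. C0_fun u \<longrightarrow> (\<forall>x. \<bar>u x\<bar> \<le> B) \<longrightarrow> (\<forall>x. \<bar>P t u x\<bar> \<le> B)) \<and>
     (\<forall>u. C0_fun u \<longrightarrow> P 0 u = u) \<and>
     (\<forall>s\<ge>0. \<forall>t\<ge>0. \<forall>u. C0_fun u \<longrightarrow> P (s + t) u = P s (P t u)) \<and>
     (\<forall>u. C0_fun u \<longrightarrow> uniform_limit UNIV (\<lambda>t. P t u) u (at_right 0))"

text \<open>Graph of the infinitesimal generator.\<close>

definition generator_C0 ::
    "(real \<Rightarrow> ('a::euclidean_space \<Rightarrow> real) \<Rightarrow> 'a \<Rightarrow> real) \<Rightarrow> (('a \<Rightarrow> real) \<times> ('a \<Rightarrow> real)) set" where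
  "generator_C0 P = {(u, v). C0_fun u \<and> C0_fun v \<and>
     uniform_limit UNIV (\<lambda>t x. (P t u x - u x) / t) v (at_right 0)}"

text \<open>Graph of the closure of the horizontal Laplacian with domain the test functions.\<close>

definition laplacian_closure_C0 ::
    "('a::euclidean_space \<Rightarrow> 'a \<Rightarrow> 'a) \<Rightarrow> ('m::finite \<Rightarrow> 'a) \<Rightarrow> (('a \<Rightarrow> real) \<times> ('a \<Rightarrow> real)) set" where
  "laplacian_closure_C0 mul e = {(u, v). C0_fun u \<and> C0_fun v \<and>
     (\<exists>\<phi>. (\<forall>n::nat. test_fun (\<phi> n)) \<and> uniform_limit UNIV \<phi> u sequentially \<and>
          uniform_limit UNIV (\<lambda>n. horizontal_laplacian mul e (\<phi> n)) v sequentially)}"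

text \<open>
  The heat semigroup is the semigroup generated by the horizontal Laplacian; thus for \<open>u\<close> in the
  domain of the generator \<open>t \<mapsto> P t u\<close> solves the heat equation with initial value \<open>u\<close>.
\<close>

definition heat_semigroup ::
    "('a::euclidean_space \<Rightarrow> 'a \<Rightarrow> 'a) \<Rightarrow> ('m::finite \<Rightarrow> 'a) \<Rightarrow>
     (real \<Rightarrow> ('a \<Rightarrow> real) \<Rightarrow> 'a \<Rightarrow> real) \<Rightarrow> bool" where
  "heat_semigroup mul e P \<longleftrightarrow>
     contraction_semigroup_C0 P \<and> generator_C0 P = laplacian_closure_C0 mul e"

text \<open>The Haar measure \<open>dg = dz d\<sigma>\<close> is Lebesgue measure \<open>lborel\<close> on the Lie algebra.\<close>

definition heat_kernel ::
    "(real \<Rightarrow> ('a::euclidean_space \<Rightarrow> real) \<Rightarrow> 'a \<Rightarrow> real) \<Rightarrow> ('a \<Rightarrow> 'a \<Rightarrow> real \<Rightarrow> real) \<Rightarrow> bool" where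
  "heat_kernel P p \<longleftrightarrow>
     (\<forall>g g'. \<forall>t>0. p g g' t > 0) \<and>
     (\<forall>g g'. \<forall>t>0. p g g' t = p g' g t) \<and>
     smooth_on (UNIV \<times> UNIV \<times> {0<..}) (\<lambda>(g, g', t). p g g' t) \<and>
     (\<forall>t>0. \<forall>u g. C0_fun u \<longrightarrow>
        has_bochner_integral lborel (\<lambda>g'. p g g' t * u g') (P t u g))"

end

theory Submission
  imports Defs "HOL-Probability.Probability"
begin

text \<open>
  The projection \<open>pr\<close> of the group onto the coordinates of the first layer is a homomorphism, because every linear
  functional that vanishes on all Lie brackets is additive in logarithmic coordinates. Hence \<open>u = exp (\<i> \<xi> \<bullet> pr)\<close>
  is a unitary character with \<open>X\<^sub>i u = \<i> \<xi>\<^sub>i u\<close>. The semigroup commutes with left translations, so the heat kernel is left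
  invariant up to the modulus \<open>D\<close> of Lebesgue measure, and \<open>\<integral> p(h, g, t) u(g) dg = c(t) u(h)\<close>. Pairing \<open>u\<close> with \<open>P t \<psi>\<close>
  for test functions \<open>\<psi>\<close> identifies \<open>c(t)\<close> as the exponential of \<open>t\<close> times the sum of the \<open>(a\<^sub>i - \<i> \<xi>\<^sub>i)\<^sup>2\<close>, where \<open>a\<^sub>i\<close> is the
  derivative of \<open>D\<close> along the \<open>i\<close>-th field; as the mass of \<open>p\<close> is at most one, \<open>\<xi> = 0\<close> forces \<open>a = 0\<close>, hence
  \<open>c(t) = exp (- t \<bar>\<xi>\<bar>\<^sup>2)\<close>. No cut-off functions, dilations or unimodularity are needed.

  Fourier inversion against Gaussians gives the fibre integrals \<open>q(g, z, t)\<close> of \<open>p\<close> for almost every \<open>z\<close>. By Fatou they are lower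
  semicontinuous in \<open>z\<close>, hence bounded by the Gaussian everywhere. The converse bound at every \<open>z\<close> follows
  from the Chapman-Kolmogorov inequality together with \<open>q(g, z, t) = q(0, z - pr g, t)\<close>.
\<close>

section \<open>The group in logarithmic coordinates\<close>

text \<open>The semigroup acts on functions vanishing at infinity, and the characters are not of
  this kind. So a character is only ever integrated against the kernel, and the time dependence of
  that integral is read off by duality from test functions. The description of the generator as a
  closure also carries left invariance over to \<open>P\<close>: it is visible on test functions,
  passes to the closure, and reaches all of \<open>P\<close> by density of the domain.

  Fourier analysis sees \<open>p\<close> only after integration in \<open>z\<close>, while the claim
  concerns every single \<open>z\<close>. Integrability of \<open>p\<close> gives no bound that is
  uniform on nearby fibres, so continuity of the fibre integral in \<open>z\<close> is not to be had
  by domination. Hence two one-sided arguments: Fatou turns the averaged statement into an upper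
  bound at each point; for the lower bound \<open>t\<close> is split into two equal halves, where
  the first half is integrated and tolerates an almost-everywhere identity, while the second keeps
  the exact point \<open>z\<close>.\<close>

lemma smooth_on_Ck: "smooth_on S f \<Longrightarrow> Ck_on k S f"
  by (simp add: smooth_on_def)

lemma smooth_on_has_derivative:
  assumes "smooth_on S f" "x \<in> S"
  shows "(f has_derivative frechet_derivative f (at x)) (at x)"
  using smooth_on_Ck[OF assms(1), of "Suc 0"] assms(2) by (simp add: frechet_derivative_works)

lemma smooth_on_frechet_has_derivative:
  assumes "smooth_on S f" "x \<in> S"
  shows "((\<lambda>x. frechet_derivative f (at x) v) has_derivative
           frechet_derivative (\<lambda>x. frechet_derivative f (at x) v) (at x)) (at x)"
  using smooth_on_Ck[OF assms(1), of "Suc (Suc 0)"] assms(2) by (simp add: frechet_derivative_works)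

lemma smooth_on_frechet: "smooth_on S f \<Longrightarrow> smooth_on S (\<lambda>x. frechet_derivative f (at x) v)"
  unfolding smooth_on_def by (metis Ck_on.simps(2))

lemma smooth_on_continuous: "smooth_on S f \<Longrightarrow> continuous_on S f"
  using smooth_on_Ck[of S f 0] by simp

text \<open>The form in which the group property is used: a difference quotient at \<open>s\<close>
  is rewritten as one at \<open>0\<close>, as in \<open>l_Ad\<close>.\<close>

lemma has_vector_derivative_at_iff:
  "(f has_vector_derivative v) (at x) \<longleftrightarrow> ((\<lambda>h. (f (x + h) - f x) /\<^sub>R h) \<longlongrightarrow> v) (at 0)"
proof -
  have "norm ((f (x + h) - f x) /\<^sub>R h - v) = norm (f (x + h) - f x - h *\<^sub>R v) / norm h" if "h \<noteq> 0" for h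
  proof -
    have "(f (x + h) - f x) /\<^sub>R h - v = (f (x + h) - f x - h *\<^sub>R v) /\<^sub>R h"
      using that by (simp add: algebra_simps)
    then show ?thesis
      by (simp add: divide_inverse mult.commute)
  qed
  then have "((\<lambda>h. (f (x + h) - f x) /\<^sub>R h) \<longlongrightarrow> v) (at 0) \<longleftrightarrow>
      ((\<lambda>h. norm (f (x + h) - f x - h *\<^sub>R v) / norm h) \<longlongrightarrow> 0) (at 0)"
    by (subst Lim_null, subst tendsto_norm_zero_iff[symmetric], intro filterlim_cong)
       (auto simp: eventually_at_filter)
  then show ?thesis
    by (simp add: has_vector_derivative_def has_derivative_at bounded_linear_scaleR_left)
qed

section \<open>The group law, its differential and the left-invariant fields\<close>

locale lie_log =
  fixes mul :: "'a::euclidean_space \<Rightarrow> 'a \<Rightarrow> 'a"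
  assumes lie_group: "lie_group_log mul"
begin

lemma assoc: "mul (mul x y) z = mul x (mul y z)"
  and mul_0_left [simp]: "mul 0 x = x"
  and mul_0_right [simp]: "mul x 0 = x"
  and smooth_mul: "smooth_on UNIV (\<lambda>(x, y). mul x y)"
  and mul_scale: "mul (s *\<^sub>R x) (t *\<^sub>R x) = (s + t) *\<^sub>R x"
  using lie_group by (auto simp: lie_group_log_def)

lemma mul_uminus [simp]: "mul x (- x) = 0" "mul (- x) x = 0"
  using mul_scale[of 1 x "-1"] mul_scale[of "-1" x 1] by auto

lemma mul_uminus_cancel [simp]: "mul x (mul (- x) y) = y" "mul (- x) (mul x y) = y"
  by (simp_all flip: assoc)

lemma mul_left_cancel: "mul x y = mul x z \<longleftrightarrow> y = z"
  by (metis mul_uminus_cancel(2))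

lemma uminus_mul: "- mul x y = mul (- y) (- x)"
proof -
  have "mul (mul x y) (mul (- y) (- x)) = 0"
    by (simp add: assoc)
  then have "mul (mul x y) (mul (- y) (- x)) = mul (mul x y) (- mul x y)"
    by simp
  then show ?thesis
    by (simp only: mul_left_cancel)
qed

definition dmul :: "'a \<times> 'a \<Rightarrow> 'a \<times> 'a \<Rightarrow> 'a" where
  "dmul q = frechet_derivative (\<lambda>(x, y). mul x y) (at q)"

lemma mul_has_derivative_at: "((\<lambda>(x, y). mul x y) has_derivative dmul q) (at q)"
  unfolding dmul_def by (rule smooth_on_has_derivative[OF smooth_mul]) simp

lemma linear_dmul: "linear (dmul q)"
  using mul_has_derivative_at has_derivative_linear by blast

lemma mul_has_derivative:
  assumes "(f has_derivative f') (at x within S)" "(g has_derivative g') (at x within S)"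
  shows "((\<lambda>x. mul (f x) (g x)) has_derivative (\<lambda>h. dmul (f x, g x) (f' h, g' h))) (at x within S)"
  using has_derivative_compose[OF has_derivative_Pair[OF assms] mul_has_derivative_at] by simp

lemma mul_has_vector_derivative:
  assumes "(f has_vector_derivative f') (at x within S)" "(g has_vector_derivative g') (at x within S)"
  shows "((\<lambda>x. mul (f x) (g x)) has_vector_derivative dmul (f x, g x) (f', g')) (at x within S)"
  using mul_has_derivative[OF assms[unfolded has_vector_derivative_def]]
  by (simp add: has_vector_derivative_def linear_cmul[OF linear_dmul, of _ _ "(f', g')", simplified])

lemma dmul_has_derivative:
  "((\<lambda>q. dmul q w) has_derivative frechet_derivative (\<lambda>q. dmul q w) (at q)) (at q)"
  unfolding dmul_def by (rule smooth_on_frechet_has_derivative[OF smooth_mul]) simp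

lemma continuous_on_dmul: "continuous_on UNIV (\<lambda>q. dmul q w)"
  unfolding dmul_def by (rule smooth_on_continuous[OF smooth_on_frechet[OF smooth_mul]])

lemma continuous_on_mul:
  assumes "continuous_on S f" "continuous_on S g"
  shows "continuous_on S (\<lambda>x. mul (f x) (g x))"
  using continuous_on_compose2[OF smooth_on_continuous[OF smooth_mul] continuous_on_Pair[OF assms]] by auto

text \<open>Both partial differentials at the neutral element are the identity because
  \<open>0\<close> is neutral on either side; linearity adds them up.\<close>

lemma dmul_0: "dmul (0, 0) (v, w) = v + w"
proof -
  have "((\<lambda>x. mul x 0) has_derivative (\<lambda>h. dmul (0, 0) (h, 0))) (at 0)"
    using mul_has_derivative[of "\<lambda>x. x" "\<lambda>x. x" 0 UNIV "\<lambda>x. 0" "\<lambda>x. 0"] by simp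
  then have 1: "(\<lambda>h. dmul (0, 0) (h, 0)) = (\<lambda>h. h)"
    by (auto intro: has_derivative_unique)
  have "((\<lambda>x. mul 0 x) has_derivative (\<lambda>h. dmul (0, 0) (0, h))) (at 0)"
    using mul_has_derivative[of "\<lambda>x. 0" "\<lambda>x. 0" 0 UNIV "\<lambda>x. x" "\<lambda>x. x"] by simp
  then have 2: "(\<lambda>h. dmul (0, 0) (0, h)) = (\<lambda>h. h)"
    by (auto intro: has_derivative_unique)
  show ?thesis
    using linear_add[OF linear_dmul, of "(0,0)" "(v,0)" "(0,w)"] fun_cong[OF 1, of v] fun_cong[OF 2, of w] by simp
qed

abbreviation X :: "'a \<Rightarrow> 'a \<Rightarrow> 'a" where
  "X \<equiv> left_inv_field mul"

lemma curve_has_vector_derivative: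
  "((\<lambda>s. mul g (s *\<^sub>R v)) has_vector_derivative dmul (g, 0) (0, v)) (at 0)"
  using mul_has_vector_derivative[OF has_vector_derivative_const has_vector_derivative_scaleR,
     of "\<lambda>s. s" 1 0 UNIV "\<lambda>_. v" 0 g] has_vector_derivative_const[of v "at 0"] by (simp add: DERIV_ident)

lemma X_eq: "X v g = dmul (g, 0) (0, v)"
  unfolding left_inv_field_def by (rule vector_derivative_at[OF curve_has_vector_derivative])

lemma curve_derivative_0: "((\<lambda>s. mul g (s *\<^sub>R v)) has_vector_derivative X v g) (at 0)"
  unfolding X_eq by (rule curve_has_vector_derivative)

text \<open>The factor \<open>s *\<^sub>R v\<close> is absorbed into the base point, which reduces
  the claim to the derivative at \<open>0\<close>: the curve is an integral curve of
  \<open>X v\<close>.\<close>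

lemma curve_derivative: "((\<lambda>s. mul g (s *\<^sub>R v)) has_vector_derivative X v (mul g (s *\<^sub>R v))) (at s)"
proof -
  have "((\<lambda>k. mul (mul g (s *\<^sub>R v)) (k *\<^sub>R v)) has_vector_derivative X v (mul g (s *\<^sub>R v))) (at (s - s))"
    using curve_derivative_0[of "mul g (s *\<^sub>R v)" v] by simp
  moreover have "((\<lambda>t. t - s) has_vector_derivative 1) (at s)"
    by (auto intro!: derivative_eq_intros simp: has_real_derivative_iff_has_vector_derivative[symmetric])
  ultimately have "((\<lambda>t. mul (mul g (s *\<^sub>R v)) ((t - s) *\<^sub>R v)) has_vector_derivative X v (mul g (s *\<^sub>R v))) (at s)"
    using vector_diff_chain_at[of "\<lambda>t. t - s" 1 s "\<lambda>k. mul (mul g (s *\<^sub>R v)) (k *\<^sub>R v)"] by (simp add: o_def)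
  then show ?thesis
    by (simp add: assoc mul_scale)
qed

lemma linear_X: "linear (\<lambda>v. X v g)"
  unfolding X_eq using linear_compose[OF _ linear_dmul, of "\<lambda>v. (0, v)" "(g,0)"]
  by (simp add: o_def linear_iff)

lemma X_0 [simp]: "X v 0 = v"
  by (simp add: X_eq dmul_0)

text \<open>Lines through \<open>0\<close> are one-parameter subgroups, so the field
  \<open>X x\<close> is constant along the line through \<open>x\<close>.\<close>

lemma X_self: "X x (s *\<^sub>R x) = x"
proof -
  have "((\<lambda>t. (s + t) *\<^sub>R x) has_vector_derivative x) (at 0)"
    by (auto intro!: derivative_eq_intros)
  then show ?thesis
    using vector_derivative_unique_at[OF _ curve_derivative_0[of "s *\<^sub>R x" x]] by (simp add: mul_scale)
qed

text \<open>The mixed second derivative of the group law at the neutral element. It turns out to be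
  half of the Lie bracket (\<open>lie_bracket_eq\<close>), which explains the factors 2
  below.\<close>

definition \<beta> :: "'a \<Rightarrow> 'a \<Rightarrow> 'a" where
  "\<beta> x v = frechet_derivative (X v) (at 0) x"

lemma X_has_derivative: "(X v has_derivative frechet_derivative (X v) (at g)) (at g)"
proof -
  have "((\<lambda>g. (g, 0::'a)) has_derivative (\<lambda>h. (h, 0))) (at g)"
    by (auto intro!: derivative_eq_intros)
  from has_derivative_compose[OF this dmul_has_derivative] have "(X v) differentiable (at g)"
    unfolding X_eq[abs_def] by (blast intro: differentiableI)
  then show ?thesis
    by (simp add: frechet_derivative_works)
qed

lemma X_has_derivative_0: "(X v has_derivative (\<lambda>x. \<beta> x v)) (at 0)"
  using X_has_derivative[of v 0] by (simp add: \<beta>_def[abs_def])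

lemma X_line_derivative: "((\<lambda>s. X v (s *\<^sub>R x)) has_vector_derivative \<beta> x v) (at 0)"
proof -
  have "((\<lambda>s. s *\<^sub>R x) has_derivative (\<lambda>s. s *\<^sub>R x)) (at 0)"
    by (auto intro!: derivative_eq_intros)
  moreover have "(X v has_derivative (\<lambda>x. \<beta> x v)) (at (0 *\<^sub>R x))"
    by (simp add: X_has_derivative_0)
  ultimately have "((\<lambda>s. X v (s *\<^sub>R x)) has_derivative (\<lambda>s. \<beta> (s *\<^sub>R x) v)) (at 0)"
    by (rule has_derivative_compose)
  then show ?thesis
    by (simp add: has_vector_derivative_def linear_cmul[OF has_derivative_linear[OF X_has_derivative_0]])
qed

lemma linear_beta_left: "linear (\<lambda>x. \<beta> x v)"
  using X_has_derivative_0 has_derivative_linear by blast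

lemma linear_beta_right: "linear (\<beta> x)"
proof (rule linearI)
  fix v w c
  have "((\<lambda>s. X (v + w) (s *\<^sub>R x)) has_vector_derivative \<beta> x v + \<beta> x w) (at 0)"
    unfolding linear_add[OF linear_X] by (intro has_vector_derivative_add X_line_derivative)
  then show "\<beta> x (v + w) = \<beta> x v + \<beta> x w"
    using X_line_derivative vector_derivative_unique_at by blast
  have "((\<lambda>s. X (c *\<^sub>R v) (s *\<^sub>R x)) has_vector_derivative c *\<^sub>R \<beta> x v) (at 0)"
    unfolding linear_cmul[OF linear_X]
    by (intro bounded_linear.has_vector_derivative[OF bounded_linear_scaleR_right] X_line_derivative)
  then show "\<beta> x (c *\<^sub>R v) = c *\<^sub>R \<beta> x v"
    using X_line_derivative vector_derivative_unique_at by blast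
qed

text \<open>Differentiating the constancy in \<open>X_self\<close>. This is where logarithmic
  coordinates make the mixed second derivative alternating, and polarisation then gives
  antisymmetry.\<close>

lemma beta_self [simp]: "\<beta> x x = 0"
proof -
  have "((\<lambda>s. X x (s *\<^sub>R x)) has_vector_derivative 0) (at 0)"
    by (simp add: X_self)
  then show ?thesis
    using X_line_derivative vector_derivative_unique_at by blast
qed

lemma beta_antisym: "\<beta> y x = - \<beta> x y"
proof -
  have "\<beta> (x + y) (x + y) = \<beta> x (x + y) + \<beta> y (x + y)"
    by (rule linear_add[OF linear_beta_left])
  then show ?thesis
    by (simp add: linear_add[OF linear_beta_right] eq_neg_iff_add_eq_0 add.commute)
qed

lemma lie_bracket_eq: "lie_bracket mul x y = 2 *\<^sub>R \<beta> x y"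
  unfolding lie_bracket_def \<beta>_def[symmetric] by (subst (2) beta_antisym) (simp add: scaleR_2)

lemma bounded_bilinear_beta: "bounded_bilinear \<beta>"
  unfolding bilinear_conv_bounded_bilinear[symmetric] bilinear_def
  by (auto intro: linear_beta_left linear_beta_right)

text \<open>By \<open>mul_scale\<close> the n-fold product of \<open>\<gamma> (s / n)\<close> with
  itself is \<open>n\<close> times that vector, so \<open>\<gamma> s / s\<close> equals the same
  quotient at \<open>s / n\<close>, which tends to \<open>v\<close>. Thus differentiability at the
  single point \<open>0\<close> is enough.\<close>

lemma one_parameter_line:
  assumes hom: "\<And>s t. \<gamma> (s + t) = mul (\<gamma> s) (\<gamma> t)"
    and d: "(\<gamma> has_vector_derivative v) (at 0)"
  shows "\<gamma> s = s *\<^sub>R v"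
proof -
  have "\<gamma> 0 = 2 *\<^sub>R \<gamma> 0"
    using hom[of 0 0] mul_scale[of 1 "\<gamma> 0" 1] by simp
  then have 0: "\<gamma> 0 = 0"
    by (simp add: scaleR_2)
  have n: "\<gamma> (real n * s) = real n *\<^sub>R \<gamma> s" for n s
  proof (induction n)
    case (Suc n)
    have "\<gamma> (real (Suc n) * s) = mul (\<gamma> (real n * s)) (\<gamma> s)"
      by (simp add: hom[symmetric] algebra_simps)
    also have "\<dots> = mul (real n *\<^sub>R \<gamma> s) (1 *\<^sub>R \<gamma> s)"
      by (simp add: Suc)
    also have "\<dots> = real (Suc n) *\<^sub>R \<gamma> s"
      unfolding mul_scale by (simp add: add.commute)
    finally show ?case .
  qed (simp add: 0)
  show ?thesis
  proof (cases "s = 0")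
    case False
    have "((\<lambda>h. \<gamma> h /\<^sub>R h) \<longlongrightarrow> v) (at 0)"
      using d unfolding has_vector_derivative_at_iff by (simp add: 0)
    moreover have "filterlim (\<lambda>n. s / real (Suc n)) (at 0) sequentially"
      unfolding filterlim_at
    proof
      show "(\<lambda>n. s / real (Suc n)) \<longlonglongrightarrow> 0"
        by real_asymp
    qed (use False in simp)
    ultimately have "(\<lambda>n. \<gamma> (s / real (Suc n)) /\<^sub>R (s / real (Suc n))) \<longlonglongrightarrow> v"
      by (rule filterlim_compose)
    moreover have "\<gamma> (s / real (Suc n)) /\<^sub>R (s / real (Suc n)) = \<gamma> s /\<^sub>R s" for n
    proof -
      have "\<gamma> s = real (Suc n) *\<^sub>R \<gamma> (s / real (Suc n))"
        using n[of "Suc n" "s / real (Suc n)"] by (simp del: of_nat_Suc)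
      then show ?thesis
        by (simp add: divide_inverse del: of_nat_Suc)
    qed
    ultimately have "\<gamma> s /\<^sub>R s = v"
      by (simp add: LIMSEQ_const_iff)
    then show ?thesis
      using False by auto
  qed (simp add: 0)
qed

section \<open>The adjoint action and the Jacobi identity\<close>

definition Ad :: "'a \<Rightarrow> 'a \<Rightarrow> 'a" where
  "Ad g y = mul (mul g y) (- g)"

lemma Ad_mul: "Ad g (mul x y) = mul (Ad g x) (Ad g y)"
  by (simp add: Ad_def assoc)

lemma Ad_Ad: "Ad g (Ad h y) = Ad (mul g h) y"
  by (simp add: Ad_def assoc uminus_mul)

lemma Ad_0 [simp]: "Ad 0 y = y" "Ad g 0 = 0"
  by (simp_all add: Ad_def)

lemma Ad_has_derivative: "(Ad g has_derivative (\<lambda>h. dmul (mul g y, - g) (dmul (g, y) (0, h), 0))) (at y)"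
  unfolding Ad_def[abs_def]
  by (intro mul_has_derivative has_derivative_const has_derivative_ident)

text \<open>Conjugation is an automorphism and maps the line through \<open>y\<close> to a
  one-parameter subgroup, which by \<open>one_parameter_line\<close> is again a line. Hence
  \<open>Ad g\<close> coincides with its own differential at \<open>0\<close>.\<close>

lemma linear_Ad: "linear (Ad g)"
proof -
  let ?L = "\<lambda>h. dmul (mul g 0, - g) (dmul (g, 0) (0, h), 0)"
  have L: "(Ad g has_derivative ?L) (at 0)"
    by (rule Ad_has_derivative)
  have "Ad g y = ?L y" for y
  proof -
    have "((\<lambda>s::real. s *\<^sub>R y) has_derivative (\<lambda>s. s *\<^sub>R y)) (at 0)"
      by (auto intro!: derivative_eq_intros)
    from has_derivative_compose[OF this, of "Ad g" ?L] L
    have "((\<lambda>s. Ad g (s *\<^sub>R y)) has_derivative (\<lambda>s. ?L (s *\<^sub>R y))) (at 0)"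
      by simp
    then have "((\<lambda>s. Ad g (s *\<^sub>R y)) has_vector_derivative ?L y) (at 0)"
      unfolding has_vector_derivative_def linear_cmul[OF has_derivative_linear[OF L]] .
    have "Ad g ((s + t) *\<^sub>R y) = mul (Ad g (s *\<^sub>R y)) (Ad g (t *\<^sub>R y))" for s t
      unfolding Ad_mul[symmetric] mul_scale ..
    from one_parameter_line[OF this \<open>(_ has_vector_derivative ?L y) (at 0)\<close>, of 1] show ?thesis
      by simp
  qed
  then have "Ad g = ?L"
    by auto
  with has_derivative_linear[OF L] show ?thesis
    by simp
qed

text \<open>A linear automorphism of the group transports left-invariant fields, and therefore, in
  \<open>Ad_beta\<close>, their derivatives at the neutral element.\<close>

lemma Ad_X: "Ad g (X v k) = X (Ad g v) (Ad g k)"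
proof -
  have "((\<lambda>s. Ad g (mul k (s *\<^sub>R v))) has_vector_derivative Ad g (X v k)) (at 0)"
    by (rule bounded_linear.has_vector_derivative[OF linear_conv_bounded_linear[THEN iffD1, OF linear_Ad] curve_derivative_0])
  moreover have "Ad g (mul k (s *\<^sub>R v)) = mul (Ad g k) (s *\<^sub>R Ad g v)" for s
    by (simp add: Ad_mul linear_cmul[OF linear_Ad])
  ultimately have "((\<lambda>s. mul (Ad g k) (s *\<^sub>R Ad g v)) has_vector_derivative Ad g (X v k)) (at 0)"
    by simp
  then show ?thesis
    by (rule vector_derivative_unique_at[OF _ curve_derivative_0])
qed

lemma Ad_beta: "Ad g (\<beta> x v) = \<beta> (Ad g x) (Ad g v)"
proof -
  have "((\<lambda>s. Ad g (X v (s *\<^sub>R x))) has_vector_derivative Ad g (\<beta> x v)) (at 0)"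
    by (rule bounded_linear.has_vector_derivative[OF linear_conv_bounded_linear[THEN iffD1, OF linear_Ad] X_line_derivative])
  moreover have "Ad g (X v (s *\<^sub>R x)) = X (Ad g v) (s *\<^sub>R Ad g x)" for s
    by (simp add: Ad_X linear_cmul[OF linear_Ad])
  ultimately have "((\<lambda>s. X (Ad g v) (s *\<^sub>R Ad g x)) has_vector_derivative Ad g (\<beta> x v)) (at 0)"
    by simp
  then show ?thesis
    by (rule vector_derivative_unique_at[OF _ X_line_derivative])
qed

text \<open>Existence only. The value is afterwards forced by the implicit equation in
  \<open>Ad_line_derivative_0\<close>.\<close>

lemma Ad_line_differentiable: "\<exists>w. ((\<lambda>s. Ad (s *\<^sub>R x) y) has_vector_derivative w) (at 0)"
proof -
  have 1: "((\<lambda>s. s *\<^sub>R x) has_vector_derivative x) (at 0)"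
    by (auto intro!: derivative_eq_intros)
  have 2: "((\<lambda>s. - (s *\<^sub>R x)) has_vector_derivative - x) (at 0)"
    by (rule has_vector_derivative_minus[OF 1])
  show ?thesis
    unfolding Ad_def using mul_has_vector_derivative[OF mul_has_vector_derivative[OF 1 has_vector_derivative_const] 2]
    by blast
qed

text \<open>The right-invariant field with value \<open>w\<close> at \<open>0\<close> is \<open>g \<mapsto> X w (- g)\<close>, since inversion is \<open>g \<mapsto> - g\<close>.\<close>

lemma right_curve_derivative_0: "((\<lambda>s. mul (s *\<^sub>R w) g) has_vector_derivative X w (- g)) (at 0)"
proof -
  have "((\<lambda>s. - mul (- g) (s *\<^sub>R (- w))) has_vector_derivative - X (- w) (- g)) (at 0)"
    by (rule has_vector_derivative_minus[OF curve_derivative_0])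
  then show ?thesis
    by (simp add: uminus_mul linear_neg[OF linear_X])
qed

lemma Ad_X_line: "X (Ad g y) (- g) = X y g"
proof -
  have "mul (s *\<^sub>R Ad g y) g = mul g (s *\<^sub>R y)" for s
    unfolding linear_cmul[OF linear_Ad, symmetric] by (simp add: Ad_def assoc)
  then have "((\<lambda>s. mul g (s *\<^sub>R y)) has_vector_derivative X (Ad g y) (- g)) (at 0)"
    using right_curve_derivative_0[of "Ad g y" g] by simp
  then show ?thesis
    by (rule vector_derivative_unique_at[OF _ curve_derivative_0])
qed

text \<open>The differential of \<open>Ad\<close> is the bracket. With \<open>w\<close> the unknown
  derivative, differentiating \<open>Ad_X_line\<close> at \<open>g = s *\<^sub>R x\<close> in
  \<open>s = 0\<close> gives \<open>\<beta> (- x) y + w = \<beta> x y\<close>, which determines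
  \<open>w\<close>.\<close>

lemma Ad_line_derivative_0: "((\<lambda>s. Ad (s *\<^sub>R x) y) has_vector_derivative 2 *\<^sub>R \<beta> x y) (at 0)"
proof -
  let ?w = "\<lambda>s. Ad (s *\<^sub>R x) y"
  obtain w where w: "(?w has_vector_derivative w) (at 0)"
    using Ad_line_differentiable by blast
  \<comment> \<open>\<open>X\<close> is linear in its first argument; expanding that argument in a
    basis separates the two dependences on \<open>s\<close>, so that the product rule
    applies.\<close>
  have eq: "(\<Sum>b\<in>Basis. (?w s \<bullet> b) *\<^sub>R X b (s *\<^sub>R (- x))) = X y (s *\<^sub>R x)" for s
  proof -
    have "X (\<Sum>b\<in>Basis. (?w s \<bullet> b) *\<^sub>R b) (s *\<^sub>R (- x)) = X y (s *\<^sub>R x)"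
      unfolding euclidean_representation using Ad_X_line[of "s *\<^sub>R x" y] by simp
    then show ?thesis
      by (simp add: linear_sum[OF linear_X] linear_cmul[OF linear_X])
  qed
  have "((\<lambda>s. \<Sum>b\<in>Basis. (?w s \<bullet> b) *\<^sub>R X b (s *\<^sub>R (- x))) has_vector_derivative
      (\<Sum>b\<in>Basis. (?w 0 \<bullet> b) *\<^sub>R \<beta> (- x) b + (w \<bullet> b) *\<^sub>R X b (0 *\<^sub>R (- x)))) (at 0)"
    by (intro has_vector_derivative_sum has_vector_derivative_scaleR X_line_derivative)
      (use bounded_linear.has_vector_derivative[OF bounded_linear_inner_left w] in
        \<open>simp add: has_real_derivative_iff_has_vector_derivative\<close>)
  moreover have "(\<Sum>b\<in>Basis. (?w 0 \<bullet> b) *\<^sub>R \<beta> (- x) b + (w \<bullet> b) *\<^sub>R X b (0 *\<^sub>R (- x))) = \<beta> (- x) y + w"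
  proof -
    have "\<beta> (- x) (\<Sum>b\<in>Basis. (y \<bullet> b) *\<^sub>R b) = (\<Sum>b\<in>Basis. (y \<bullet> b) *\<^sub>R \<beta> (- x) b)"
      by (simp add: linear_sum[OF linear_beta_right] linear_cmul[OF linear_beta_right])
    then show ?thesis
      by (simp add: sum.distrib euclidean_representation)
  qed
  ultimately have "((\<lambda>s. X y (s *\<^sub>R x)) has_vector_derivative \<beta> (- x) y + w) (at 0)"
    unfolding eq by simp
  then have "\<beta> (- x) y + w = \<beta> x y"
    by (rule vector_derivative_unique_at[OF _ X_line_derivative])
  then have "w = 2 *\<^sub>R \<beta> x y"
    by (simp add: linear_neg[OF linear_beta_left] scaleR_2 algebra_simps)
  with w show ?thesis by simp
qed

text \<open>Differentiate \<open>Ad_beta\<close> along the line through \<open>x\<close>: that every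
  \<open>Ad (s *\<^sub>R x)\<close> respects \<open>\<beta>\<close> becomes, at
  \<open>s = 0\<close>, the derivation property of \<open>\<beta> x\<close>. The common factor 2
  cancels.\<close>

lemma jacobi: "\<beta> x (\<beta> y z) = \<beta> (\<beta> x y) z + \<beta> y (\<beta> x z)"
proof -
  have "((\<lambda>s. Ad (s *\<^sub>R x) (\<beta> y z)) has_vector_derivative
     \<beta> (Ad (0 *\<^sub>R x) y) (2 *\<^sub>R \<beta> x z) + \<beta> (2 *\<^sub>R \<beta> x y) (Ad (0 *\<^sub>R x) z)) (at 0)"
    unfolding Ad_beta
    by (intro bounded_bilinear.has_vector_derivative[OF bounded_bilinear_beta] Ad_line_derivative_0)
  from vector_derivative_unique_at[OF Ad_line_derivative_0 this]
  have "2 *\<^sub>R \<beta> x (\<beta> y z) = \<beta> y (2 *\<^sub>R \<beta> x z) + \<beta> (2 *\<^sub>R \<beta> x y) z"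
    by simp
  then have "2 *\<^sub>R \<beta> x (\<beta> y z) = 2 *\<^sub>R (\<beta> (\<beta> x y) z + \<beta> y (\<beta> x z))"
    by (simp add: linear_cmul[OF linear_beta_left] linear_cmul[OF linear_beta_right] scaleR_add_right add.commute)
  then show ?thesis
    by (simp only: scaleR_cancel_left) simp
qed

end

section \<open>Projection onto the first layer\<close>

context lie_log
begin

context
  fixes l :: "'a \<Rightarrow> real"
  assumes l: "linear l" and l_beta: "\<And>x y. l (\<beta> x y) = 0"
begin

lemma bounded_linear_l: "bounded_linear l"
  using l by (simp add: linear_conv_bounded_linear)

text \<open>\<open>Ad\<close> is an action, so the difference quotient at \<open>s\<close> is the
  one at \<open>0\<close> applied to \<open>Ad (s *\<^sub>R g) y\<close>. Its limit is a multiple of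
  a value of \<open>\<beta>\<close>, on which \<open>l\<close> vanishes.\<close>

lemma l_Ad: "l (Ad g y) = l y"
proof -
  have "((\<lambda>s. l (Ad (s *\<^sub>R g) y)) has_vector_derivative 0) (at s within {0..1})" for s
  proof -
    have "((\<lambda>h. l ((Ad (h *\<^sub>R g) (Ad (s *\<^sub>R g) y) - Ad (s *\<^sub>R g) y) /\<^sub>R h)) \<longlongrightarrow> l (2 *\<^sub>R \<beta> g (Ad (s *\<^sub>R g) y))) (at 0)"
      using Ad_line_derivative_0[of g "Ad (s *\<^sub>R g) y"] unfolding has_vector_derivative_at_iff
      by (intro bounded_linear.tendsto[OF bounded_linear_l]) simp
    then have "((\<lambda>h. (l (Ad ((s + h) *\<^sub>R g) y) - l (Ad (s *\<^sub>R g) y)) /\<^sub>R h) \<longlongrightarrow> 0) (at 0)"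
      by (simp add: linear_cmul[OF l] linear_diff[OF l] l_beta Ad_Ad mul_scale add.commute)
    then have "((\<lambda>s. l (Ad (s *\<^sub>R g) y)) has_vector_derivative 0) (at s)"
      by (simp add: has_vector_derivative_at_iff)
    then show ?thesis
      by (rule has_vector_derivative_at_within)
  qed
  from has_vector_derivative_zero_constant[OF convex_real_interval(5) this]
  obtain c where "\<And>s. s \<in> {0..1} \<Longrightarrow> l (Ad (s *\<^sub>R g) y) = c"
    by blast
  from this[of 0] this[of 1] show ?thesis
    by simp
qed

text \<open>For \<open>\<phi> s \<epsilon> = mul (- (s x)) (s (x + \<epsilon> v))\<close> one has \<open>\<phi> (s + h) \<epsilon> = mul (Ad (- (h x)) (\<phi> s \<epsilon>)) (\<phi> h \<epsilon>)\<close>;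
  hence \<open>s \<mapsto> l (\<partial>\<^sub>\<epsilon> \<phi> s 0)\<close> is additive.\<close>

lemma l_dmul: "l (dmul (- x, x) (0, v)) = l v"
proof -
  define \<phi> where "\<phi> s \<epsilon> = mul (- (s *\<^sub>R x)) (s *\<^sub>R (x + \<epsilon> *\<^sub>R v))" for s \<epsilon> :: real
  define M where "M s = dmul (- (s *\<^sub>R x), s *\<^sub>R x) (0, s *\<^sub>R v)" for s
  have \<phi>_0: "\<phi> s 0 = 0" for s
    by (simp add: \<phi>_def)
  have d\<phi>: "(\<phi> s has_vector_derivative M s) (at 0)" for s
  proof -
    have "((\<lambda>\<epsilon>. s *\<^sub>R (x + \<epsilon> *\<^sub>R v)) has_vector_derivative s *\<^sub>R v) (at 0)"
      by (auto intro!: derivative_eq_intros)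
    from mul_has_vector_derivative[OF has_vector_derivative_const this] show ?thesis
      by (simp add: \<phi>_def[abs_def] M_def)
  qed
  have cocycle: "\<phi> (s + h) \<epsilon> = mul (Ad (- (h *\<^sub>R x)) (\<phi> s \<epsilon>)) (\<phi> h \<epsilon>)" for s h \<epsilon>
  proof -
    have 1: "- ((s + h) *\<^sub>R x) = mul (- (h *\<^sub>R x)) (- (s *\<^sub>R x))"
      using mul_scale[of "- h" x "- s"] by (simp add: algebra_simps)
    have 2: "(s + h) *\<^sub>R y = mul (s *\<^sub>R y) (h *\<^sub>R y)" for y
      by (simp add: mul_scale)
    show ?thesis
      unfolding \<phi>_def Ad_def 1 2 by (simp add: assoc uminus_mul)
  qed
  have M_add: "M (s + h) = Ad (- (h *\<^sub>R x)) (M s) + M h" for s h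
  proof -
    let ?A = "Ad (- (h *\<^sub>R x))"
    have "((\<lambda>\<epsilon>. mul (?A (\<phi> s \<epsilon>)) (\<phi> h \<epsilon>)) has_vector_derivative dmul (?A (\<phi> s 0), \<phi> h 0) (?A (M s), M h)) (at 0)"
      by (intro mul_has_vector_derivative d\<phi>
          bounded_linear.has_vector_derivative[OF linear_conv_bounded_linear[THEN iffD1, OF linear_Ad]])
    then have "(\<phi> (s + h) has_vector_derivative ?A (M s) + M h) (at 0)"
      by (simp add: cocycle[abs_def, symmetric] cocycle[symmetric] \<phi>_0 dmul_0)
    then show ?thesis
      using d\<phi> vector_derivative_unique_at by blast
  qed
  have lM_n: "l (M (real n * s)) = real n * l (M s)" for n s
  proof (induction n)
    case 0
    have "M 0 = 0"
      using linear_0[OF linear_dmul] by (simp add: M_def flip: zero_prod_def)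
    then show ?case
      using linear_0[OF l] by simp
  next
    case (Suc n)
    have "l (M (real (Suc n) * s)) = l (M (real n * s + s))"
      by (simp add: algebra_simps)
    also have "\<dots> = real (Suc n) * l (M s)"
      unfolding M_add linear_add[OF l] l_Ad Suc by (simp add: algebra_simps)
    finally show ?case .
  qed
  \<comment> \<open>By additivity \<open>l (M 1)\<close> is \<open>n\<close> times
    \<open>l (M (1 / n))\<close>, that is, \<open>l\<close> of the differential taken at the point
    scaled by \<open>1 / n\<close>. These points tend to the neutral element, where
    \<open>dmul_0\<close> gives \<open>l v\<close>.\<close>
  have "(\<lambda>n. l (dmul (- ((1 / real (Suc n)) *\<^sub>R x), (1 / real (Suc n)) *\<^sub>R x) (0, v))) \<longlonglongrightarrow> l (dmul (- (0 *\<^sub>R x), 0 *\<^sub>R x) (0, v))"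
  proof (intro bounded_linear.tendsto[OF bounded_linear_l] continuous_on_tendsto_compose[OF continuous_on_dmul])
    have "(\<lambda>n. 1 / real (Suc n)) \<longlonglongrightarrow> 0"
      by real_asymp
    then show "(\<lambda>n. (- ((1 / real (Suc n)) *\<^sub>R x), (1 / real (Suc n)) *\<^sub>R x)) \<longlonglongrightarrow> (- (0 *\<^sub>R x), 0 *\<^sub>R x)"
      by (intro tendsto_intros)
  qed auto
  moreover have "l (dmul (- ((1 / real (Suc n)) *\<^sub>R x), (1 / real (Suc n)) *\<^sub>R x) (0, v)) = l (M 1)" for n
  proof -
    have "M (1 / real (Suc n)) = (1 / real (Suc n)) *\<^sub>R
        dmul (- ((1 / real (Suc n)) *\<^sub>R x), (1 / real (Suc n)) *\<^sub>R x) (0, v)"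
      using linear_cmul[OF linear_dmul, of _ "1 / real (Suc n)" "(0, v)"] by (simp add: M_def del: of_nat_Suc)
    then show ?thesis
      using lM_n[of "Suc n" "1 / real (Suc n)"] by (simp add: linear_cmul[OF l] del: of_nat_Suc)
  qed
  ultimately have "l v = l (M 1)"
    by (simp add: LIMSEQ_const_iff dmul_0)
  then show ?thesis
    by (simp add: M_def)
qed

text \<open>Translating back by \<open>- g\<close> carries \<open>X v g\<close> to \<open>v\<close>,
  and by \<open>l_dmul\<close> this translation does not change the value of
  \<open>l\<close>.\<close>

lemma l_X: "l (X v g) = l v"
proof -
  have "((\<lambda>s. mul (- g) (mul g (s *\<^sub>R v))) has_vector_derivative dmul (- g, g) (0, X v g)) (at 0)"
    using mul_has_vector_derivative[OF has_vector_derivative_const curve_derivative_0, of "- g" g v] by simp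
  moreover have "((\<lambda>s. s *\<^sub>R v) has_vector_derivative v) (at 0)"
    by (auto intro!: derivative_eq_intros)
  ultimately have "dmul (- g, g) (0, X v g) = v"
    by (simp add: vector_derivative_unique_at)
  then show ?thesis
    using l_dmul[of g "X v g"] by simp
qed

text \<open>Along the integral curve from \<open>g\<close> to \<open>mul g v\<close> the functional
  has constant speed \<open>l v\<close>, by \<open>l_X\<close>.\<close>

lemma linear_functional_mul: "l (mul g v) = l g + l v"
proof -
  define h where "h s = l (mul g (s *\<^sub>R v)) - s * l v" for s :: real
  have "(h has_vector_derivative 0) (at s within {0..1})" for s
  proof -
    have "((\<lambda>s. l (mul g (s *\<^sub>R v))) has_vector_derivative l v) (at s)"
      using bounded_linear.has_vector_derivative[OF bounded_linear_l curve_derivative] by (simp add: l_X)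
    moreover have "((\<lambda>s. s * l v) has_vector_derivative l v) (at s)"
      unfolding has_real_derivative_iff_has_vector_derivative[symmetric] by (auto intro!: derivative_eq_intros)
    ultimately have "(h has_vector_derivative l v - l v) (at s)"
      unfolding h_def by (rule has_vector_derivative_diff)
    then show ?thesis
      by (simp add: has_vector_derivative_at_within)
  qed
  from has_vector_derivative_zero_constant[OF convex_real_interval(5) this]
  obtain c where "\<And>s. s \<in> {0..1} \<Longrightarrow> h s = c"
    by blast
  from this[of 0] this[of 1] show ?thesis
    by (simp add: h_def)
qed

end

end

section \<open>Brackets in a stratified algebra\<close>

locale carnot =
  fixes mul :: "'a::euclidean_space \<Rightarrow> 'a \<Rightarrow> 'a" and r :: nat and V :: "nat \<Rightarrow> 'a set"
  assumes carnot_group: "carnot_group mul r V"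
begin

sublocale lie_log mul
  using carnot_group by unfold_locales (simp add: carnot_group_def)

text \<open>The stratification speaks only of brackets with an element of \<open>V 1\<close>, which
  land in higher layers or vanish. Brackets of two higher layers are reduced to these by the Jacobi
  identity.\<close>

lemma beta_orthogonal_first_layer:
  assumes "w \<in> V 1"
  shows "\<beta> x y \<bullet> w = 0"
proof -
  have r: "1 \<le> r" and sub: "\<And>j. j \<in> {1..r} \<Longrightarrow> subspace (V j)"
    and orth: "\<And>i j x y. i \<in> {1..r} \<Longrightarrow> j \<in> {1..r} \<Longrightarrow> i \<noteq> j \<Longrightarrow> x \<in> V i \<Longrightarrow> y \<in> V j \<Longrightarrow> x \<bullet> y = 0"
    and span: "span (\<Union>j\<in>{1..r}. V j) = UNIV"
    and br: "\<And>j. j \<in> {1..<r} \<Longrightarrow> bracket_space mul (V 1) (V j) = V (Suc j)"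
    and br_r: "bracket_space mul (V 1) (V r) = {0}"
    using carnot_group unfolding carnot_group_def by blast+
  define W where "W = {x. \<forall>w\<in>V 1. x \<bullet> w = 0}"
  have W: "subspace W"
    by (auto simp: W_def subspace_def inner_add_left)
  have ind: "y \<in> span A \<Longrightarrow> (\<And>a. a \<in> A \<Longrightarrow> f a \<in> W) \<Longrightarrow> linear f \<Longrightarrow> f y \<in> W" for y A and f :: "'a \<Rightarrow> 'a"
  proof (induction rule: span_induct_alt)
    case base
    then show ?case by (simp add: linear_0 subspace_0[OF W])
  next
    case (step c x y)
    then show ?case by (simp add: linear_add linear_cmul subspace_add[OF W] subspace_mul[OF W])
  qed
  have half: "2 *\<^sub>R z \<in> W \<Longrightarrow> z \<in> W" for z
    using subspace_mul[OF W, of "2 *\<^sub>R z" "1 / 2"] by simp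
  have first: "\<beta> x y \<in> W" if x: "x \<in> V 1" for x y
  proof -
    have "\<beta> x y \<in> W" if y: "y \<in> V j" and j: "j \<in> {1..r}" for y j
    proof -
      have "lie_bracket mul x y \<in> bracket_space mul (V 1) (V j)"
        unfolding bracket_space_def using x y by (blast intro: span_base)
      moreover have "bracket_space mul (V 1) (V j) \<subseteq> W"
      proof (cases "j = r")
        case True
        then show ?thesis
          using br_r by (simp add: subspace_0[OF W])
      next
        case False
        then have "bracket_space mul (V 1) (V j) = V (Suc j)"
          using br j by simp
        then show ?thesis
          using orth[of "Suc j" 1] False j r by (auto simp: W_def)
      qed
      ultimately show ?thesis
        unfolding lie_bracket_eq by (blast intro: half)
    qed
    then show ?thesis
      using ind[of y "\<Union>j\<in>{1..r}. V j" "\<beta> x", OF _ _ linear_beta_right] span by blast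
  qed
  \<comment> \<open>Induction on the layer of \<open>x\<close>: an element of the next layer is a
    combination of brackets of \<open>a \<in> V 1\<close> with \<open>b\<close> in the current one,
    and Jacobi rewrites its bracket with \<open>y\<close> by brackets whose outermost left entry is
    \<open>a\<close> or \<open>b\<close>.\<close>
  have layer: "\<beta> x y \<in> W" if "x \<in> V (Suc j)" "Suc j \<le> r" for x y j
    using that
  proof (induction j arbitrary: x y)
    case 0
    then show ?case using first by simp
  next
    case (Suc j)
    have "V (Suc (Suc j)) = span {lie_bracket mul a b | a b. a \<in> V 1 \<and> b \<in> V (Suc j)}"
      using br[of "Suc j"] Suc.prems by (simp add: bracket_space_def)
    with Suc.prems have x: "x \<in> span {lie_bracket mul a b | a b. a \<in> V 1 \<and> b \<in> V (Suc j)}"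
      by simp
    have "\<beta> (lie_bracket mul a b) y \<in> W" if ab: "a \<in> V 1" "b \<in> V (Suc j)" for a b
    proof -
      have "\<beta> (\<beta> a b) y = \<beta> a (\<beta> b y) - \<beta> b (\<beta> a y)"
        using jacobi[of a b y] by simp
      also have "\<dots> \<in> W"
        by (intro subspace_diff[OF W] first Suc.IH ab) (use Suc.prems in simp)
      finally show ?thesis
        by (simp add: lie_bracket_eq linear_cmul[OF linear_beta_left] subspace_mul[OF W])
    qed
    with ind[OF x _ linear_beta_left, of y] show ?case
      by blast
  qed
  have "\<beta> x y \<in> W"
  proof (rule ind[OF _ _ linear_beta_left])
    show "x \<in> span (\<Union>j\<in>{1..r}. V j)"
      unfolding span by simp
    fix a assume "a \<in> (\<Union>j\<in>{1..r}. V j)"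
    then obtain j where "j \<in> {1..r}" "a \<in> V j" by blast
    then show "\<beta> a y \<in> W"
      using layer[of a "j - 1" y] by simp
  qed
  with assms show ?thesis
    by (simp add: W_def)
qed

lemma inner_first_layer_mul:
  assumes "w \<in> V 1"
  shows "mul x y \<bullet> w = x \<bullet> w + y \<bullet> w"
  by (rule linear_functional_mul[of "\<lambda>x. x \<bullet> w"])
    (simp_all add: beta_orthogonal_first_layer[OF assms] bounded_linear.linear bounded_linear_inner_left)

end

section \<open>Maps of class Ck\<close>

lemma Ck_on_cong:
  assumes "open S" "\<And>x. x \<in> S \<Longrightarrow> f x = g x" "Ck_on k S f"
  shows "Ck_on k S g"
  using assms(2,3)
proof (induction k arbitrary: f g)
  case 0
  then show ?case
    using continuous_on_eq[of S f g] by simp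
next
  case (Suc k)
  have d: "(g has_derivative frechet_derivative f (at x)) (at x)" if "x \<in> S" for x
  proof -
    have "(f has_derivative frechet_derivative f (at x)) (at x)"
      using Suc.prems(2) that unfolding frechet_derivative_works[symmetric] by simp
    then show ?thesis
      by (rule has_derivative_transform_within_open[OF _ assms(1) that Suc.prems(1)])
  qed
  have "frechet_derivative f (at x) v = frechet_derivative g (at x) v" if "x \<in> S" for x v
    using frechet_derivative_at[OF d[OF that]] by simp
  moreover have "Ck_on k S (\<lambda>x. frechet_derivative f (at x) v)" for v
    using Suc.prems(2) by simp
  ultimately have "Ck_on k S (\<lambda>x. frechet_derivative g (at x) v)" for v
    by (rule Suc.IH)
  then show ?case
    using differentiableI[OF d] by simp
qed

text \<open>Allows the derivative to be given by a formula. The formula and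
  \<open>frechet_derivative\<close> agree only on \<open>S\<close>, which is why openness and
  \<open>Ck_on_cong\<close> enter.\<close>

lemma Ck_on_SucI:
  assumes "open S" "\<And>x. x \<in> S \<Longrightarrow> (f has_derivative f' x) (at x)" "\<And>v. Ck_on k S (\<lambda>x. f' x v)"
  shows "Ck_on (Suc k) S f"
proof -
  have "f' x v = frechet_derivative f (at x) v" if "x \<in> S" for x v
    using frechet_derivative_at[OF assms(2)[OF that]] by simp
  then have "Ck_on k S (\<lambda>x. frechet_derivative f (at x) v)" for v
    by (rule Ck_on_cong[OF assms(1) _ assms(3)])
  then show ?thesis
    using differentiableI[OF assms(2)] by simp
qed

lemma Ck_on_SucD:
  assumes "Ck_on (Suc k) S f"
  shows "x \<in> S \<Longrightarrow> (f has_derivative frechet_derivative f (at x)) (at x)"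
    "Ck_on k S (\<lambda>x. frechet_derivative f (at x) v)"
  using assms unfolding frechet_derivative_works[symmetric] by simp_all

lemma Ck_on_Suc_le: "open S \<Longrightarrow> Ck_on (Suc k) S f \<Longrightarrow> Ck_on k S f"
proof (induction k arbitrary: f)
  case 0
  then show ?case
    by (auto simp: continuous_on_eq_continuous_at intro!: differentiable_imp_continuous_within)
next
  case (Suc k)
  show ?case
    unfolding Ck_on.simps(2)[of k]
    using Suc.prems(2)[unfolded Ck_on.simps(2)[of "Suc k"]] Suc.IH[OF Suc.prems(1)] by blast
qed

lemma Ck_on_const: "open S \<Longrightarrow> Ck_on k S (\<lambda>_. c)"
proof (induction k arbitrary: c)
  case (Suc k)
  show ?case
    by (rule Ck_on_SucI[where f'="\<lambda>_ _. 0"]) (use Suc in simp_all)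
qed simp

lemma Ck_on_bounded_linear:
  assumes "open S" "bounded_linear f"
  shows "Ck_on k S f"
proof (cases k)
  case 0
  then show ?thesis
    using assms(2) by (simp add: linear_continuous_on)
next
  case (Suc k')
  show ?thesis
    unfolding Suc
    by (rule Ck_on_SucI[where f'="\<lambda>_. f"])
      (use assms in \<open>auto intro: Ck_on_const bounded_linear.has_derivative\<close>)
qed

lemma Ck_on_bounded_linear_comp:
  assumes "open S" "bounded_linear h" "Ck_on k S f"
  shows "Ck_on k S (\<lambda>x. h (f x))"
  using assms(3)
proof (induction k arbitrary: f)
  case 0
  then show ?case
    using bounded_linear.continuous_on[OF assms(2)] by auto
next
  case (Suc k)
  show ?case
    by (rule Ck_on_SucI[where f'="\<lambda>x v. h (frechet_derivative f (at x) v)"])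
      (use Suc assms in \<open>auto intro!: bounded_linear.has_derivative[OF assms(2)] Ck_on_SucD(1)[OF Suc.prems]\<close>)
qed

lemma Ck_on_add:
  assumes "open S" "Ck_on k S f" "Ck_on k S g"
  shows "Ck_on k S (\<lambda>x. f x + g x)"
  using assms(2,3)
proof (induction k arbitrary: f g)
  case (Suc k)
  show ?case
    by (rule Ck_on_SucI[where f'="\<lambda>x v. frechet_derivative f (at x) v + frechet_derivative g (at x) v"])
      (use Suc assms in \<open>auto intro!: has_derivative_add Ck_on_SucD(1)[OF Suc.prems(1)] Ck_on_SucD(1)[OF Suc.prems(2)]\<close>)
qed (auto intro: continuous_on_add)

lemma Ck_on_sum:
  assumes "open S" "\<And>i. i \<in> I \<Longrightarrow> Ck_on k S (f i)"
  shows "Ck_on k S (\<lambda>x. \<Sum>i\<in>I. f i x)"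
  using assms(2)
proof (induction I rule: infinite_finite_induct)
  case (insert i I)
  then show ?case
    by (simp add: Ck_on_add[OF assms(1)])
qed (simp_all add: Ck_on_const[OF assms(1)])

lemma Ck_on_scaleR:
  assumes "open S" "Ck_on k S f" "Ck_on k S g"
  shows "Ck_on k S (\<lambda>x. f x *\<^sub>R g x)"
  using assms(2,3)
proof (induction k arbitrary: f g)
  case (Suc k)
  show ?case
  proof (rule Ck_on_SucI[where f'="\<lambda>x v. f x *\<^sub>R frechet_derivative g (at x) v + frechet_derivative f (at x) v *\<^sub>R g x"])
    show "((\<lambda>x. f x *\<^sub>R g x) has_derivative
        (\<lambda>v. f x *\<^sub>R frechet_derivative g (at x) v + frechet_derivative f (at x) v *\<^sub>R g x)) (at x)" if "x \<in> S" for x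
      using has_derivative_scaleR[OF Ck_on_SucD(1)[OF Suc.prems(1) that] Ck_on_SucD(1)[OF Suc.prems(2) that]] .
  qed (intro Ck_on_add assms(1) Suc.IH Ck_on_Suc_le[OF assms(1) Suc.prems(1)] Ck_on_Suc_le[OF assms(1) Suc.prems(2)]
      Ck_on_SucD(2)[OF Suc.prems(1)] Ck_on_SucD(2)[OF Suc.prems(2)])+
qed (auto intro: continuous_on_scaleR)

lemma Ck_on_compose:
  fixes f :: "'b::euclidean_space \<Rightarrow> 'c::real_normed_vector" and g :: "'a::euclidean_space \<Rightarrow> 'b"
  assumes "open S" "open T" "g ` S \<subseteq> T" "Ck_on k T f" "Ck_on k S g"
  shows "Ck_on k S (\<lambda>x. f (g x))"
  using assms(4,5)
proof (induction k arbitrary: f)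
  case 0
  then show ?case
    using assms(3) by (auto intro: continuous_on_compose2)
next
  case (Suc k)
  let ?f' = "\<lambda>y. frechet_derivative f (at y)" and ?g' = "\<lambda>x. frechet_derivative g (at x)"
  have f': "(f has_derivative ?f' (g x)) (at (g x))" if "x \<in> S" for x
    using Ck_on_SucD(1)[OF Suc.prems(1)] that assms(3) by blast
  show ?case
  proof (rule Ck_on_SucI[OF assms(1)])
    fix x assume x: "x \<in> S"
    have "((\<lambda>x. f (g x)) has_derivative (\<lambda>v. ?f' (g x) (?g' x v))) (at x)"
      by (rule has_derivative_compose[OF Ck_on_SucD(1)[OF Suc.prems(2) x] f'[OF x]])
    \<comment> \<open>The induction hypothesis treats the derivative of \<open>f\<close> in a fixed
      direction, whereas the direction \<open>?g' x v\<close> moves with \<open>x\<close>. Expansion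
      in the basis restores fixed directions.\<close>
    also have "(\<lambda>v. ?f' (g x) (?g' x v)) = (\<lambda>v. \<Sum>b\<in>Basis. (?g' x v \<bullet> b) *\<^sub>R ?f' (g x) b)"
      using has_derivative_linear[OF f'[OF x]]
      by (subst euclidean_representation[of "?g' x _", symmetric]) (simp add: linear_sum linear_cmul)
    finally show "((\<lambda>x. f (g x)) has_derivative (\<lambda>v. \<Sum>b\<in>Basis. (?g' x v \<bullet> b) *\<^sub>R ?f' (g x) b)) (at x)" .
  next
    fix v
    show "Ck_on k S (\<lambda>x. \<Sum>b\<in>Basis. (?g' x v \<bullet> b) *\<^sub>R ?f' (g x) b)"
      by (intro Ck_on_sum Ck_on_scaleR assms(1) Suc.IH Ck_on_SucD(2)[OF Suc.prems(1)] Ck_on_Suc_le[OF _ Suc.prems(2)]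
          Ck_on_bounded_linear_comp[OF _ bounded_linear_inner_left] Ck_on_SucD(2)[OF Suc.prems(2)])
  qed
qed

lemma Ck_on_Pair:
  assumes "open S" "Ck_on k S f" "Ck_on k S g"
  shows "Ck_on k S (\<lambda>x. (f x, g x))"
proof -
  have "Ck_on k S (\<lambda>x. (f x, 0) + (0, g x))"
    by (intro Ck_on_add[OF assms(1)] Ck_on_bounded_linear_comp[OF assms(1) _ assms(2)]
        Ck_on_bounded_linear_comp[OF assms(1) _ assms(3)])
       (auto intro!: bounded_linear_Pair bounded_linear_ident bounded_linear_zero)
  then show ?thesis
    by simp
qed

section \<open>Test functions\<close>

lemma smooth_on_compose:
  fixes f :: "'b::euclidean_space \<Rightarrow> 'c::real_normed_vector" and g :: "'a::euclidean_space \<Rightarrow> 'b"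
  assumes "smooth_on T f" "smooth_on S g" "g ` S \<subseteq> T"
  shows "smooth_on S (\<lambda>x. f (g x))"
  using assms Ck_on_compose unfolding smooth_on_def by blast

lemma compact_closure_subset:
  fixes K :: "'a::heine_borel set"
  shows "compact K \<Longrightarrow> S \<subseteq> K \<Longrightarrow> compact (closure S)"
  by (meson bounded_subset closure_minimal compact_closure compact_eq_bounded_closed)

lemma C0_fun_compact_support:
  fixes u :: "'a::euclidean_space \<Rightarrow> real"
  assumes "continuous_on UNIV u" "compact (closure {x. u x \<noteq> 0})"
  shows "C0_fun u"
proof -
  have "bounded {x. u x \<noteq> 0}"
    using assms(2) by (simp add: compact_closure)
  then obtain B where "\<And>x. u x \<noteq> 0 \<Longrightarrow> norm x \<le> B"
    unfolding bounded_iff by blast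
  then have "eventually (\<lambda>x. u x = 0) at_infinity"
    unfolding eventually_at_infinity by (intro exI[of _ "B + 1"]) force
  then show ?thesis
    using assms(1) by (simp add: C0_fun_def tendsto_eventually)
qed

lemma test_fun_continuous: "test_fun u \<Longrightarrow> continuous_on UNIV u"
  by (simp add: test_fun_def smooth_on_continuous)

lemma test_fun_C0: "test_fun u \<Longrightarrow> C0_fun u"
  by (simp add: test_fun_def C0_fun_compact_support smooth_on_continuous)

lemma compact_support_mono:
  fixes f :: "'a::heine_borel \<Rightarrow> 'b::zero"
  assumes "compact (closure {x. f x \<noteq> 0})" "\<And>x. x \<notin> closure {x. f x \<noteq> 0} \<Longrightarrow> g x = 0"
  shows "compact (closure {x. g x \<noteq> 0})"
proof (rule compact_closure_subset[OF assms(1)], rule subsetI, rule ccontr)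
  fix x assume "x \<in> {x. g x \<noteq> 0}" "x \<notin> closure {x. f x \<noteq> 0}"
  with assms(2)[of x] show False
    by simp
qed

lemma zero_outside_support: "x \<notin> closure {x. f x \<noteq> 0} \<Longrightarrow> f x = 0"
  using closure_subset[of "{x. f x \<noteq> 0}"] by blast

lemma test_fun_add:
  assumes "test_fun f" "test_fun g"
  shows "test_fun (\<lambda>x. f x + g x)"
proof -
  have "{x. f x + g x \<noteq> 0} \<subseteq> closure {x. f x \<noteq> 0} \<union> closure {x. g x \<noteq> 0}"
  proof (rule subsetI, rule ccontr)
    fix x assume x: "x \<in> {x. f x + g x \<noteq> 0}" "x \<notin> closure {x. f x \<noteq> 0} \<union> closure {x. g x \<noteq> 0}"
    then have "f x = 0" "g x = 0"
      by (intro zero_outside_support; simp)+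
    with x(1) show False
      by simp
  qed
  moreover have "compact (closure {x. f x \<noteq> 0} \<union> closure {x. g x \<noteq> 0})"
    using assms by (intro compact_Un) (simp_all only: test_fun_def)
  ultimately have "compact (closure {x. f x + g x \<noteq> 0})"
    by (rule compact_closure_subset[rotated])
  then show ?thesis
    using assms Ck_on_add[of UNIV _ f g] by (simp add: test_fun_def smooth_on_def)
qed

lemma test_fun_cmult:
  assumes "test_fun f"
  shows "test_fun (\<lambda>x. c * f x)"
proof -
  have "compact (closure {x. c * f x \<noteq> 0})"
  proof (rule compact_support_mono)
    show "compact (closure {x. f x \<noteq> 0})"
      using assms by (simp only: test_fun_def)
    fix x assume "x \<notin> closure {x. f x \<noteq> 0}"
    then have "f x = 0"
      by (rule zero_outside_support)
    then show "c * f x = 0"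
      by simp
  qed
  then show ?thesis
    using assms Ck_on_bounded_linear_comp[OF _ bounded_linear_mult_right, of UNIV _ f c]
    by (simp add: test_fun_def smooth_on_def)
qed

lemma test_fun_sum:
  assumes "finite I" "I \<noteq> {}" "\<And>i. i \<in> I \<Longrightarrow> test_fun (f i)"
  shows "test_fun (\<lambda>x. \<Sum>i\<in>I. f i x)"
  using assms by (induction rule: finite_ne_induct) (simp_all add: test_fun_add)

lemma test_fun_mult_smooth:
  assumes "test_fun f" "smooth_on UNIV g"
  shows "test_fun (\<lambda>x. f x * g x)"
proof -
  have "compact (closure {x. f x * g x \<noteq> 0})"
  proof (rule compact_support_mono)
    show "compact (closure {x. f x \<noteq> 0})"
      using assms by (simp only: test_fun_def)
    fix x assume "x \<notin> closure {x. f x \<noteq> 0}"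
    then have "f x = 0"
      by (rule zero_outside_support)
    then show "f x * g x = 0"
      by simp
  qed
  then show ?thesis
    using assms Ck_on_scaleR[of UNIV _ f g]
    by (simp add: test_fun_def smooth_on_def)
qed

section \<open>Left translates and left-invariant derivatives of test functions\<close>

context lie_log
begin

lemma smooth_left_mul: "smooth_on UNIV (mul h)"
proof -
  have "smooth_on UNIV (\<lambda>x. (h, x))"
    by (simp add: smooth_on_def Ck_on_Pair Ck_on_const Ck_on_bounded_linear bounded_linear_ident)
  from smooth_on_compose[OF smooth_mul this] show ?thesis
    by simp
qed

lemma smooth_X: "smooth_on UNIV (X v)"
proof -
  have "smooth_on UNIV (\<lambda>x. (x, 0::'a))"
    by (simp add: smooth_on_def Ck_on_Pair Ck_on_const Ck_on_bounded_linear bounded_linear_ident)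
  from smooth_on_compose[OF smooth_on_frechet[OF smooth_mul] this] show ?thesis
    by (simp add: X_eq[abs_def] dmul_def)
qed

lemma compact_support_left_translate:
  assumes "compact (closure {x. u x \<noteq> (0::real)})"
  shows "compact (closure {x. u (mul h x) \<noteq> 0})"
proof -
  let ?K = "closure {x. u x \<noteq> 0}"
  have "compact (mul (- h) ` ?K)"
    using assms by (intro compact_continuous_image continuous_on_subset[OF smooth_on_continuous[OF smooth_left_mul]]) auto
  moreover have "{x. u (mul h x) \<noteq> 0} \<subseteq> mul (- h) ` ?K"
  proof
    fix x assume "x \<in> {x. u (mul h x) \<noteq> 0}"
    then have "mul h x \<in> ?K" "x = mul (- h) (mul h x)"
      using zero_outside_support[of "mul h x" u] by auto
    then show "x \<in> mul (- h) ` ?K" by blast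
  qed
  ultimately show ?thesis
    by (rule compact_closure_subset)
qed

lemma test_fun_left_translate: "test_fun u \<Longrightarrow> test_fun (\<lambda>x. u (mul h x))"
  using smooth_on_compose[OF _ smooth_left_mul, of UNIV u]
  unfolding test_fun_def by (simp only: compact_support_left_translate) simp

lemma left_inv_deriv_left_translate:
  "left_inv_deriv mul v (\<lambda>x. u (mul h x)) = (\<lambda>g. left_inv_deriv mul v u (mul h g))"
  by (simp add: left_inv_deriv_def[abs_def] assoc)

lemma horizontal_laplacian_left_translate:
  "horizontal_laplacian mul e (\<lambda>x. u (mul h x)) = (\<lambda>g. horizontal_laplacian mul e u (mul h g))"
  by (simp add: horizontal_laplacian_def[abs_def] left_inv_deriv_left_translate)

lemma left_inv_deriv_has_derivative:
  assumes "smooth_on UNIV u"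
  shows "((\<lambda>s. u (mul g (s *\<^sub>R v))) has_real_derivative frechet_derivative u (at g) (X v g)) (at 0)"
proof -
  have "(u has_derivative frechet_derivative u (at g)) (at g)"
    using assms by (simp add: smooth_on_has_derivative)
  then have "(u has_derivative frechet_derivative u (at g)) (at (mul g (0 *\<^sub>R v)))"
    by simp
  from has_derivative_compose[OF curve_derivative_0[unfolded has_vector_derivative_def] this]
  have "((\<lambda>s. u (mul g (s *\<^sub>R v))) has_derivative (\<lambda>s. frechet_derivative u (at g) (s *\<^sub>R X v g))) (at 0)" .
  moreover have "(\<lambda>s. frechet_derivative u (at g) (s *\<^sub>R X v g)) = (*) (frechet_derivative u (at g) (X v g))"
    using linear_cmul[OF has_derivative_linear[OF \<open>(u has_derivative _) (at g)\<close>]]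
    by (auto simp: mult.commute)
  ultimately show ?thesis
    by (simp add: has_field_derivative_def)
qed

lemma left_inv_deriv_eq:
  assumes "smooth_on UNIV u"
  shows "left_inv_deriv mul v u g = frechet_derivative u (at g) (X v g)"
  unfolding left_inv_deriv_def by (rule DERIV_imp_deriv[OF left_inv_deriv_has_derivative[OF assms]])

lemma curve_has_real_derivative:
  assumes "smooth_on UNIV u"
  shows "((\<lambda>s. u (mul g (s *\<^sub>R v))) has_real_derivative left_inv_deriv mul v u (mul g (s *\<^sub>R v))) (at s)"
proof -
  have "((\<lambda>k. u (mul (mul g (s *\<^sub>R v)) (k *\<^sub>R v))) has_real_derivative left_inv_deriv mul v u (mul g (s *\<^sub>R v))) (at 0)"
    unfolding left_inv_deriv_eq[OF assms] by (rule left_inv_deriv_has_derivative[OF assms])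
  then have "((\<lambda>k. u (mul g ((s + k) *\<^sub>R v))) has_real_derivative left_inv_deriv mul v u (mul g (s *\<^sub>R v))) (at 0)"
    by (simp add: assoc mul_scale)
  then show ?thesis
    by (simp add: DERIV_def)
qed

lemma smooth_left_inv_deriv:
  assumes "smooth_on UNIV u"
  shows "smooth_on UNIV (left_inv_deriv mul v u)"
proof -
  have "left_inv_deriv mul v u g = (\<Sum>b\<in>Basis. (X v g \<bullet> b) *\<^sub>R frechet_derivative u (at g) b)" for g
    unfolding left_inv_deriv_eq[OF assms]
    by (subst euclidean_representation[of "X v g", symmetric])
      (simp add: linear_sum[OF has_derivative_linear[OF smooth_on_has_derivative[OF assms]]]
        linear_cmul[OF has_derivative_linear[OF smooth_on_has_derivative[OF assms]]])
  moreover have "smooth_on UNIV (\<lambda>g. \<Sum>b\<in>Basis. (X v g \<bullet> b) *\<^sub>R frechet_derivative u (at g) b)"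
    unfolding smooth_on_def
    by (intro conjI allI Ck_on_sum Ck_on_scaleR Ck_on_bounded_linear_comp[OF _ bounded_linear_inner_left]
        smooth_on_Ck[OF smooth_X] smooth_on_Ck[OF smooth_on_frechet[OF assms]] open_UNIV)
  ultimately show ?thesis
    by presburger
qed

text \<open>Supports do not grow: off the closed support \<open>u\<close> vanishes on an open set,
  so its differential is zero there.\<close>

lemma test_fun_left_inv_deriv:
  assumes "test_fun u"
  shows "test_fun (left_inv_deriv mul v u)"
proof -
  have u: "smooth_on UNIV u"
    using assms by (simp add: test_fun_def)
  have "left_inv_deriv mul v u g = 0" if "g \<notin> closure {x. u x \<noteq> 0}" for g
  proof -
    have "((\<lambda>x. 0) has_derivative (\<lambda>h. 0)) (at g)"
      by simp
    then have "(u has_derivative (\<lambda>h. 0)) (at g)"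
      by (rule has_derivative_transform_within_open[of _ _ _ _ "- closure {x. u x \<noteq> 0}"])
        (use that closure_subset[of "{x. u x \<noteq> 0}"] in auto)
    from frechet_derivative_at[OF this, symmetric] show ?thesis
      by (simp add: left_inv_deriv_eq[OF u])
  qed
  moreover have "compact (closure {x. u x \<noteq> 0})"
    using assms by (simp only: test_fun_def)
  ultimately have "compact (closure {g. left_inv_deriv mul v u g \<noteq> 0})"
    by (rule compact_support_mono[rotated])
  then show ?thesis
    using smooth_left_inv_deriv[OF u] by (simp add: test_fun_def)
qed

lemma test_fun_horizontal_laplacian: "test_fun u \<Longrightarrow> test_fun (horizontal_laplacian mul e u)"
  unfolding horizontal_laplacian_def[abs_def] by (intro test_fun_sum test_fun_left_inv_deriv) auto

text \<open>Left translation is proper: if \<open>mul h x\<close> lies in a ball, then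
  \<open>x\<close> lies in the image of that ball under the continuous inverse
  \<open>mul (- h)\<close>, which is bounded.\<close>

lemma C0_fun_left_translate:
  assumes "C0_fun u"
  shows "C0_fun (\<lambda>x. u (mul h x))"
proof -
  have "filterlim (mul h) at_infinity at_infinity"
    unfolding filterlim_at_infinity[OF order_refl]
  proof (intro allI impI)
    fix R :: real assume "R > 0"
    have "compact (mul (- h) ` cball 0 R)"
      by (intro compact_continuous_image continuous_on_subset[OF smooth_on_continuous[OF smooth_left_mul]]) auto
    then have "\<exists>B. \<forall>y. norm y \<le> R \<longrightarrow> norm (mul (- h) y) \<le> B"
      using compact_imp_bounded[of "mul (- h) ` cball 0 R"]
      unfolding bounded_iff by (metis imageI mem_cball_0)
    then obtain B where B: "\<And>y. norm y \<le> R \<Longrightarrow> norm (mul (- h) y) \<le> B"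
      by blast
    show "\<forall>\<^sub>F x in at_infinity. R \<le> norm (mul h x)"
      unfolding eventually_at_infinity
    proof (intro exI allI impI)
      fix x :: 'a assume "B + 1 \<le> norm x"
      then show "R \<le> norm (mul h x)"
        using B[of "mul h x"] by (cases "norm (mul h x) \<le> R") auto
    qed
  qed
  then show ?thesis
    using assms filterlim_compose[of u _ at_infinity "mul h"]
      continuous_on_compose2[of UNIV u UNIV, OF _ smooth_on_continuous[OF smooth_left_mul]]
    by (simp add: C0_fun_def)
qed

text \<open>The Laplacian commutes with left translations on test functions, and composing with a
  translation preserves uniform limits.\<close>

lemma laplacian_closure_left_translate:
  assumes "(u, v) \<in> laplacian_closure_C0 mul e"
  shows "((\<lambda>x. u (mul h x)), (\<lambda>x. v (mul h x))) \<in> laplacian_closure_C0 mul e"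
proof -
  have shift: "uniform_limit UNIV (\<lambda>n x. f n (mul h x)) (\<lambda>x. g (mul h x)) sequentially"
    if "uniform_limit UNIV f g sequentially" for f :: "nat \<Rightarrow> 'a \<Rightarrow> real" and g
    using uniform_limit_compose'[OF that, of "mul h" UNIV] by simp
  obtain \<phi> where "C0_fun u" "C0_fun v" "\<forall>n. test_fun (\<phi> n)" "uniform_limit UNIV \<phi> u sequentially"
      "uniform_limit UNIV (\<lambda>n. horizontal_laplacian mul e (\<phi> n)) v sequentially"
    using assms unfolding laplacian_closure_C0_def by blast
  then show ?thesis
    using shift[of "\<lambda>n. horizontal_laplacian mul e (\<phi> n)" v]
    unfolding laplacian_closure_C0_def mem_Collect_eq prod.case
    by (intro conjI exI[of _ "\<lambda>n x. \<phi> n (mul h x)"])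
      (simp_all add: C0_fun_left_translate test_fun_left_translate shift horizontal_laplacian_left_translate)
qed

end

section \<open>Contraction semigroups\<close>

lemma C0_fun_lincomb:
  assumes "C0_fun u" "C0_fun v"
  shows "C0_fun (\<lambda>x. a * u x + b * v x)"
proof -
  have "((\<lambda>x. a * u x + b * v x) \<longlongrightarrow> a * 0 + b * 0) at_infinity"
    using assms by (intro tendsto_intros) (auto simp: C0_fun_def)
  then show ?thesis
    using assms by (auto simp: C0_fun_def intro!: continuous_intros)
qed

lemma C0_fun_diff: "C0_fun u \<Longrightarrow> C0_fun v \<Longrightarrow> C0_fun (\<lambda>x. u x - v x)"
  using C0_fun_lincomb[of u v 1 "-1"] by simp

lemma C0_fun_cmult: "C0_fun u \<Longrightarrow> C0_fun (\<lambda>x. c * u x)"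
  using C0_fun_lincomb[of u u c 0] by simp

lemma C0_fun_zero: "C0_fun (\<lambda>x. 0)"
  by (simp add: C0_fun_def)

lemma C0_fun_sum: "(\<And>i. i \<in> I \<Longrightarrow> C0_fun (f i)) \<Longrightarrow> C0_fun (\<lambda>x. \<Sum>i\<in>I. f i x)"
proof (induction I rule: infinite_finite_induct)
  case (insert i I)
  then show ?case
    using C0_fun_lincomb[of "f i" "\<lambda>x. \<Sum>i\<in>I. f i x" 1 1] by simp
qed (simp_all add: C0_fun_zero)

lemma C0_fun_uniform_closure:
  assumes "\<And>\<epsilon>. \<epsilon> > 0 \<Longrightarrow> \<exists>v. C0_fun v \<and> (\<forall>x. \<bar>u x - v x\<bar> \<le> \<epsilon>)"
  shows "C0_fun u"
proof -
  have "\<exists>v. C0_fun v \<and> (\<forall>x. \<bar>u x - v x\<bar> \<le> 1 / real (Suc n))" for n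
    by (rule assms) simp
  then obtain v where v: "\<And>n. C0_fun (v n)" "\<And>n x. \<bar>u x - v n x\<bar> \<le> 1 / real (Suc n)"
    by metis
  have lim: "uniform_limit UNIV v u sequentially"
  proof (rule uniform_limitI)
    fix e :: real assume "e > 0"
    then have "\<forall>\<^sub>F n in sequentially. 1 / real (Suc n) < e"
      by real_asymp
    then show "\<forall>\<^sub>F n in sequentially. \<forall>x\<in>UNIV. dist (v n x) (u x) < e"
    proof eventually_elim
      case (elim n)
      then show ?case
        using v(2)[of _ n] by (auto simp: dist_real_def abs_minus_commute intro: le_less_trans)
    qed
  qed
  have "continuous_on UNIV u"
    by (rule uniform_limit_theorem[OF _ lim]) (use v(1) in \<open>auto simp: C0_fun_def\<close>)
  moreover have "(u \<longlongrightarrow> 0) at_infinity"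
    unfolding tendsto_iff
  proof (intro allI impI)
    fix e :: real assume e: "e > 0"
    then obtain w where w: "C0_fun w" "\<And>x. \<bar>u x - w x\<bar> \<le> e / 2"
      using assms[of "e / 2"] by auto
    then have "\<forall>\<^sub>F x in at_infinity. dist (w x) 0 < e / 2"
      using e unfolding C0_fun_def tendsto_iff by (metis half_gt_zero)
    then show "\<forall>\<^sub>F x in at_infinity. dist (u x) 0 < e"
    proof eventually_elim
      case (elim x)
      then show ?case
        using w(2)[of x] abs_triangle_ineq[of "u x - w x" "w x"] by (simp add: dist_real_def)
    qed
  qed
  ultimately show ?thesis
    by (simp add: C0_fun_def)
qed

text \<open>The error depends only on the modulus of continuity, hence is uniform in any further
  parameter. So time integrals of \<open>P s u\<close> are uniform limits of finite sums, through
  which \<open>P\<close> passes by linearity.\<close>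

lemma riemann_sum_error:
  fixes f :: "real \<Rightarrow> real"
  assumes "\<delta> > 0" "continuous_on {a..a + real n * \<delta>} f"
    and "\<And>s s'. s \<in> {a..a + real n * \<delta>} \<Longrightarrow> s' \<in> {a..a + real n * \<delta>} \<Longrightarrow> \<bar>s - s'\<bar> \<le> \<delta> \<Longrightarrow> \<bar>f s - f s'\<bar> \<le> \<epsilon>"
  shows "\<bar>integral {a..a + real n * \<delta>} f - (\<Sum>j<n. \<delta> * f (a + real j * \<delta>))\<bar> \<le> real n * \<delta> * \<epsilon>"
  using assms(2,3)
proof (induction n)
  case (Suc n)
  let ?b = "a + real n * \<delta>" and ?c = "a + real (Suc n) * \<delta>"
  have bc: "a \<le> ?b" "?b \<le> ?c" "?c - ?b = \<delta>"
    using assms(1) by (auto simp: algebra_simps)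
  have sub: "{?b..?c} \<subseteq> {a..?c}"
    using bc(1) by (simp only: atLeastatMost_subset_iff) simp
  have cont: "continuous_on {?b..?c} f"
    by (rule continuous_on_subset[OF Suc.prems(1) sub])
  have int: "f integrable_on {a..?c}" "f integrable_on {?b..?c}"
    by (intro integrable_continuous_real Suc.prems(1) cont)+
  have IH: "\<bar>integral {a..?b} f - (\<Sum>j<n. \<delta> * f (a + real j * \<delta>))\<bar> \<le> real n * \<delta> * \<epsilon>"
    by (rule Suc.IH[OF continuous_on_subset[OF Suc.prems(1)] Suc.prems(2)]) (use bc in auto)
  have "\<bar>integral {?b..?c} f - \<delta> * f ?b\<bar> \<le> \<delta> * \<epsilon>"
  proof -
    have "integral {?b..?c} (\<lambda>s. f s - f ?b) = integral {?b..?c} f - \<delta> * f ?b"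
      using int bc by (subst Henstock_Kurzweil_Integration.integral_diff) (auto simp del: of_nat_Suc)
    moreover have "norm (integral {?b..?c} (\<lambda>s. f s - f ?b)) \<le> \<epsilon> * (?c - ?b)"
    proof (rule integral_bound[OF bc(2)])
      show "continuous_on {?b..?c} (\<lambda>s. f s - f ?b)"
        by (intro continuous_on_diff cont continuous_on_const)
      fix s assume s: "s \<in> {?b..?c}"
      then have "\<bar>s - ?b\<bar> \<le> \<delta>" "?b \<in> {a..?c}"
        using bc by (auto simp del: of_nat_Suc)
      then show "norm (f s - f ?b) \<le> \<epsilon>"
        unfolding real_norm_def by (intro Suc.prems(2) subsetD[OF sub s])
    qed
    ultimately show ?thesis
      using bc(3) by (simp add: mult.commute)
  qed
  moreover have "integral {a..?c} f = integral {a..?b} f + integral {?b..?c} f"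
    using Henstock_Kurzweil_Integration.integral_combine[OF bc(1,2) int(1)] by simp
  ultimately show ?case
    using IH by (simp add: algebra_simps)
qed simp

lemma integral_average_error:
  fixes f :: "real \<Rightarrow> real"
  assumes "h > 0" "continuous_on {a..a + h} f" "\<And>s. s \<in> {a..a + h} \<Longrightarrow> \<bar>f s - f a\<bar> \<le> \<epsilon>"
  shows "\<bar>integral {a..a + h} f / h - f a\<bar> \<le> \<epsilon>"
proof -
  have "integral {a..a + h} (\<lambda>s. f s - f a) = integral {a..a + h} f - h * f a"
    using assms by (subst Henstock_Kurzweil_Integration.integral_diff) (auto intro: integrable_continuous_real)
  moreover have "norm (integral {a..a + h} (\<lambda>s. f s - f a)) \<le> \<epsilon> * (a + h - a)"
    by (rule integral_bound) (use assms in \<open>auto intro!: continuous_intros\<close>)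
  ultimately have "\<bar>integral {a..a + h} f - h * f a\<bar> / h \<le> \<epsilon>"
    using assms(1) by (simp add: divide_le_eq)
  moreover have "integral {a..a + h} f / h - f a = (integral {a..a + h} f - h * f a) / h"
    using assms(1) by (simp add: field_simps)
  ultimately show ?thesis
    using assms(1) by (simp add: abs_divide)
qed

section \<open>Strong continuity, the generator and the density of its domain\<close>

locale C0_semigroup =
  fixes P :: "real \<Rightarrow> ('a::euclidean_space \<Rightarrow> real) \<Rightarrow> 'a \<Rightarrow> real"
  assumes contraction_semigroup: "contraction_semigroup_C0 P"
begin

lemma P_C0: "t \<ge> 0 \<Longrightarrow> C0_fun u \<Longrightarrow> C0_fun (P t u)"
  and P_lincomb: "t \<ge> 0 \<Longrightarrow> C0_fun u \<Longrightarrow> C0_fun v \<Longrightarrow> P t (\<lambda>x. a * u x + b * v x) = (\<lambda>x. a * P t u x + b * P t v x)"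
  and P_bound: "t \<ge> 0 \<Longrightarrow> C0_fun u \<Longrightarrow> (\<And>x. \<bar>u x\<bar> \<le> B) \<Longrightarrow> \<bar>P t u x\<bar> \<le> B"
  and P_0: "C0_fun u \<Longrightarrow> P 0 u = u"
  and P_add: "s \<ge> 0 \<Longrightarrow> t \<ge> 0 \<Longrightarrow> C0_fun u \<Longrightarrow> P (s + t) u = P s (P t u)"
  and P_lim: "C0_fun u \<Longrightarrow> uniform_limit UNIV (\<lambda>t. P t u) u (at_right 0)"
proof -
  note * = contraction_semigroup[unfolded contraction_semigroup_C0_def]
  show "t \<ge> 0 \<Longrightarrow> C0_fun u \<Longrightarrow> C0_fun (P t u)"
    using *[THEN conjunct1] by simp
  show "t \<ge> 0 \<Longrightarrow> C0_fun u \<Longrightarrow> C0_fun v \<Longrightarrow> P t (\<lambda>x. a * u x + b * v x) = (\<lambda>x. a * P t u x + b * P t v x)"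
    using *[THEN conjunct2, THEN conjunct1] by simp
  show "t \<ge> 0 \<Longrightarrow> C0_fun u \<Longrightarrow> (\<And>x. \<bar>u x\<bar> \<le> B) \<Longrightarrow> \<bar>P t u x\<bar> \<le> B"
    using *[THEN conjunct2, THEN conjunct2, THEN conjunct1] by simp
  show "C0_fun u \<Longrightarrow> P 0 u = u"
    using *[THEN conjunct2, THEN conjunct2, THEN conjunct2, THEN conjunct1] by simp
  show "s \<ge> 0 \<Longrightarrow> t \<ge> 0 \<Longrightarrow> C0_fun u \<Longrightarrow> P (s + t) u = P s (P t u)"
    using *[THEN conjunct2, THEN conjunct2, THEN conjunct2, THEN conjunct2, THEN conjunct1] by simp
  show "C0_fun u \<Longrightarrow> uniform_limit UNIV (\<lambda>t. P t u) u (at_right 0)"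
    using *[THEN conjunct2, THEN conjunct2, THEN conjunct2, THEN conjunct2, THEN conjunct2] by simp
qed

lemma P_diff: "t \<ge> 0 \<Longrightarrow> C0_fun u \<Longrightarrow> C0_fun v \<Longrightarrow> P t (\<lambda>x. u x - v x) x = P t u x - P t v x"
  using P_lincomb[of t u v 1 "-1"] by simp

lemma P_cmult: "t \<ge> 0 \<Longrightarrow> C0_fun u \<Longrightarrow> P t (\<lambda>x. c * u x) = (\<lambda>x. c * P t u x)"
  using P_lincomb[of t u u c 0] by simp

lemma P_sum:
  assumes "t \<ge> 0" "\<And>i. i \<in> I \<Longrightarrow> C0_fun (f i)"
  shows "P t (\<lambda>x. \<Sum>i\<in>I. f i x) = (\<lambda>x. \<Sum>i\<in>I. P t (f i) x)"
  using assms(2)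
proof (induction I rule: infinite_finite_induct)
  case (insert i I)
  then have "C0_fun (f i)" "C0_fun (\<lambda>x. \<Sum>i\<in>I. f i x)"
    by (auto intro!: C0_fun_sum)
  from P_lincomb[OF assms(1) this, of 1 1]
  have "P t (\<lambda>x. 1 * f i x + 1 * (\<Sum>i\<in>I. f i x)) = (\<lambda>x. 1 * P t (f i) x + 1 * P t (\<lambda>x. \<Sum>i\<in>I. f i x) x)" .
  then show ?case
    using insert by simp
qed (use P_cmult[OF assms(1) C0_fun_zero, of 0] in simp_all)

lemma P_dist:
  assumes "t \<ge> 0" "C0_fun u" "C0_fun v" "\<And>x. \<bar>u x - v x\<bar> \<le> B"
  shows "\<bar>P t u x - P t v x\<bar> \<le> B"
  using P_bound[OF assms(1) C0_fun_diff[OF assms(2,3)] assms(4)] by (simp add: P_diff assms)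

text \<open>For \<open>s \<le> t\<close> the difference is \<open>P s\<close> applied to
  \<open>P (t - s) u - u\<close> up to sign. The contraction property thus reduces every pair of
  times to continuity at \<open>0\<close>, uniformly in \<open>x\<close>.\<close>

lemma P_uniformly_continuous:
  assumes u: "C0_fun u" and e: "\<epsilon> > 0"
  obtains \<delta> where "\<delta> > 0"
    "\<And>s t x. s \<ge> 0 \<Longrightarrow> t \<ge> 0 \<Longrightarrow> \<bar>s - t\<bar> < \<delta> \<Longrightarrow> \<bar>P s u x - P t u x\<bar> \<le> \<epsilon>"
proof -
  have "\<forall>\<^sub>F t in at_right 0. \<forall>x\<in>UNIV. dist (P t u x) (u x) < \<epsilon>"
    by (rule uniform_limitD[OF P_lim[OF u] e])
  then obtain d where d: "d > 0" "\<And>t x. 0 < t \<Longrightarrow> t < d \<Longrightarrow> \<bar>P t u x - u x\<bar> < \<epsilon>"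
    unfolding eventually_at_right_field by (auto simp: dist_real_def)
  have small: "\<bar>P t u x - u x\<bar> \<le> \<epsilon>" if "0 \<le> t" "t < d" for t x
    using d(2)[of t x] that e P_0[OF u] by (cases "t = 0") auto
  have le: "\<bar>P s u x - P t u x\<bar> \<le> \<epsilon>" if "0 \<le> s" "s \<le> t" "t - s < d" for s t x
  proof -
    have "P t u = P s (P (t - s) u)"
      using P_add[of s "t - s" u] that u by simp
    then show ?thesis
      using P_dist[of s u "P (t - s) u" \<epsilon> x] small[of "t - s"] that u by (simp add: P_C0 abs_minus_commute)
  qed
  show ?thesis
  proof (rule that[OF d(1)])
    fix s t x assume "s \<ge> 0" "t \<ge> 0" "\<bar>s - t\<bar> < d"
    then show "\<bar>P s u x - P t u x\<bar> \<le> \<epsilon>"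
      using le[of s t x] le[of t s x] by (cases "s \<le> t") (auto simp: abs_minus_commute)
  qed
qed

lemma P_continuous:
  assumes "C0_fun u"
  shows "continuous_on {0..} (\<lambda>s. P s u x)"
  unfolding continuous_on_iff
proof (intro ballI allI impI)
  fix s e :: real assume s: "s \<in> {0..}" and e: "e > 0"
  then have "e / 2 > 0" by simp
  from P_uniformly_continuous[OF assms this] obtain \<delta> where \<delta>: "\<delta> > 0"
    "\<And>s t x. s \<ge> 0 \<Longrightarrow> t \<ge> 0 \<Longrightarrow> \<bar>s - t\<bar> < \<delta> \<Longrightarrow> \<bar>P s u x - P t u x\<bar> \<le> e / 2" by blast
  show "\<exists>d>0. \<forall>s'\<in>{0..}. dist s' s < d \<longrightarrow> dist (P s' u x) (P s u x) < e"
  proof (intro exI[of _ \<delta>] conjI ballI impI)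
    fix s' assume "s' \<in> {0..}" "dist s' s < \<delta>"
    then show "dist (P s' u x) (P s u x) < e"
      using \<delta>(2)[of s' s x] s e by (simp add: dist_real_def)
  qed (rule \<delta>(1))
qed

lemma generator_C0D: "(u, v) \<in> generator_C0 P \<Longrightarrow> C0_fun u" "(u, v) \<in> generator_C0 P \<Longrightarrow> C0_fun v"
  by (auto simp: generator_C0_def)

lemma generator_uniform:
  assumes "(u, v) \<in> generator_C0 P" "\<epsilon> > 0"
  obtains \<delta> where "\<delta> > 0" "\<And>t x. 0 \<le> t \<Longrightarrow> t < \<delta> \<Longrightarrow> \<bar>P t u x - u x - t * v x\<bar> \<le> \<epsilon> * t"
proof -
  have "uniform_limit UNIV (\<lambda>t x. (P t u x - u x) / t) v (at_right 0)"
    using assms(1) by (simp add: generator_C0_def)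
  then have "\<forall>\<^sub>F t in at_right 0. \<forall>x\<in>UNIV. dist ((P t u x - u x) / t) (v x) < \<epsilon>"
    by (rule uniform_limitD[OF _ assms(2)])
  then obtain d where d: "d > 0" "\<And>t x. 0 < t \<Longrightarrow> t < d \<Longrightarrow> \<bar>(P t u x - u x) / t - v x\<bar> < \<epsilon>"
    unfolding eventually_at_right_field by (auto simp: dist_real_def)
  show ?thesis
  proof (rule that[OF d(1)])
    fix t x assume t: "0 \<le> t" "t < d"
    show "\<bar>P t u x - u x - t * v x\<bar> \<le> \<epsilon> * t"
    proof (cases "t = 0")
      case True
      then show ?thesis
        using P_0[OF generator_C0D(1)[OF assms(1)]] by simp
    next
      case False
      have "P t u x - u x - t * v x = ((P t u x - u x) / t - v x) * t"
        using False by (simp add: field_simps)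
      then show ?thesis
        using d(2)[of t x] t False by (simp add: abs_mult mult_right_mono)
    qed
  qed
qed

lemma generator_C0I:
  assumes "C0_fun u" "C0_fun v"
    "\<And>\<epsilon>. \<epsilon> > 0 \<Longrightarrow> \<exists>\<delta>>0. \<forall>t x. 0 < t \<longrightarrow> t < \<delta> \<longrightarrow> \<bar>P t u x - u x - t * v x\<bar> \<le> \<epsilon> * t"
  shows "(u, v) \<in> generator_C0 P"
proof -
  have "uniform_limit UNIV (\<lambda>t x. (P t u x - u x) / t) v (at_right 0)"
  proof (rule uniform_limitI)
    fix e :: real assume e: "e > 0"
    then obtain d where d: "d > 0" "\<And>t x. 0 < t \<Longrightarrow> t < d \<Longrightarrow> \<bar>P t u x - u x - t * v x\<bar> \<le> e / 2 * t"
      using assms(3)[of "e / 2"] by auto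
    show "\<forall>\<^sub>F t in at_right 0. \<forall>x\<in>UNIV. dist ((P t u x - u x) / t) (v x) < e"
      unfolding eventually_at_right_field
    proof (intro exI conjI allI impI ballI)
      fix t x assume t: "0 < t" "t < d"
      have "(P t u x - u x) / t - v x = (P t u x - u x - t * v x) / t"
        using t by (simp add: field_simps)
      then have "\<bar>(P t u x - u x) / t - v x\<bar> \<le> e / 2"
        using d(2)[OF t, of x] t by (simp add: divide_le_eq)
      then show "dist ((P t u x - u x) / t) (v x) < e"
        using e by (simp add: dist_real_def)
    qed (rule d(1))
  qed
  with assms(1,2) show ?thesis
    by (simp add: generator_C0_def)
qed

lemma generator_P:
  assumes uv: "(u, v) \<in> generator_C0 P" and s: "s \<ge> 0"
  shows "(P s u, P s v) \<in> generator_C0 P"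
proof (rule generator_C0I)
  note C0 = generator_C0D[OF uv]
  show "C0_fun (P s u)" "C0_fun (P s v)"
    using C0 s by (auto intro: P_C0)
  fix \<epsilon> :: real assume "\<epsilon> > 0"
  from generator_uniform[OF uv this] obtain \<delta> where \<delta>: "\<delta> > 0"
    "\<And>t x. 0 \<le> t \<Longrightarrow> t < \<delta> \<Longrightarrow> \<bar>P t u x - u x - t * v x\<bar> \<le> \<epsilon> * t" by blast
  have "\<bar>P t (P s u) x - P s u x - t * P s v x\<bar> \<le> \<epsilon> * t" if t: "0 < t" "t < \<delta>" for t x
  proof -
    have "P t (P s u) = P s (P t u)"
      using P_add[of t s u] P_add[of s t u] t s C0 by (simp add: add.commute)
    moreover have "P s (\<lambda>x. P t u x - u x - t * v x) x = P s (P t u) x - P s u x - t * P s v x"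
      using t s C0 by (simp add: P_diff P_cmult P_C0 C0_fun_diff C0_fun_cmult)
    moreover have "\<bar>P s (\<lambda>x. P t u x - u x - t * v x) x\<bar> \<le> \<epsilon> * t"
      by (rule P_bound[OF s]) (use t C0 \<delta>(2) in \<open>auto intro!: C0_fun_diff C0_fun_cmult P_C0\<close>)
    ultimately show ?thesis
      by simp
  qed
  with \<delta>(1) show "\<exists>\<delta>>0. \<forall>t x. 0 < t \<longrightarrow> t < \<delta> \<longrightarrow> \<bar>P t (P s u) x - P s u x - t * P s v x\<bar> \<le> \<epsilon> * t"
    by blast
qed

text \<open>Two-sided in time and uniform in space. To the right the generator estimate is pushed
  forward by the contraction \<open>P s\<close>; to the left one starts at the earlier time
  instead.\<close>

lemma P_uniformly_differentiable:
  assumes uv: "(u, v) \<in> generator_C0 P" and s: "s \<ge> 0" and e: "\<epsilon> > 0"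
  obtains \<delta> where "\<delta> > 0"
    "\<And>s' x. s' \<ge> 0 \<Longrightarrow> \<bar>s' - s\<bar> < \<delta> \<Longrightarrow> \<bar>P s' u x - P s u x - (s' - s) * P s v x\<bar> \<le> \<epsilon> * \<bar>s' - s\<bar>"
proof -
  note C0 = generator_C0D[OF uv]
  have e2: "\<epsilon> / 2 > 0" using e by simp
  from generator_uniform[OF uv e2] obtain d1 where d1: "d1 > 0"
    "\<And>t x. 0 \<le> t \<Longrightarrow> t < d1 \<Longrightarrow> \<bar>P t u x - u x - t * v x\<bar> \<le> \<epsilon> / 2 * t" by blast
  from P_uniformly_continuous[OF C0(2) e2] obtain d2 where d2: "d2 > 0"
    "\<And>s t x. s \<ge> 0 \<Longrightarrow> t \<ge> 0 \<Longrightarrow> \<bar>s - t\<bar> < d2 \<Longrightarrow> \<bar>P s v x - P t v x\<bar> \<le> \<epsilon> / 2" by blast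
  have right: "\<bar>P (q + k) u x - P q u x - k * P q v x\<bar> \<le> \<epsilon> / 2 * k" if "q \<ge> 0" "0 \<le> k" "k < d1" for q k x
  proof -
    have "P (q + k) u = P q (P k u)"
      using P_add that C0 by simp
    moreover have "P q (\<lambda>x. P k u x - u x - k * v x) x = P q (P k u) x - P q u x - k * P q v x"
      using that C0 by (simp add: P_diff P_cmult P_C0 C0_fun_diff C0_fun_cmult)
    moreover have "\<bar>P q (\<lambda>x. P k u x - u x - k * v x) x\<bar> \<le> \<epsilon> / 2 * k"
      by (rule P_bound) (use that C0 d1(2) in \<open>auto intro!: C0_fun_diff C0_fun_cmult P_C0\<close>)
    ultimately show ?thesis
      by simp
  qed
  show ?thesis
  proof (rule that[of "min d1 d2"])
    fix s' x assume s': "s' \<ge> 0" "\<bar>s' - s\<bar> < min d1 d2"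
    show "\<bar>P s' u x - P s u x - (s' - s) * P s v x\<bar> \<le> \<epsilon> * \<bar>s' - s\<bar>"
    proof (cases "s \<le> s'")
      case True
      then have "\<bar>P s' u x - P s u x - (s' - s) * P s v x\<bar> \<le> \<epsilon> / 2 * (s' - s)"
        using right[of s "s' - s" x] s s' by simp
      also have "\<dots> \<le> \<epsilon> * (s' - s)"
        using True e by (intro mult_right_mono) auto
      finally show ?thesis
        using True by simp
    next
      \<comment> \<open>The estimate based at \<open>s'\<close> has the wrong derivative
        \<open>P s' v\<close>. Replacing it by \<open>P s v\<close> costs the second half of
        \<open>\<epsilon>\<close>, by uniform continuity.\<close>
      case False
      have 1: "\<bar>P s u x - P s' u x - (s - s') * P s' v x\<bar> \<le> \<epsilon> / 2 * (s - s')"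
        using right[of s' "s - s'" x] s' False by simp
      have "\<bar>P s' v x - P s v x\<bar> \<le> \<epsilon> / 2"
        by (rule d2(2)) (use s s' in auto)
      then have "\<bar>(s - s') * (P s' v x - P s v x)\<bar> \<le> (s - s') * (\<epsilon> / 2)"
        using False by (simp add: abs_mult)
      moreover have "P s' u x - P s u x - (s' - s) * P s v x =
          - ((P s u x - P s' u x - (s - s') * P s' v x) + (s - s') * (P s' v x - P s v x))"
        by (simp add: algebra_simps)
      ultimately have "\<bar>P s' u x - P s u x - (s' - s) * P s v x\<bar> \<le> \<epsilon> / 2 * (s - s') + (s - s') * (\<epsilon> / 2)"
        using 1 abs_triangle_ineq[of "P s u x - P s' u x - (s - s') * P s' v x" "(s - s') * (P s' v x - P s v x)"]
        by (simp only: abs_minus_cancel)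
      also have "\<dots> = \<epsilon> * \<bar>s' - s\<bar>"
        using False by (simp add: algebra_simps)
      finally show ?thesis .
    qed
  qed (use d1 d2 in auto)
qed

lemma P_has_derivative:
  assumes uv: "(u, v) \<in> generator_C0 P" and s: "s \<ge> 0"
  shows "((\<lambda>s. P s u x) has_real_derivative P s v x) (at s within {0..})"
  unfolding has_field_derivative_def has_derivative_within_alt
proof (intro conjI allI impI)
  show "bounded_linear ((*) (P s v x))"
    by (rule bounded_linear_mult_right)
  fix e :: real assume "e > 0"
  from P_uniformly_differentiable[OF uv s this] obtain \<delta> where "\<delta> > 0"
    "\<And>s' x. s' \<ge> 0 \<Longrightarrow> \<bar>s' - s\<bar> < \<delta> \<Longrightarrow> \<bar>P s' u x - P s u x - (s' - s) * P s v x\<bar> \<le> e * \<bar>s' - s\<bar>" by blast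
  then show "\<exists>d>0. \<forall>y\<in>{0..}. norm (y - s) < d \<longrightarrow>
      norm (P y u x - P s u x - P s v x * (y - s)) \<le> e * norm (y - s)"
    by (intro exI[of _ \<delta>]) (auto simp: mult.commute)
qed

text \<open>\<open>s \<mapsto> P (t - s) ((P s u) \<circ> a)\<close> has derivative zero on \<open>[0, t]\<close>.\<close>

lemma P_commute_generator:
  assumes uv: "(u, v) \<in> generator_C0 P" and t: "t \<ge> 0"
    and gen: "\<And>u v. (u, v) \<in> generator_C0 P \<Longrightarrow> ((\<lambda>x. u (a x)), (\<lambda>x. v (a x))) \<in> generator_C0 P"
  shows "P t (\<lambda>x. u (a x)) x = P t u (a x)"
proof -
  define \<phi> where "\<phi> s = P (t - s) (\<lambda>y. P s u (a y)) x" for s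
  have "(\<phi> has_real_derivative 0) (at s within {0..t})" if s: "s \<in> {0..t}" for s
    unfolding has_field_derivative_def has_derivative_within_alt
  proof (intro conjI allI impI)
    show "bounded_linear ((*) (0::real))"
      by (rule bounded_linear_mult_right)
    fix e :: real assume "e > 0"
    then have e3: "e / 3 > 0" by simp
    define w where "w s = (\<lambda>y. P s u (a y))" for s
    define w' where "w' = (\<lambda>y. P s v (a y))"
    have gens: "(w q, \<lambda>y. P q v (a y)) \<in> generator_C0 P" if "q \<ge> 0" for q
      unfolding w_def by (intro gen generator_P[OF uv that])
    have ww': "(w s, w') \<in> generator_C0 P"
      using gens[of s] s by (simp add: w'_def)
    note C0 = generator_C0D[OF ww']
    have C0w: "C0_fun (w q)" if "q \<ge> 0" for q
      using gens[OF that] generator_C0D(1) by blast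
    have s0: "s \<ge> 0" "t - s \<ge> 0" using s by auto
    from P_uniformly_differentiable[OF uv s0(1) e3] obtain d1 where d1: "d1 > 0"
      "\<And>s' x. s' \<ge> 0 \<Longrightarrow> \<bar>s' - s\<bar> < d1 \<Longrightarrow> \<bar>P s' u x - P s u x - (s' - s) * P s v x\<bar> \<le> e / 3 * \<bar>s' - s\<bar>" by blast
    from P_uniformly_differentiable[OF ww' s0(2) e3] obtain d2 where d2: "d2 > 0"
      "\<And>s' x. s' \<ge> 0 \<Longrightarrow> \<bar>s' - (t - s)\<bar> < d2 \<Longrightarrow> \<bar>P s' (w s) x - P (t - s) (w s) x - (s' - (t - s)) * P (t - s) w' x\<bar> \<le> e / 3 * \<bar>s' - (t - s)\<bar>" by blast
    from P_uniformly_continuous[OF C0(2) e3] obtain d3 where d3: "d3 > 0"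
      "\<And>s t x. s \<ge> 0 \<Longrightarrow> t \<ge> 0 \<Longrightarrow> \<bar>s - t\<bar> < d3 \<Longrightarrow> \<bar>P s w' x - P t w' x\<bar> \<le> e / 3" by blast
    have "\<bar>\<phi> s' - \<phi> s\<bar> \<le> e * \<bar>s' - s\<bar>" if s': "s' \<in> {0..t}" "\<bar>s' - s\<bar> < min d1 (min d2 d3)" for s'
    proof -
      define k where "k = s' - s"
      have t': "t - s' \<ge> 0" "s' \<ge> 0" "t - s' - (t - s) = - k" "(t - s') - (t - s) = s - s'"
        using s' by (auto simp: k_def)
      have "P (t - s') (\<lambda>y. w s' y - w s y - k * w' y) x
          = P (t - s') (w s') x - P (t - s') (w s) x - k * P (t - s') w' x"
        using t' C0 C0w s0 by (simp add: P_diff P_cmult C0_fun_diff C0_fun_cmult)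
      moreover have "\<bar>P (t - s') (\<lambda>y. w s' y - w s y - k * w' y) x\<bar> \<le> e / 3 * \<bar>k\<bar>"
        by (rule P_bound) (use t' C0 C0w s0 s' d1(2)[of s'] in
            \<open>auto intro!: C0_fun_diff C0_fun_cmult simp: w_def w'_def k_def\<close>)
      ultimately have 1: "\<bar>P (t - s') (w s') x - P (t - s') (w s) x - k * P (t - s') w' x\<bar> \<le> e / 3 * \<bar>k\<bar>"
        by simp
      have 2: "\<bar>P (t - s') (w s) x - P (t - s) (w s) x + k * P (t - s) w' x\<bar> \<le> e / 3 * \<bar>k\<bar>"
      proof -
        have "\<bar>P (t - s') (w s) x - P (t - s) (w s) x - (t - s' - (t - s)) * P (t - s) w' x\<bar> \<le> e / 3 * \<bar>t - s' - (t - s)\<bar>"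
          by (rule d2(2)) (use s' t' in auto)
        then show ?thesis
          unfolding t'(3) by simp
      qed
      have "\<bar>P (t - s') w' x - P (t - s) w' x\<bar> \<le> e / 3"
        by (rule d3(2)) (use s' s0 in auto)
      then have 3: "\<bar>k * P (t - s') w' x - k * P (t - s) w' x\<bar> \<le> e / 3 * \<bar>k\<bar>"
        using mult_left_mono[of _ "e / 3" "\<bar>k\<bar>"] unfolding right_diff_distrib[symmetric] abs_mult
        by (metis abs_ge_zero mult.commute)
      have "\<phi> s' - \<phi> s = P (t - s') (w s') x - P (t - s) (w s) x"
        by (simp add: \<phi>_def w_def)
      with 1 2 3 show ?thesis
        unfolding k_def[symmetric] by linarith
    qed
    with d1 d2 d3 show "\<exists>d>0. \<forall>y\<in>{0..t}. norm (y - s) < d \<longrightarrow> norm (\<phi> y - \<phi> s - 0 * (y - s)) \<le> e * norm (y - s)"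
      by (intro exI[of _ "min d1 (min d2 d3)"]) auto
  qed
  from has_field_derivative_zero_constant[OF convex_real_interval(5) this]
  obtain c where "\<And>s. s \<in> {0..t} \<Longrightarrow> \<phi> s = c"
    by blast
  from this[of 0] this[of t] have "\<phi> 0 = \<phi> t"
    using t by simp
  then show ?thesis
    using generator_C0D(1)[OF uv] generator_C0D(1)[OF gen[OF uv]] generator_C0D(1)[OF gen[OF generator_P[OF uv t]]]
    by (simp add: \<phi>_def P_0)
qed

text \<open>The approximants are the averages of \<open>P s u\<close> over a short interval
  \<open>[0, T]\<close>. They lie in the domain because \<open>P h\<close> merely shifts the
  interval of integration, and the generator takes the value \<open>(P T u - u) / T\<close>.\<close>

lemma generator_dense:
  assumes u: "C0_fun u" and e: "\<epsilon> > 0"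
  obtains w w' where "(w, w') \<in> generator_C0 P" "\<And>x. \<bar>w x - u x\<bar> \<le> \<epsilon>"
proof -
  define I where "I a b x = integral {a..b} (\<lambda>s. P s u x)" for a b x
  have cont: "continuous_on {a..b} (\<lambda>s. P s u x)" if "a \<ge> 0" for a b x
    by (rule continuous_on_subset[OF P_continuous[OF u]]) (use that in auto)
  have avg: "\<exists>\<delta>>0. \<forall>a h x. 0 \<le> a \<longrightarrow> 0 < h \<longrightarrow> h < \<delta> \<longrightarrow> \<bar>I a (a + h) x / h - P a u x\<bar> \<le> \<epsilon>" if "\<epsilon> > 0" for \<epsilon>
  proof -
    from P_uniformly_continuous[OF u that] obtain \<delta> where "\<delta> > 0"
      "\<And>s t x. s \<ge> 0 \<Longrightarrow> t \<ge> 0 \<Longrightarrow> \<bar>s - t\<bar> < \<delta> \<Longrightarrow> \<bar>P s u x - P t u x\<bar> \<le> \<epsilon>" by blast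
    then show ?thesis
      unfolding I_def by (intro exI[of _ \<delta>]) (auto intro!: integral_average_error cont)
  qed
  from avg[OF e] obtain \<tau> where "\<tau> > 0" and \<tau>: "\<And>h x. 0 < h \<Longrightarrow> h < \<tau> \<Longrightarrow> \<bar>I 0 (0 + h) x / h - P 0 u x\<bar> \<le> \<epsilon>"
    by blast
  define T where "T = \<tau> / 2"
  have T: "T > 0" "\<And>x. \<bar>I 0 T x / T - u x\<bar> \<le> \<epsilon>"
    using \<tau>[of T] \<open>\<tau> > 0\<close> by (auto simp: T_def P_0 u)
  have riemann: "\<exists>n>0. \<forall>a x. 0 \<le> a \<longrightarrow> \<bar>I a (a + T) x - (\<Sum>j<n. T / real n * P (a + real j * (T / real n)) u x)\<bar> \<le> T * \<epsilon>"
    if "\<epsilon> > 0" for \<epsilon>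
  proof -
    from P_uniformly_continuous[OF u that] obtain \<delta> where \<delta>: "\<delta> > 0"
      "\<And>s t x. s \<ge> 0 \<Longrightarrow> t \<ge> 0 \<Longrightarrow> \<bar>s - t\<bar> < \<delta> \<Longrightarrow> \<bar>P s u x - P t u x\<bar> \<le> \<epsilon>" by blast
    obtain n :: nat where n: "real n > T / \<delta>"
      using reals_Archimedean2 by blast
    have n0: "n > 0"
      using n T(1) \<delta>(1) by (metis divide_pos_pos gr0I less_asym of_nat_0)
    then have small: "T / real n < \<delta>"
      using n \<delta>(1) by (simp add: field_simps)
    have "\<bar>integral {a..a + real n * (T / real n)} (\<lambda>s. P s u x) - (\<Sum>j<n. T / real n * P (a + real j * (T / real n)) u x)\<bar>
        \<le> real n * (T / real n) * \<epsilon>" if "0 \<le> a" for a x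
      by (rule riemann_sum_error) (use that n0 T(1) small in \<open>auto intro!: cont \<delta>(2)\<close>)
    then show ?thesis
      using n0 by (intro exI[of _ n]) (simp add: I_def)
  qed
  have C0_sum: "C0_fun (\<lambda>x. \<Sum>j<n. T / real n * P (a + real j * (T / real n)) u x)" if "a \<ge> 0" for n a
    using that T(1) u by (intro C0_fun_sum C0_fun_cmult P_C0) auto
  have C0_I: "C0_fun (I 0 T)"
  proof (rule C0_fun_uniform_closure)
    fix \<epsilon> :: real assume "\<epsilon> > 0"
    then have "\<epsilon> / T > 0" using T(1) by simp
    from riemann[OF this] obtain n where
      "\<And>a x. 0 \<le> a \<Longrightarrow> \<bar>I a (a + T) x - (\<Sum>j<n. T / real n * P (a + real j * (T / real n)) u x)\<bar> \<le> T * (\<epsilon> / T)"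
      by blast
    from this[of 0] T(1) have "\<bar>I 0 T x - (\<Sum>j<n. T / real n * P (0 + real j * (T / real n)) u x)\<bar> \<le> \<epsilon>" for x
      by simp
    then show "\<exists>v. C0_fun v \<and> (\<forall>x. \<bar>I 0 T x - v x\<bar> \<le> \<epsilon>)"
      using C0_sum[of 0 n] by blast
  qed
  \<comment> \<open>\<open>P h\<close> is moved inside the integral by approximating with Riemann
    sums on both sides; each side contributes half of \<open>\<epsilon>\<close>.\<close>
  have P_I: "P h (I 0 T) x = I h (h + T) x" if h: "h \<ge> 0" for h x
  proof -
    have "\<bar>P h (I 0 T) x - I h (h + T) x\<bar> \<le> \<epsilon>" if "\<epsilon> > 0" for \<epsilon>
    proof -
      have "\<epsilon> / (2 * T) > 0" using T(1) that by simp
      from riemann[OF this] obtain n where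
        "\<And>a x. 0 \<le> a \<Longrightarrow> \<bar>I a (a + T) x - (\<Sum>j<n. T / real n * P (a + real j * (T / real n)) u x)\<bar> \<le> T * (\<epsilon> / (2 * T))"
        by blast
      moreover have T_\<epsilon>: "T * (\<epsilon> / (2 * T)) = \<epsilon> / 2"
        using T(1) by simp
      ultimately have n: "\<And>a x. 0 \<le> a \<Longrightarrow>
          \<bar>I a (a + T) x - (\<Sum>j<n. T / real n * P (a + real j * (T / real n)) u x)\<bar> \<le> \<epsilon> / 2"
        unfolding T_\<epsilon> by blast
      let ?R = "\<lambda>a x. \<Sum>j<n. T / real n * P (a + real j * (T / real n)) u x"
      have "\<bar>P h (I 0 T) x - P h (?R 0) x\<bar> \<le> \<epsilon> / 2"
        by (rule P_dist[OF h C0_I C0_sum]) (use n[of 0] in auto)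
      moreover have "P h (?R 0) x = ?R h x"
      proof -
        have "P h (?R 0) x = (\<Sum>j<n. P h (\<lambda>x. T / real n * P (0 + real j * (T / real n)) u x) x)"
          using T(1) by (intro fun_cong[OF P_sum[OF h]] C0_fun_cmult P_C0 u) simp
        also have "\<dots> = ?R h x"
        proof (rule sum.cong[OF refl])
          fix j
          have j: "real j * (T / real n) \<ge> 0"
            using T(1) by simp
          show "P h (\<lambda>x. T / real n * P (0 + real j * (T / real n)) u x) x = T / real n * P (h + real j * (T / real n)) u x"
            unfolding add_0 P_cmult[OF h P_C0[OF j u]] P_add[OF h j u] ..
        qed
        finally show ?thesis .
      qed
      ultimately show ?thesis
        using n[OF h, of x] by linarith
    qed
    then show ?thesis
      by (metis abs_le_zero_iff eq_iff_diff_eq_0 field_le_epsilon add_0)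
  qed
  define w w' where "w = (\<lambda>x. 1 / T * I 0 T x)" and "w' = (\<lambda>x. 1 / T * (P T u x - u x))"
  have "(w, w') \<in> generator_C0 P"
  proof (rule generator_C0I)
    show "C0_fun w" "C0_fun w'"
      unfolding w_def w'_def using T(1) by (intro C0_fun_cmult C0_fun_diff P_C0 C0_I u; simp)+
    fix \<epsilon> :: real assume \<epsilon>: "\<epsilon> > 0"
    then have "\<epsilon> * T / 2 > 0" using T(1) by simp
    from avg[OF this] obtain \<delta> where \<delta>: "\<delta> > 0"
      "\<And>a h x. 0 \<le> a \<Longrightarrow> 0 < h \<Longrightarrow> h < \<delta> \<Longrightarrow> \<bar>I a (a + h) x / h - P a u x\<bar> \<le> \<epsilon> * T / 2" by blast
    have "\<bar>P h w x - w x - h * w' x\<bar> \<le> \<epsilon> * h" if h: "0 < h" "h < \<delta>" for h x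
    proof -
      have int: "(\<lambda>s. P s u x) integrable_on {a..b}" if "a \<ge> 0" for a b
        by (intro integrable_continuous_real cont that)
      \<comment> \<open>Shifting the interval by \<open>h\<close> only changes its two ends. The
        difference quotient therefore compares averages over intervals of length \<open>h\<close>
        starting at \<open>T\<close> and at \<open>0\<close>.\<close>
      have "I 0 h x + I h (h + T) x = I 0 (h + T) x" "I 0 T x + I T (T + h) x = I 0 (h + T) x"
        using T(1) h int unfolding I_def
        by (auto intro!: Henstock_Kurzweil_Integration.integral_combine simp: add.commute[of T h])
      then have "I h (h + T) x - I 0 T x = I T (T + h) x - I 0 (0 + h) x"
        by simp
      moreover have "P h w x = 1 / T * I h (h + T) x"
        unfolding w_def P_cmult[OF less_imp_le[OF h(1)] C0_I] P_I[OF less_imp_le[OF h(1)]] ..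
      ultimately have "P h w x - w x = 1 / T * (I T (T + h) x - I 0 (0 + h) x)"
        by (simp only: right_diff_distrib[symmetric] w_def[THEN fun_cong, of x])
      then have "P h w x - w x - h * w' x = h / T * ((I T (T + h) x / h - P T u x) - (I 0 (0 + h) x / h - P 0 u x))"
      proof -
        have "h / T * ((D / h - a) - (E / h - b)) = 1 / T * (D - E) - h * (1 / T * (a - b))" for D E a b :: real
          using h T(1) by (simp add: field_simps)
        with \<open>P h w x - w x = _\<close> show ?thesis
          unfolding w'_def P_0[OF u] by simp
      qed
      also have "\<bar>\<dots>\<bar> \<le> h / T * (\<epsilon> * T)"
      proof -
        have "\<bar>(I T (T + h) x / h - P T u x) - (I 0 (0 + h) x / h - P 0 u x)\<bar> \<le> \<epsilon> * T / 2 + \<epsilon> * T / 2"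
          by (rule order_trans[OF abs_triangle_ineq4 add_mono[OF \<delta>(2) \<delta>(2)]]) (use h T(1) in auto)
        then show ?thesis
          unfolding abs_mult using h T(1) by (intro mult_mono) (auto simp: mult.commute)
      qed
      finally show ?thesis
        using T(1) by (simp add: mult.commute)
    qed
    with \<delta>(1) show "\<exists>\<delta>>0. \<forall>t x. 0 < t \<longrightarrow> t < \<delta> \<longrightarrow> \<bar>P t w x - w x - t * w' x\<bar> \<le> \<epsilon> * t"
      by blast
  qed
  moreover have "\<bar>w x - u x\<bar> \<le> \<epsilon>" for x
    using T(2)[of x] by (simp add: w_def)
  ultimately show ?thesis
    using that by blast
qed

text \<open>Both sides are contractive in \<open>u\<close>, so the commutation extends from the
  domain of the generator to its uniform closure.\<close>

lemma P_commute:
  assumes gen: "\<And>u v. (u, v) \<in> generator_C0 P \<Longrightarrow> ((\<lambda>x. u (a x)), (\<lambda>x. v (a x))) \<in> generator_C0 P"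
    and C0: "C0_fun (\<lambda>x. u (a x))" and t: "t \<ge> 0" and u: "C0_fun u"
  shows "P t (\<lambda>x. u (a x)) x = P t u (a x)"
proof -
  have "\<bar>P t (\<lambda>x. u (a x)) x - P t u (a x)\<bar> \<le> \<epsilon>" if "\<epsilon> > 0" for \<epsilon>
  proof -
    have "\<epsilon> / 2 > 0" using that by simp
    from generator_dense[OF u this] obtain w w' where w: "(w, w') \<in> generator_C0 P" "\<And>x. \<bar>w x - u x\<bar> \<le> \<epsilon> / 2"
      by blast
    have "\<bar>P t (\<lambda>x. w (a x)) x - P t (\<lambda>x. u (a x)) x\<bar> \<le> \<epsilon> / 2"
      by (rule P_dist[OF t generator_C0D(1)[OF gen[OF w(1)]] C0]) (rule w(2))
    moreover have "\<bar>P t w (a x) - P t u (a x)\<bar> \<le> \<epsilon> / 2"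
      by (rule P_dist[OF t generator_C0D(1)[OF w(1)] u]) (rule w(2))
    moreover have "P t (\<lambda>x. w (a x)) x = P t w (a x)"
      by (rule P_commute_generator[OF w(1) t gen])
    ultimately show ?thesis
      by linarith
  qed
  then show ?thesis
    by (metis abs_le_zero_iff eq_iff_diff_eq_0 field_le_epsilon add_0)
qed

end

section \<open>Left invariance of the heat kernel\<close>

lemma continuous_AE_eq_lborel:
  fixes f g :: "'a::euclidean_space \<Rightarrow> real"
  assumes "continuous_on UNIV f" "continuous_on UNIV g" "AE x in lborel. f x = g x"
  shows "f = g"
proof (rule ccontr)
  assume "f \<noteq> g"
  have "open {x. f x \<noteq> g x}"
    by (rule open_Collect_neq[OF assms(1,2)])
  moreover have "{x. f x \<noteq> g x} \<noteq> {}"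
    using \<open>f \<noteq> g\<close> by auto
  ultimately have "\<not> negligible {x. f x \<noteq> g x}"
    by (rule open_not_negligible)
  moreover have "{x. f x \<noteq> g x} \<in> null_sets lborel"
    using assms(3) \<open>open {x. f x \<noteq> g x}\<close> by (intro AE_iff_null_sets[THEN iffD2]) (auto simp: borel_open)
  ultimately show False
    by (simp add: negligible_iff_null_sets null_sets_completionI)
qed

lemma bump_compact_support:
  fixes K :: "'a::euclidean_space set"
  assumes "compact K" "K \<noteq> {}" "c > 0"
  shows "compact (closure {x. max 0 (1 - c * infdist x K) \<noteq> 0})"
proof -
  obtain B where B: "\<And>y. y \<in> K \<Longrightarrow> norm y \<le> B"
    using compact_imp_bounded[OF assms(1)] unfolding bounded_iff by blast
  have "{x. max 0 (1 - c * infdist x K) \<noteq> 0} \<subseteq> cball 0 (B + 1 / c)"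
  proof
    fix x assume "x \<in> {x. max 0 (1 - c * infdist x K) \<noteq> 0}"
    then have "c * infdist x K < 1"
      by (auto simp: max_def split: if_splits)
    then have *: "infdist x K < 1 / c"
      using assms(3) by (simp add: field_simps)
    obtain y where y: "y \<in> K" "infdist x K = dist x y"
      using infdist_attains_inf[OF compact_imp_closed[OF assms(1)] assms(2)] by blast
    have "norm x \<le> norm y + dist x y"
      by (metis add.commute dist_norm norm_triangle_sub)
    with * y B[of y] show "x \<in> cball 0 (B + 1 / c)"
      by simp
  qed
  then show ?thesis
    by (rule compact_closure_subset[OF compact_cball])
qed

lemma C0_fun_bump:
  fixes K :: "'a::euclidean_space set"
  assumes "compact K" "K \<noteq> {}" "c > 0"
  shows "C0_fun (\<lambda>x. max 0 (1 - c * infdist x K))"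
  by (intro C0_fun_compact_support bump_compact_support assms continuous_intros)

lemma bump_tendsto_indicator:
  fixes K :: "'a::euclidean_space set"
  assumes "compact K" "K \<noteq> {}"
  shows "(\<lambda>n. max 0 (1 - real (Suc n) * infdist x K)) \<longlonglongrightarrow> indicator K x"
proof (cases "x \<in> K")
  case False
  then have pos: "infdist x K > 0"
    using assms by (metis compact_imp_closed in_closed_iff_infdist_zero infdist_nonneg order_le_less)
  obtain N :: nat where N: "1 / infdist x K < real N"
    using reals_Archimedean2 by blast
  have "max 0 (1 - real (Suc n) * infdist x K) = 0" if "n \<ge> N" for n
  proof -
    have "1 < real N * infdist x K"
      using N pos by (simp add: field_simps)
    also have "\<dots> \<le> real (Suc n) * infdist x K"
      using that pos by (intro mult_right_mono) auto
    finally show ?thesis by simp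
  qed
  then show ?thesis
    using False by (intro tendsto_eventually) (auto simp: eventually_sequentially)
qed simp

text \<open>Compact sets form an intersection-stable generator of the Borel sets, and their
  indicators are bounded pointwise limits of the bumps of \<open>C0_fun_bump\<close>.\<close>

lemma measure_eqI_C0:
  fixes M N :: "'a::euclidean_space measure"
  assumes "finite_measure M" "finite_measure N" and sets: "sets M = sets borel" "sets N = sets borel"
    and eq: "\<And>u. C0_fun u \<Longrightarrow> (\<integral>x. u x \<partial>M) = (\<integral>x. u x \<partial>N)"
  shows "M = N"
proof (rule measure_eqI_generator_eq)
  interpret M: finite_measure M by fact
  interpret N: finite_measure N by fact
  show "Int_stable (Collect compact :: 'a set set)"
    by (auto simp: Int_stable_def intro: compact_Int)
  have gen: "sigma_sets UNIV (Collect compact) = sets (borel :: 'a measure)"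
  proof
    show "sigma_sets UNIV (Collect compact) \<subseteq> sets (borel :: 'a measure)"
      by (rule sets.sigma_sets_subset[where M=borel, simplified]) (auto intro: borel_closed compact_imp_closed)
    have "S \<in> sigma_sets UNIV (Collect compact)" if "closed S" for S :: "'a set"
    proof -
      have "S = (\<Union>n. S \<inter> cball 0 (real n))"
        by (auto intro: real_arch_simple)
      moreover have "\<dots> \<in> sigma_sets UNIV (Collect compact)"
        using that by (intro sigma_sets.Union sigma_sets.Basic) (auto intro: closed_Int_compact)
      ultimately show ?thesis by metis
    qed
    then have "sigma_sets UNIV (Collect closed) \<subseteq> sigma_sets UNIV (Collect compact :: 'a set set)"
      by (intro sigma_sets_mono) auto
    then show "sets (borel :: 'a measure) \<subseteq> sigma_sets UNIV (Collect compact)"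
      by (simp add: borel_eq_closed)
  qed
  show "sets M = sigma_sets UNIV (Collect compact)" "sets N = sigma_sets UNIV (Collect compact)"
    using gen sets by auto
  show "range (\<lambda>n. cball 0 (real n)) \<subseteq> (Collect compact :: 'a set set)"
    by auto
  show "(\<Union>n. cball 0 (real n)) = (UNIV :: 'a set)"
    by (auto intro: real_arch_simple)
  show "emeasure M (cball 0 (real n)) \<noteq> \<infinity>" for n
    by simp
  show "emeasure M K = emeasure N K" if "K \<in> Collect compact" for K
  proof (cases "K = {}")
    case False
    have K: "compact K" using that by simp
    define u where "u n x = max 0 (1 - real (Suc n) * infdist x K)" for n x
    have u: "C0_fun (u n)" for n
      unfolding u_def by (rule C0_fun_bump[OF K False]) simp
    have meas: "u n \<in> borel_measurable borel" for n
      using u[of n] by (simp add: C0_fun_def borel_measurable_continuous_onI)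
    have lim: "(\<lambda>n. u n x) \<longlonglongrightarrow> indicator K x" for x
      unfolding u_def by (rule bump_tendsto_indicator[OF K False])
    have bd: "norm (u n x) \<le> 1" for n x
      using infdist_nonneg[of x K] by (simp add: u_def)
    have *: "(\<lambda>n. \<integral>x. u n x \<partial>L) \<longlonglongrightarrow> (\<integral>x. indicator K x \<partial>L)"
      if "finite_measure L" "sets L = sets borel" for L :: "'a measure"
    proof (rule integral_dominated_convergence[where w="\<lambda>_. 1"])
      show "integrable L (\<lambda>_. 1::real)"
        using that(1) by (simp add: finite_measure.integrable_const)
      show "indicator K \<in> borel_measurable L"
        using borel_closed[OF compact_imp_closed[OF K]] that(2) by simp
      show "u n \<in> borel_measurable L" for n
        using meas that(2) measurable_cong_sets by blast
    qed (use lim bd in auto)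
    have "(\<integral>x. indicator K x \<partial>M) = (\<integral>x. indicator K x \<partial>N :: real)"
      using *[OF assms(1) sets(1)] *[OF assms(2) sets(2)] unfolding eq[OF u] by (rule LIMSEQ_unique)
    moreover have "K \<in> sets M" "K \<in> sets N"
      using borel_closed[OF compact_imp_closed[OF K]] sets by auto
    ultimately have "measure M K = measure N K"
      by (simp add: sets.sets_into_space Int_absorb2)
    then show ?thesis
      by (simp add: M.emeasure_eq_measure N.emeasure_eq_measure)
  qed simp
qed auto

lemma lborel_distr_uminus_euclidean: "distr lborel borel uminus = (lborel :: 'a::euclidean_space measure)"
  using lborel_affine[of "-1" "0::'a"] by (simp add: density_1 one_ennreal_def[symmetric])

lemma nn_integral_lborel_uminus:
  assumes "F \<in> borel_measurable borel"
  shows "(\<integral>\<^sup>+x. F (- x) \<partial>lborel) = (\<integral>\<^sup>+x. F x \<partial>(lborel :: 'a::euclidean_space measure))"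
  by (subst (2) lborel_distr_uminus_euclidean[symmetric]) (simp add: nn_integral_distr assms)

section \<open>Kernel measures and the modulus of left translation\<close>

locale carnot_heat = carnot mul r V
  for mul :: "'a::euclidean_space \<Rightarrow> 'a \<Rightarrow> 'a" and r :: nat and V :: "nat \<Rightarrow> 'a set" +
  fixes e :: "'m::finite \<Rightarrow> 'a" and f :: "nat \<Rightarrow> 'a"
    and P :: "real \<Rightarrow> ('a \<Rightarrow> real) \<Rightarrow> 'a \<Rightarrow> real"
    and p :: "'a \<Rightarrow> 'a \<Rightarrow> real \<Rightarrow> real"
  assumes adapted: "adapted_basis r V e f"
    and heat_semigroup: "heat_semigroup mul e P"
    and heat_kernel: "heat_kernel P p"
begin

sublocale C0_semigroup P
  using heat_semigroup by unfold_locales (simp add: heat_semigroup_def)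

lemma generator_eq: "generator_C0 P = laplacian_closure_C0 mul e"
  using heat_semigroup by (simp add: heat_semigroup_def)

lemma p_pos: "t > 0 \<Longrightarrow> p g g' t > 0"
  and p_sym: "t > 0 \<Longrightarrow> p g g' t = p g' g t"
  and p_smooth: "smooth_on (UNIV \<times> UNIV \<times> {0<..}) (\<lambda>(g, g', t). p g g' t)"
  and p_integral: "t > 0 \<Longrightarrow> C0_fun u \<Longrightarrow> has_bochner_integral lborel (\<lambda>g'. p g g' t * u g') (P t u g)"
  using heat_kernel[unfolded heat_kernel_def, THEN conjunct1]
    heat_kernel[unfolded heat_kernel_def, THEN conjunct2, THEN conjunct1]
    heat_kernel[unfolded heat_kernel_def, THEN conjunct2, THEN conjunct2, THEN conjunct1]
    heat_kernel[unfolded heat_kernel_def, THEN conjunct2, THEN conjunct2, THEN conjunct2]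
  by blast+

lemma p_continuous:
  assumes "t > 0" "continuous_on S a" "continuous_on S b"
  shows "continuous_on S (\<lambda>x. p (a x) (b x) t)"
proof -
  have "continuous_on S (\<lambda>x. (a x, b x, t))"
    using assms by (intro continuous_intros)
  from continuous_on_compose2[OF smooth_on_continuous[OF p_smooth] this] show ?thesis
    using assms(1) by auto
qed

lemma p_measurable [measurable]:
  assumes "t > 0"
  shows "(\<lambda>x. p (fst x) (snd x) t) \<in> borel_measurable borel" "(\<lambda>g'. p g g' t) \<in> borel_measurable borel"
    "(\<lambda>g. p g g' t) \<in> borel_measurable borel"
  using assms by (auto intro!: borel_measurable_continuous_onI p_continuous continuous_intros)

lemma P_left_translate:
  assumes "t \<ge> 0" "C0_fun u"
  shows "P t (\<lambda>x. u (mul h x)) x = P t u (mul h x)"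
  by (rule P_commute[OF _ C0_fun_left_translate[OF assms(2)] assms])
    (simp add: generator_eq laplacian_closure_left_translate)

text \<open>The constant 1 does not vanish at infinity, so the contraction property reaches it only
  through a limit, and Fatou yields an inequality. Equality is recovered later, in
  \<open>nn_integral_p\<close>.\<close>

lemma nn_integral_p_le_1:
  assumes t: "t > 0"
  shows "(\<integral>\<^sup>+g'. ennreal (p g g' t) \<partial>lborel) \<le> 1"
proof -
  \<comment> \<open>Cones of height 1 with slope \<open>1 / (n + 1)\<close>: they vanish at
    infinity, stay below 1 and tend to 1 pointwise.\<close>
  define u :: "nat \<Rightarrow> 'a \<Rightarrow> real" where "u n x = max 0 (1 - 1 / real (Suc n) * infdist x {0})" for n x
  have u: "C0_fun (u n)" for n
    unfolding u_def by (rule C0_fun_bump) auto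
  have bd: "0 \<le> u n x" "u n x \<le> 1" for n x
    by (auto simp: u_def)
  have meas: "u n \<in> borel_measurable borel" for n
    using u[of n] by (simp add: C0_fun_def borel_measurable_continuous_onI)
  have lim: "(\<lambda>n. u n x) \<longlonglongrightarrow> 1" for x
  proof -
    have "(\<lambda>n. max 0 (1 - 1 / real (Suc n) * infdist x {0})) \<longlonglongrightarrow> max 0 (1 - 0 * infdist x {0})"
    proof (intro tendsto_intros)
      show "(\<lambda>n. 1 / real (Suc n)) \<longlonglongrightarrow> 0"
        by real_asymp
    qed
    then show ?thesis
      by (simp add: u_def)
  qed
  have le: "(\<integral>\<^sup>+g'. ennreal (p g g' t * u n g') \<partial>lborel) \<le> 1" for n
  proof -
    have "(\<integral>\<^sup>+g'. ennreal (p g g' t * u n g') \<partial>lborel) = ennreal (P t (u n) g)"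
      using p_integral[OF t u, of g n] bd p_pos[OF t]
      by (intro nn_integral_has_integral_lebesgue nn_integral_eq_integral[THEN trans])
        (auto simp: has_bochner_integral_iff less_imp_le)
    moreover have "\<bar>P t (u n) g\<bar> \<le> 1"
      using t u bd by (intro P_bound) auto
    ultimately show ?thesis
      by simp
  qed
  have "(\<integral>\<^sup>+g'. ennreal (p g g' t) \<partial>lborel) = (\<integral>\<^sup>+g'. liminf (\<lambda>n. ennreal (p g g' t * u n g')) \<partial>lborel)"
  proof (intro nn_integral_cong)
    fix g'
    have "(\<lambda>n. ennreal (p g g' t * u n g')) \<longlonglongrightarrow> ennreal (p g g' t * 1)"
      by (intro tendsto_ennrealI tendsto_mult tendsto_const lim)
    from lim_imp_Liminf[OF _ this] show "ennreal (p g g' t) = liminf (\<lambda>n. ennreal (p g g' t * u n g'))"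
      by simp
  qed
  also have "\<dots> \<le> liminf (\<lambda>n. \<integral>\<^sup>+g'. ennreal (p g g' t * u n g') \<partial>lborel)"
    using p_measurable(2)[OF t] meas by (intro nn_integral_liminf) simp
  also have "\<dots> \<le> 1"
    by (rule Liminf_le) (use le in auto)
  finally show ?thesis .
qed

lemma integrable_p: "t > 0 \<Longrightarrow> integrable lborel (\<lambda>g'. p g g' t)"
proof (rule integrableI_bounded)
  assume t: "t > 0"
  have "(\<integral>\<^sup>+g'. ennreal (norm (p g g' t)) \<partial>lborel) \<le> 1"
    using nn_integral_p_le_1[OF t, of g] p_pos[OF t] by (simp add: less_imp_le)
  then show "(\<integral>\<^sup>+g'. ennreal (norm (p g g' t)) \<partial>lborel) < \<infinity>"
    by (metis ennreal_one_less_top infinity_ennreal_def le_less_trans)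
qed simp

definition \<nu> :: "real \<Rightarrow> 'a \<Rightarrow> 'a measure" where
  "\<nu> t g = density lborel (\<lambda>g'. ennreal (p g g' t))"

lemma sets_\<nu> [simp]: "sets (\<nu> t g) = sets borel" and space_\<nu> [simp]: "space (\<nu> t g) = UNIV"
  by (simp_all add: \<nu>_def)

lemma finite_measure_\<nu>: "t > 0 \<Longrightarrow> finite_measure (\<nu> t g)"
  using nn_integral_p_le_1[of t g]
  by (intro finite_measureI) (auto simp: \<nu>_def emeasure_density top_unique)

lemma integral_\<nu>:
  fixes u :: "'a \<Rightarrow> 'b::{banach, second_countable_topology}"
  assumes "t > 0" "u \<in> borel_measurable borel"
  shows "(\<integral>x. u x \<partial>\<nu> t g) = (\<integral>x. p g x t *\<^sub>R u x \<partial>lborel)"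
  unfolding \<nu>_def using assms p_pos by (subst integral_density) (auto simp: less_imp_le)

lemma left_mul_measurable [measurable]: "mul h \<in> borel_measurable borel"
  by (rule borel_measurable_continuous_onI[OF smooth_on_continuous[OF smooth_left_mul]])

lemma measurable_\<nu> [simp]: "measurable (\<nu> t g) N = measurable borel N"
  by (rule measurable_cong_sets) simp_all

text \<open>Both measures represent \<open>u \<mapsto> P t u (mul h g)\<close>: one directly, the
  other because \<open>P\<close> commutes with left translations.\<close>

lemma distr_\<nu>_left:
  assumes t: "t > 0"
  shows "distr (\<nu> t g) borel (mul h) = \<nu> t (mul h g)"
proof (rule measure_eqI_C0)
  show "finite_measure (distr (\<nu> t g) borel (mul h))"
    by (rule finite_measure.finite_measure_distr[OF finite_measure_\<nu>[OF t]]) simp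
  show "finite_measure (\<nu> t (mul h g))"
    by (rule finite_measure_\<nu>[OF t])
  fix u :: "'a \<Rightarrow> real" assume u: "C0_fun u"
  then have [measurable]: "u \<in> borel_measurable borel"
    by (simp add: C0_fun_def borel_measurable_continuous_onI)
  have "(\<integral>x. u x \<partial>distr (\<nu> t g) borel (mul h)) = (\<integral>x. u (mul h x) \<partial>\<nu> t g)"
    by (rule integral_distr) (simp_all add: \<nu>_def)
  also have "\<dots> = P t (\<lambda>x. u (mul h x)) g"
    using p_integral[OF t C0_fun_left_translate[OF u]] by (simp add: integral_\<nu>[OF t] has_bochner_integral_iff)
  also have "\<dots> = P t u (mul h g)"
    using t by (simp add: P_left_translate u)
  also have "\<dots> = (\<integral>x. u x \<partial>\<nu> t (mul h g))"
    using p_integral[OF t u] by (simp add: integral_\<nu>[OF t] has_bochner_integral_iff)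
  finally show "(\<integral>x. u x \<partial>distr (\<nu> t g) borel (mul h)) = (\<integral>x. u x \<partial>\<nu> t (mul h g))" .
qed auto

lemma nn_integral_p_left:
  assumes t: "t > 0" and F: "F \<in> borel_measurable borel"
  shows "(\<integral>\<^sup>+x. ennreal (p g x t) * F (mul h x) \<partial>lborel) = (\<integral>\<^sup>+x. ennreal (p (mul h g) x t) * F x \<partial>lborel)"
proof -
  have "(\<integral>\<^sup>+x. ennreal (p (mul h g) x t) * F x \<partial>lborel) = (\<integral>\<^sup>+x. F x \<partial>\<nu> t (mul h g))"
    using t F by (simp add: \<nu>_def nn_integral_density)
  also have "\<dots> = (\<integral>\<^sup>+x. F (mul h x) \<partial>\<nu> t g)"
    unfolding distr_\<nu>_left[OF t, symmetric] using F by (subst nn_integral_distr) (simp_all add: \<nu>_def)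
  also have "\<dots> = (\<integral>\<^sup>+x. ennreal (p g x t) * F (mul h x) \<partial>lborel)"
    using t F by (simp add: \<nu>_def nn_integral_density)
  finally show ?thesis ..
qed

lemma integral_p_left:
  fixes F :: "'a \<Rightarrow> 'b::{banach, second_countable_topology}"
  assumes t: "t > 0" and F: "F \<in> borel_measurable borel"
  shows "(\<integral>x. p g x t *\<^sub>R F (mul h x) \<partial>lborel) = (\<integral>x. p (mul h g) x t *\<^sub>R F x \<partial>lborel)"
proof -
  have "(\<integral>x. F x \<partial>\<nu> t (mul h g)) = (\<integral>x. F (mul h x) \<partial>\<nu> t g)"
    unfolding distr_\<nu>_left[OF t, symmetric] using F by (subst integral_distr) (simp_all add: \<nu>_def)
  then show ?thesis
    using t F by (simp add: integral_\<nu>)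
qed

text \<open>Left translation by \<open>h\<close> maps Lebesgue measure to the measure with density
  \<open>p (mul h g) k t / p g (mul (- h) k) t\<close>, for every \<open>g\<close>; by symmetry of \<open>p\<close> this density is constant.\<close>

lemma left_translation_ratio:
  assumes t: "t > 0"
  obtains c where "c > 0" "\<And>g k. p (mul h g) (mul h k) t = c * p g k t"
    "\<And>F. F \<in> borel_measurable borel \<Longrightarrow> (\<integral>\<^sup>+x. F (mul h x) \<partial>lborel) = ennreal c * (\<integral>\<^sup>+x. F x \<partial>lborel)"
proof -
  define R where "R g k = p (mul h g) k t / p g (mul (- h) k) t" for g k
  have R_pos: "R g k > 0" for g k
    using p_pos[OF t] by (simp add: R_def)
  have R_cont: "continuous_on UNIV (R g)" for g
    unfolding R_def using p_pos[OF t, THEN less_imp_neq]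
    by (intro continuous_on_divide p_continuous[OF t] continuous_on_const continuous_on_id continuous_on_mul) metis
  then have R_meas: "R g \<in> borel_measurable borel" for g
    by (rule borel_measurable_continuous_onI)
  have R_int: "(\<integral>\<^sup>+x. F (mul h x) \<partial>lborel) = (\<integral>\<^sup>+x. ennreal (R g x) * F x \<partial>lborel)"
    if F: "F \<in> borel_measurable borel" for F g
  proof -
    \<comment> \<open>Dividing by the kernel at the back-translated point makes it cancel after
      translation, leaving the plain Lebesgue integral on the left and the ratio \<open>R\<close> on
      the right.\<close>
    define F' where "F' k = ennreal (1 / p g (mul (- h) k) t) * F k" for k
    have "continuous_on UNIV (\<lambda>k. 1 / p g (mul (- h) k) t)"
      using p_pos[OF t, THEN less_imp_neq]
      by (intro continuous_on_divide p_continuous[OF t] continuous_on_const continuous_on_id continuous_on_mul) metis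
    then have [measurable]: "(\<lambda>k. 1 / p g (mul (- h) k) t) \<in> borel_measurable borel"
      by (rule borel_measurable_continuous_onI)
    have F': "F' \<in> borel_measurable borel"
      using F unfolding F'_def by measurable
    have "ennreal (p g x t) * F' (mul h x) = F (mul h x)" for x
      using p_pos[OF t, of g x] by (simp add: F'_def mult.assoc[symmetric] flip: ennreal_mult)
    moreover have "ennreal (p (mul h g) x t) * F' x = ennreal (R g x) * F x" for x
      using p_pos[OF t, THEN less_imp_le] by (simp add: F'_def R_def mult.assoc[symmetric] flip: ennreal_mult)
    ultimately show ?thesis
      using nn_integral_p_left[OF t F', of g h] by simp
  qed
  have dens: "distr lborel borel (mul h) = density lborel (\<lambda>x. ennreal (R g x))" for g
  proof (rule measure_eqI)
    fix A assume "A \<in> sets (distr lborel borel (mul h))"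
    then have A: "A \<in> sets borel" by simp
    then show "emeasure (distr lborel borel (mul h)) A = emeasure (density lborel (\<lambda>x. ennreal (R g x))) A"
      using R_int[of "indicator A" g] R_meas
      by (subst nn_integral_indicator[symmetric], simp, subst nn_integral_distr) (auto simp: emeasure_density)
  qed simp
  have R_indep: "R g = R g'" for g g'
  proof (rule continuous_AE_eq_lborel[OF R_cont R_cont])
    have "AE x in lborel. ennreal (R g x) = ennreal (R g' x)"
      using dens[of g] dens[of g'] R_meas
      by (intro sigma_finite_measure.density_unique_iff[OF sigma_finite_lborel, THEN iffD1]) auto
    then show "AE x in lborel. R g x = R g' x"
      using R_pos[THEN less_imp_le] by simp
  qed
  have R_sym: "R g (mul h k) = R k (mul h g)" for g k
    by (simp add: R_def p_sym[OF t, of "mul h g"] p_sym[OF t, of g])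
  define c where "c = R 0 0"
  \<comment> \<open>\<open>R\<close> does not depend on its first argument, and \<open>R_sym\<close>
    exchanges the roles of the two. So swap, replace the argument now in first place by a fixed one,
    and swap back.\<close>
  have R_const: "R g k = c" for g k
  proof -
    have "R g k = R 0 (mul h (mul (- h) k))"
      using fun_cong[OF R_indep[of g 0]] by simp
    also have "\<dots> = R (mul (- h) k) (mul h 0)"
      by (rule R_sym)
    also have "\<dots> = R (mul (- h) 0) (mul h 0)"
      using fun_cong[OF R_indep] by metis
    also have "\<dots> = R 0 (mul h (mul (- h) 0))"
      by (rule R_sym[symmetric])
    finally show ?thesis
      by (simp add: c_def)
  qed
  show ?thesis
  proof (rule that)
    show "c > 0"
      using R_pos by (simp add: c_def)
    show "p (mul h g) (mul h k) t = c * p g k t" for g k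
      using R_const[of g "mul h k"] p_pos[OF t, of g k] by (simp add: R_def field_simps)
    show "(\<integral>\<^sup>+x. F (mul h x) \<partial>lborel) = ennreal c * (\<integral>\<^sup>+x. F x \<partial>lborel)" if "F \<in> borel_measurable borel" for F
      using R_int[OF that, of 0] that by (simp add: R_const nn_integral_cmult)
  qed
qed

text \<open>The modulus of left translation for Lebesgue measure. It is pinned down by the integral
  identity, in which \<open>t\<close> does not occur, so that one \<open>D\<close> serves the
  kernels of all times.\<close>

definition D :: "'a \<Rightarrow> real" where
  "D h = (SOME c. c > 0 \<and> (\<forall>F. F \<in> borel_measurable borel \<longrightarrow>
     (\<integral>\<^sup>+x. F (mul h x) \<partial>lborel) = ennreal c * (\<integral>\<^sup>+x. F x \<partial>lborel)))"

lemma D_pos: "D h > 0"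
  and nn_integral_left: "F \<in> borel_measurable borel \<Longrightarrow> (\<integral>\<^sup>+x. F (mul h x) \<partial>lborel) = ennreal (D h) * (\<integral>\<^sup>+x. F x \<partial>lborel)"
proof -
  have "\<exists>c. c > 0 \<and> (\<forall>F. F \<in> borel_measurable borel \<longrightarrow>
     (\<integral>\<^sup>+x. F (mul h x) \<partial>lborel) = ennreal c * (\<integral>\<^sup>+x. F x \<partial>lborel))"
    by (rule left_translation_ratio[of 1 h]) auto
  from someI_ex[OF this] show "D h > 0" "F \<in> borel_measurable borel \<Longrightarrow>
      (\<integral>\<^sup>+x. F (mul h x) \<partial>lborel) = ennreal (D h) * (\<integral>\<^sup>+x. F x \<partial>lborel)"
    by (auto simp: D_def)
qed

text \<open>The ratio lemma supplies a constant for each \<open>t\<close>. It satisfies the same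
  integral identity as \<open>D h\<close>, and testing with the unit ball, of positive finite
  measure, identifies the two.\<close>

lemma p_left:
  assumes t: "t > 0"
  shows "p (mul h g) (mul h k) t = D h * p g k t"
proof -
  obtain c where c: "c > 0" "\<And>g k. p (mul h g) (mul h k) t = c * p g k t"
    "\<And>F. F \<in> borel_measurable borel \<Longrightarrow> (\<integral>\<^sup>+x. F (mul h x) \<partial>lborel) = ennreal c * (\<integral>\<^sup>+x. F x \<partial>lborel)"
    using left_translation_ratio[OF t] by blast
  define m where "m = emeasure lborel (ball (0::'a) 1)"
  have "m \<noteq> 0" "m \<noteq> \<infinity>"
    using content_ball_pos[of 1 "0::'a"] emeasure_lborel_ball_finite[of "0::'a" 1]
    by (auto simp: m_def measure_def)
  moreover have "ennreal c * m = ennreal (D h) * m"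
  proof -
    have ind: "(indicator (ball 0 1) :: 'a \<Rightarrow> ennreal) \<in> borel_measurable borel"
      by (intro borel_measurable_indicator borel_open open_ball)
    show ?thesis
      using c(3)[OF ind] nn_integral_left[OF ind, of h] by (simp add: m_def)
  qed
  ultimately have "ennreal c = ennreal (D h)"
    by (simp add: ennreal_mult_cancel_left mult.commute[of _ m])
  then have "c = D h"
    using c(1) D_pos[of h] by simp
  with c(2) show ?thesis by simp
qed

lemma right_mul_measurable [measurable]: "(\<lambda>g. mul g h) \<in> borel_measurable borel"
  by (intro borel_measurable_continuous_onI continuous_on_mul continuous_intros)

text \<open>Inversion is \<open>x \<mapsto> - x\<close>; it preserves Lebesgue measure and turns
  right translation by \<open>h\<close> into left translation by \<open>- h\<close>.\<close>

lemma nn_integral_right: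
  assumes F: "F \<in> borel_measurable borel"
  shows "(\<integral>\<^sup>+x. F (mul x h) \<partial>lborel) = ennreal (D (- h)) * (\<integral>\<^sup>+x. F x \<partial>lborel)"
proof -
  have [measurable]: "(\<lambda>x. F (- x)) \<in> borel_measurable borel" "(\<lambda>x. F (mul x h)) \<in> borel_measurable borel"
    using F by simp_all
  have "(\<integral>\<^sup>+x. F (mul x h) \<partial>lborel) = (\<integral>\<^sup>+x. F (mul (- x) h) \<partial>lborel)"
    by (rule nn_integral_lborel_uminus[symmetric]) simp
  also have "\<dots> = (\<integral>\<^sup>+x. F (- mul (- h) x) \<partial>lborel)"
    by (simp add: uminus_mul)
  also have "\<dots> = ennreal (D (- h)) * (\<integral>\<^sup>+x. F (- x) \<partial>lborel)"
    by (rule nn_integral_left) simp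
  also have "\<dots> = ennreal (D (- h)) * (\<integral>\<^sup>+x. F x \<partial>lborel)"
    by (simp add: nn_integral_lborel_uminus F)
  finally show ?thesis .
qed

lemma integral_right:
  fixes F :: "'a \<Rightarrow> 'b::{banach, second_countable_topology}"
  assumes F: "F \<in> borel_measurable borel"
  shows "(\<integral>x. F (mul x h) \<partial>lborel) = D (- h) *\<^sub>R (\<integral>x. F x \<partial>lborel)"
proof -
  have "distr lborel borel (\<lambda>x. mul x h) = density lborel (\<lambda>_. ennreal (D (- h)))"
  proof (rule measure_eqI)
    fix A assume "A \<in> sets (distr lborel borel (\<lambda>x. mul x h))"
    then have A: "A \<in> sets borel" by simp
    then show "emeasure (distr lborel borel (\<lambda>x. mul x h)) A = emeasure (density lborel (\<lambda>_. ennreal (D (- h)))) A"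
      using nn_integral_right[of "indicator A" h]
      by (subst nn_integral_indicator[symmetric], simp, subst nn_integral_distr)
         (auto simp: emeasure_density nn_integral_cmult)
  qed simp
  then have "(\<integral>x. F x \<partial>distr lborel borel (\<lambda>x. mul x h)) = (\<integral>x. F x \<partial>density lborel (\<lambda>_. ennreal (D (- h))))"
    by simp
  then show ?thesis
    using F D_pos[of "- h"] by (simp add: integral_distr integral_density less_imp_le)
qed

end

section \<open>Characters along the first layer\<close>

lemma Ck_on_cos_sin:
  fixes l :: "'a::euclidean_space \<Rightarrow> real"
  assumes l: "bounded_linear l"
  shows "Ck_on k UNIV (\<lambda>x. cos (l x)) \<and> Ck_on k UNIV (\<lambda>x. sin (l x))"
proof (induction k)
  case 0
  show ?case
    using linear_continuous_on[OF l, of UNIV] by (auto intro!: continuous_intros)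
next
  case (Suc k)
  have dl: "(l has_derivative l) (at x)" for x
    by (rule bounded_linear_imp_has_derivative[OF l])
  have "Ck_on (Suc k) UNIV (\<lambda>x. cos (l x))"
  proof (rule Ck_on_SucI)
    show "((\<lambda>x. cos (l x)) has_derivative (\<lambda>v. sin (l x) * - l v)) (at x)" for x
      by (rule derivative_eq_intros dl | simp add: mult.commute)+
    show "Ck_on k UNIV (\<lambda>x. sin (l x) * - l v)" for v
      by (rule Ck_on_bounded_linear_comp[OF open_UNIV bounded_linear_mult_left]) (use Suc in simp)
  qed simp
  moreover have "Ck_on (Suc k) UNIV (\<lambda>x. sin (l x))"
  proof (rule Ck_on_SucI)
    show "((\<lambda>x. sin (l x)) has_derivative (\<lambda>v. cos (l x) * l v)) (at x)" for x
      by (rule derivative_eq_intros dl | simp add: mult.commute)+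
    show "Ck_on k UNIV (\<lambda>x. cos (l x) * l v)" for v
      by (rule Ck_on_bounded_linear_comp[OF open_UNIV bounded_linear_mult_left]) (use Suc in simp)
  qed simp
  ultimately show ?case ..
qed

lemma test_fun_integrable:
  fixes u :: "'a::euclidean_space \<Rightarrow> real"
  assumes "test_fun u"
  shows "integrable lborel u"
proof -
  let ?K = "closure {x. u x \<noteq> 0}"
  have "integrable lborel (\<lambda>x. indicator ?K x *\<^sub>R u x)"
    using assms by (intro borel_integrable_compact continuous_on_subset[OF test_fun_continuous]) (auto simp only: test_fun_def)
  moreover have "(\<lambda>x. indicator ?K x *\<^sub>R u x) = u"
  proof (rule ext)
    show "indicator ?K x *\<^sub>R u x = u x" for x
      using zero_outside_support[of x u] by (cases "x \<in> ?K") auto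
  qed
  ultimately show ?thesis
    by simp
qed

lemma test_fun_measurable: "test_fun u \<Longrightarrow> u \<in> borel_measurable borel"
  by (rule borel_measurable_continuous_onI[OF test_fun_continuous])

lemma test_fun_bounded:
  fixes u :: "'a::euclidean_space \<Rightarrow> real"
  assumes "test_fun u"
  obtains B where "\<And>x. \<bar>u x\<bar> \<le> B" "B \<ge> 0"
proof -
  let ?K = "closure {x. u x \<noteq> 0}"
  have "compact (u ` ?K)"
    using assms by (intro compact_continuous_image continuous_on_subset[OF test_fun_continuous]) (auto simp only: test_fun_def)
  from compact_imp_bounded[OF this] obtain B where B: "\<forall>y\<in>u ` ?K. norm y \<le> B"
    unfolding bounded_iff ..
  have "\<bar>u x\<bar> \<le> max B 0" for x
  proof (cases "x \<in> ?K")
    case True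
    then show ?thesis
      using B by (auto simp: le_max_iff_disj)
  qed (use zero_outside_support[of x u] in auto)
  then show ?thesis
    by (rule that) simp
qed

lemma test_fun_diff: "test_fun f \<Longrightarrow> test_fun g \<Longrightarrow> test_fun (\<lambda>x. f x - c * g x)"
  using test_fun_add[OF _ test_fun_cmult[of g "- c"], of f] by simp

text \<open>Prepares differentiation under the integral: dominated convergence wants sequences, and
  the bound by 1 keeps all translated supports in one compact set.\<close>

lemma has_vector_derivative_0_sequentiallyI:
  assumes "\<And>Y :: nat \<Rightarrow> real. (\<And>n. Y n \<noteq> 0) \<Longrightarrow> (\<And>n. \<bar>Y n\<bar> \<le> 1) \<Longrightarrow> Y \<longlonglongrightarrow> 0 \<Longrightarrow>
      (\<lambda>n. (F (Y n) - F 0) /\<^sub>R Y n) \<longlonglongrightarrow> d"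
  shows "(F has_vector_derivative d) (at 0)"
  unfolding has_vector_derivative_at_iff tendsto_at_iff_sequentially
proof (intro allI impI)
  fix Y :: "nat \<Rightarrow> real" assume Y0: "\<forall>i. Y i \<in> UNIV - {0}" and Y: "Y \<longlonglongrightarrow> 0"
  obtain N where N: "\<And>n. n \<ge> N \<Longrightarrow> \<bar>Y n\<bar> \<le> 1"
    using LIMSEQ_D[OF Y, of 1] by (auto intro: less_imp_le)
  have "(\<lambda>n. (F (Y (n + N)) - F 0) /\<^sub>R Y (n + N)) \<longlonglongrightarrow> d"
    by (rule assms) (use Y0 N in \<open>auto intro: LIMSEQ_ignore_initial_segment[OF Y]\<close>)
  then have "(\<lambda>n. (F (Y n) - F 0) /\<^sub>R Y n) \<longlonglongrightarrow> d"
    by (rule LIMSEQ_offset)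
  then show "((\<lambda>h. (F (0 + h) - F 0) /\<^sub>R h) \<circ> Y) \<longlonglongrightarrow> d"
    by (simp add: o_def)
qed

context carnot_heat
begin

definition pr :: "'a \<Rightarrow> real^'m" where
  "pr g = (\<chi> i. g \<bullet> e i)"

lemma e_first_layer: "e i \<in> V 1"
  using adapted span_base[of "e i" "range e"] by (auto simp: adapted_basis_def)

lemma e_orthonormal: "e i \<bullet> e j = (if i = j then 1 else 0)"
  using adapted by (simp add: adapted_basis_def)

lemma pr_mul: "pr (mul g h) = pr g + pr h"
  by (simp add: pr_def vec_eq_iff inner_first_layer_mul[OF e_first_layer])

lemma linear_pr: "linear pr"
  by (rule linearI) (simp_all add: pr_def vec_eq_iff inner_add_left)

lemma pr_0 [simp]: "pr 0 = 0"
  by (rule linear_0[OF linear_pr])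

lemma pr_uminus: "pr (- g) = - pr g"
  by (rule linear_neg[OF linear_pr])

lemma pr_e: "pr (s *\<^sub>R e i) = s *\<^sub>R axis i 1"
  by (simp add: pr_def vec_eq_iff e_orthonormal axis_def)

lemma continuous_on_pr [continuous_intros]: "continuous_on S h \<Longrightarrow> continuous_on S (\<lambda>x. pr (h x))"
  by (rule bounded_linear.continuous_on[OF linear_conv_bounded_linear[THEN iffD1, OF linear_pr]])

section \<open>Unitary characters and their pairing with functions\<close>

definition ph :: "real^'m \<Rightarrow> 'a \<Rightarrow> complex" where
  "ph \<xi> g = cis (\<xi> \<bullet> pr g)"

lemma norm_ph [simp]: "norm (ph \<xi> g) = 1"
  by (simp add: ph_def)

lemma ph_mul: "ph \<xi> (mul g h) = ph \<xi> g * ph \<xi> h"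
  by (simp add: ph_def pr_mul inner_add_right cis_mult)

lemma ph_0 [simp]: "ph 0 g = 1" "ph \<xi> 0 = 1"
  by (simp_all add: ph_def)

lemma continuous_on_ph [continuous_intros]: "continuous_on S h \<Longrightarrow> continuous_on S (\<lambda>x. ph \<xi> (h x))"
  unfolding ph_def cis_conv_exp by (intro continuous_intros)

lemma ph_measurable [measurable]: "ph \<xi> \<in> borel_measurable borel"
  by (rule borel_measurable_continuous_onI[OF continuous_on_ph[OF continuous_on_id]])

lemma integrable_ph:
  assumes "integrable lborel u"
  shows "integrable lborel (\<lambda>g. u g *\<^sub>R ph \<xi> g)"
  using assms by (rule Bochner_Integration.integrable_bound) (use assms in auto)

text \<open>The Fourier coefficient of \<open>u\<close> at the character
  \<open>ph \<xi>\<close>.\<close>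

definition K :: "real^'m \<Rightarrow> ('a \<Rightarrow> real) \<Rightarrow> complex" where
  "K \<xi> u = (\<integral>g. u g *\<^sub>R ph \<xi> g \<partial>lborel)"

lemma K_lincomb:
  assumes "integrable lborel u" "integrable lborel v"
  shows "K \<xi> (\<lambda>x. a * u x + b * v x) = a *\<^sub>R K \<xi> u + b *\<^sub>R K \<xi> v"
proof -
  have "K \<xi> (\<lambda>x. a * u x + b * v x) = (\<integral>g. a *\<^sub>R (u g *\<^sub>R ph \<xi> g) + b *\<^sub>R (v g *\<^sub>R ph \<xi> g) \<partial>lborel)"
    unfolding K_def by (simp only: scaleR_add_left scaleR_scaleR)
  also have "\<dots> = (\<integral>g. a *\<^sub>R (u g *\<^sub>R ph \<xi> g) \<partial>lborel) + (\<integral>g. b *\<^sub>R (v g *\<^sub>R ph \<xi> g) \<partial>lborel)"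
    by (intro Bochner_Integration.integral_add integrable_scaleR_right integrable_ph assms)
  finally show ?thesis
    unfolding K_def integral_scaleR_right .
qed

lemma K_sum:
  assumes "\<And>i. i \<in> I \<Longrightarrow> integrable lborel (u i)"
  shows "K \<xi> (\<lambda>x. \<Sum>i\<in>I. u i x) = (\<Sum>i\<in>I. K \<xi> (u i))"
  unfolding K_def scaleR_sum_left
  by (rule Bochner_Integration.integral_sum) (simp add: assms integrable_ph)

text \<open>The eigenvalue of the kernel on the character (\<open>p_character\<close>), equivalently
  the Fourier transform of the projected kernel started at \<open>0\<close>.\<close>

definition c :: "real \<Rightarrow> real^'m \<Rightarrow> complex" where
  "c t \<xi> = (\<integral>g. p 0 g t *\<^sub>R ph \<xi> g \<partial>lborel)"

definition mass :: "real \<Rightarrow> real" where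
  "mass t = (\<integral>g. p 0 g t \<partial>lborel)"

lemma c_0: "c t 0 = mass t"
  by (simp add: c_def mass_def of_real_def[symmetric])

lemma p_character: "t > 0 \<Longrightarrow> (\<integral>g. p h g t *\<^sub>R ph \<xi> g \<partial>lborel) = c t \<xi> * ph \<xi> h"
proof -
  assume t: "t > 0"
  have "(\<integral>g. p h g t *\<^sub>R ph \<xi> g \<partial>lborel) = (\<integral>g. p 0 g t *\<^sub>R ph \<xi> (mul h g) \<partial>lborel)"
    using integral_p_left[OF t ph_measurable[of \<xi>], of 0 h] by simp
  also have "\<dots> = (\<integral>g. (p 0 g t *\<^sub>R ph \<xi> g) * ph \<xi> h \<partial>lborel)"
    by (simp add: ph_mul mult.commute)
  also have "\<dots> = c t \<xi> * ph \<xi> h"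
    unfolding c_def by (rule integral_mult_left_zero)
  finally show ?thesis .
qed

lemma p_mass: "t > 0 \<Longrightarrow> (\<integral>x. p h x t \<partial>lborel) = mass t"
  using integral_p_left[of t "\<lambda>_. 1::real" 0 h] by (simp add: mass_def)

lemma mass_bounds: "t > 0 \<Longrightarrow> 0 \<le> mass t" "t > 0 \<Longrightarrow> mass t \<le> 1"
proof -
  assume t: "t > 0"
  show "0 \<le> mass t"
    using p_pos[OF t] by (simp add: mass_def less_imp_le)
  have "ennreal (mass t) = (\<integral>\<^sup>+x. ennreal (p 0 x t) \<partial>lborel)"
    unfolding mass_def using p_pos[OF t] by (intro nn_integral_eq_integral[symmetric] integrable_p[OF t]) (simp add: less_imp_le)
  also have "\<dots> \<le> ennreal 1"
    using nn_integral_p_le_1[OF t] by simp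
  finally show "mass t \<le> 1"
    by simp
qed

text \<open>Symmetry of \<open>p\<close> lets Fubini move the kernel from \<open>\<psi>\<close> onto
  the character, where \<open>p_character\<close> applies. The bound on absolute integrals is the
  same exchange with mass at most one; it provides the domination in
  \<open>c_exponential\<close>.\<close>

lemma P_pairing:
  assumes t: "t > 0" and \<psi>: "test_fun \<psi>"
  shows "integrable lborel (P t \<psi>)" "(\<integral>g. \<bar>P t \<psi> g\<bar> \<partial>lborel) \<le> (\<integral>g. \<bar>\<psi> g\<bar> \<partial>lborel)"
    "K \<xi> (P t \<psi>) = c t \<xi> * K \<xi> \<psi>"
proof -
  note [measurable] = test_fun_measurable[OF \<psi>]
  have P_eq: "P t \<psi> g = (\<integral>g'. p g g' t * \<psi> g' \<partial>lborel)" for g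
    using p_integral[OF t test_fun_C0[OF \<psi>], of g] by (simp add: has_bochner_integral_iff)
  have p_int: "integrable lborel (\<lambda>g. p g g' t)" for g'
    using integrable_p[OF t, of g'] by (simp add: p_sym[OF t, of _ g'])
  have p_mass': "(\<integral>g. p g g' t \<partial>lborel) = mass t" for g'
    using p_mass[OF t, of g'] by (simp add: p_sym[OF t, of _ g'])
  have int: "integrable (lborel \<Otimes>\<^sub>M lborel) (\<lambda>(g', g). (p g g' t * \<psi> g') *\<^sub>R ph \<xi> g)" for \<xi>
  proof (rule lborel_pair.Fubini_integrable)
    have "continuous_on UNIV (\<lambda>(g', g). (p g g' t * \<psi> g') *\<^sub>R ph \<xi> g)"
      unfolding split_beta by (intro continuous_intros p_continuous[OF t] continuous_on_compose2[OF test_fun_continuous[OF \<psi>]]) auto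
    then show "(\<lambda>(g', g). (p g g' t * \<psi> g') *\<^sub>R ph \<xi> g) \<in> borel_measurable (lborel \<Otimes>\<^sub>M lborel)"
      unfolding lborel_prod by (simp add: borel_measurable_continuous_onI)
    have "(\<integral>g. norm ((p g g' t * \<psi> g') *\<^sub>R ph \<xi> g) \<partial>lborel) = mass t * \<bar>\<psi> g'\<bar>" for g'
      using p_pos[OF t, THEN less_imp_le] p_int by (simp add: abs_mult p_mass')
    then show "integrable lborel (\<lambda>x. \<integral>y. norm (case (x, y) of (g', g) \<Rightarrow> (p g g' t * \<psi> g') *\<^sub>R ph \<xi> g) \<partial>lborel)"
      using test_fun_integrable[OF \<psi>] by simp
    show "AE x in lborel. integrable lborel (\<lambda>y. case (x, y) of (g', g) \<Rightarrow> (p g g' t * \<psi> g') *\<^sub>R ph \<xi> g)"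
      using p_int by (simp add: integrable_ph)
  qed
  \<comment> \<open>The trivial character reduces the real integrand to the complex case just
    treated.\<close>
  have int0: "integrable (lborel \<Otimes>\<^sub>M lborel) (\<lambda>(g', g). p g g' t * \<psi> g')"
  proof -
    have "integrable (lborel \<Otimes>\<^sub>M lborel) (\<lambda>x. Re (case x of (g', g) \<Rightarrow> (p g g' t * \<psi> g') *\<^sub>R ph 0 g))"
      by (intro integrable_Re int)
    then show ?thesis
      by (simp add: case_prod_unfold)
  qed
  from lborel_pair.integrable_snd[OF int0] show P_int: "integrable lborel (P t \<psi>)"
    by (simp add: P_eq[abs_def])
  have int_abs: "integrable (lborel \<Otimes>\<^sub>M lborel) (\<lambda>(g', g). p g g' t * \<bar>\<psi> g'\<bar>)"
    using integrable_abs[OF int0] p_pos[OF t, THEN less_imp_le] by (simp add: case_prod_unfold abs_mult)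
  have "(\<integral>g. \<bar>P t \<psi> g\<bar> \<partial>lborel) \<le> (\<integral>g. (\<integral>g'. p g g' t * \<bar>\<psi> g'\<bar> \<partial>lborel) \<partial>lborel)"
  proof (rule integral_mono)
    show "integrable lborel (\<lambda>g. \<bar>P t \<psi> g\<bar>)"
      by (intro integrable_abs P_int)
    show "integrable lborel (\<lambda>g. \<integral>g'. p g g' t * \<bar>\<psi> g'\<bar> \<partial>lborel)"
      by (rule lborel_pair.integrable_snd[OF int_abs])
    show "\<bar>P t \<psi> g\<bar> \<le> (\<integral>g'. p g g' t * \<bar>\<psi> g'\<bar> \<partial>lborel)" for g
      unfolding P_eq using integral_abs_bound[of lborel "\<lambda>g'. p g g' t * \<psi> g'"] p_pos[OF t, THEN less_imp_le]
      by (simp add: abs_mult)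
  qed
  also have "\<dots> = (\<integral>g'. (\<integral>g. p g g' t * \<bar>\<psi> g'\<bar> \<partial>lborel) \<partial>lborel)"
    by (rule lborel_pair.Fubini_integral[OF int_abs])
  also have "\<dots> = mass t * (\<integral>g'. \<bar>\<psi> g'\<bar> \<partial>lborel)"
    by (simp add: p_mass')
  also have "\<dots> \<le> 1 * (\<integral>g'. \<bar>\<psi> g'\<bar> \<partial>lborel)"
    by (intro mult_right_mono mass_bounds[OF t] integral_nonneg_AE) auto
  finally show "(\<integral>g. \<bar>P t \<psi> g\<bar> \<partial>lborel) \<le> (\<integral>g. \<bar>\<psi> g\<bar> \<partial>lborel)"
    by simp
  have "K \<xi> (P t \<psi>) = (\<integral>g. (\<integral>g'. (p g g' t * \<psi> g') *\<^sub>R ph \<xi> g \<partial>lborel) \<partial>lborel)"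
    unfolding K_def P_eq by (simp add: integral_scaleR_left[OF has_bochner_integral_integrable[THEN has_bochner_integral_iff[THEN iffD1, THEN conjunct1]]]
        p_integral[OF t test_fun_C0[OF \<psi>], unfolded has_bochner_integral_iff])
  also have "\<dots> = (\<integral>g'. (\<integral>g. (p g g' t * \<psi> g') *\<^sub>R ph \<xi> g \<partial>lborel) \<partial>lborel)"
    by (rule lborel_pair.Fubini_integral[OF int])
  also have "\<dots> = (\<integral>g'. c t \<xi> * (\<psi> g' *\<^sub>R ph \<xi> g') \<partial>lborel)"
  proof (rule Bochner_Integration.integral_cong[OF refl])
    fix g'
    have "(\<integral>g. (p g g' t * \<psi> g') *\<^sub>R ph \<xi> g \<partial>lborel) = (\<integral>g. \<psi> g' *\<^sub>R (p g' g t *\<^sub>R ph \<xi> g) \<partial>lborel)"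
      by (simp add: p_sym[OF t, of _ g'] mult.commute)
    also have "\<dots> = \<psi> g' *\<^sub>R (c t \<xi> * ph \<xi> g')"
      unfolding integral_scaleR_right p_character[OF t] ..
    finally show "(\<integral>g. (p g g' t * \<psi> g') *\<^sub>R ph \<xi> g \<partial>lborel) = c t \<xi> * (\<psi> g' *\<^sub>R ph \<xi> g')"
      by simp
  qed
  also have "\<dots> = c t \<xi> * K \<xi> \<psi>"
    unfolding K_def by (rule integral_mult_right_zero)
  finally show "K \<xi> (P t \<psi>) = c t \<xi> * K \<xi> \<psi>" .
qed

text \<open>The change of variables \<open>g \<mapsto> mul g (- h)\<close> produces the right
  modulus and, the character being multiplicative, the factor \<open>ph \<xi> (- h)\<close>.\<close>

lemma K_shift:
  assumes "test_fun \<phi>"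
  shows "(\<integral>g. \<phi> (mul g h) *\<^sub>R ph \<xi> g \<partial>lborel) = D (- h) *\<^sub>R (ph \<xi> (- h) * K \<xi> \<phi>)"
proof -
  note [measurable] = test_fun_measurable[OF assms]
  have "(\<integral>g. \<phi> (mul g h) *\<^sub>R ph \<xi> (mul (mul g h) (- h)) \<partial>lborel) = D (- h) *\<^sub>R (\<integral>g. \<phi> g *\<^sub>R ph \<xi> (mul g (- h)) \<partial>lborel)"
    by (rule integral_right[of "\<lambda>x. \<phi> x *\<^sub>R ph \<xi> (mul x (- h))"]) simp
  also have "(\<integral>g. \<phi> g *\<^sub>R ph \<xi> (mul g (- h)) \<partial>lborel) = (\<integral>g. ph \<xi> (- h) * (\<phi> g *\<^sub>R ph \<xi> g) \<partial>lborel)"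
    by (simp add: ph_mul mult.commute)
  also have "\<dots> = ph \<xi> (- h) * K \<xi> \<phi>"
    unfolding K_def by (rule integral_mult_right_zero)
  finally show ?thesis
    by (simp add: assoc)
qed

lemma K_shift_derivative:
  assumes \<phi>: "test_fun \<phi>"
  shows "((\<lambda>s. \<integral>g. \<phi> (mul g (s *\<^sub>R v)) *\<^sub>R ph \<xi> g \<partial>lborel) has_vector_derivative K \<xi> (left_inv_deriv mul v \<phi>)) (at 0)"
proof (rule has_vector_derivative_0_sequentiallyI)
  note [measurable] = test_fun_measurable[OF \<phi>]
  have smooth: "smooth_on UNIV \<phi>"
    using \<phi> by (simp add: test_fun_def)
  let ?d = "left_inv_deriv mul v \<phi>" and ?S = "closure {x. \<phi> x \<noteq> 0}"
  \<comment> \<open>\<open>C\<close> contains the supports of all translates with parameter in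
    \<open>[-1, 1]\<close>. By the mean value theorem every difference quotient is then dominated by
    \<open>B\<close> times the indicator of \<open>C\<close>.\<close>
  define C where "C = (\<lambda>(k, s). mul k (- (s *\<^sub>R v))) ` (?S \<times> {-1..1::real})"
  have C: "compact C"
    unfolding C_def split_beta using \<phi>
    by (intro compact_continuous_image compact_Times continuous_on_mul continuous_intros) (auto simp only: test_fun_def compact_Icc)
  have zero: "\<phi> (mul g (s *\<^sub>R v)) = 0" if "g \<notin> C" "\<bar>s\<bar> \<le> 1" for g s
  proof (rule zero_outside_support[of _ \<phi>], rule notI)
    assume "mul g (s *\<^sub>R v) \<in> ?S"
    then have "(\<lambda>(k, s). mul k (- (s *\<^sub>R v))) (mul g (s *\<^sub>R v), s) \<in> C"
      unfolding C_def using that(2) by (intro imageI) auto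
    with that(1) show False
      by (simp add: assoc)
  qed
  obtain B where B: "\<And>x. \<bar>?d x\<bar> \<le> B" "B \<ge> 0"
    using test_fun_bounded[OF test_fun_left_inv_deriv[OF \<phi>]] by blast
  obtain B0 where B0: "\<And>x. \<bar>\<phi> x\<bar> \<le> B0" "B0 \<ge> 0"
    using test_fun_bounded[OF \<phi>] by blast
  have C_int: "integrable lborel (\<lambda>g. b * indicator C g :: real)" for b
    using emeasure_compact_finite[OF C] borel_closed[OF compact_imp_closed[OF C]] by (intro integrable_mult_right) simp
  have int: "integrable lborel (\<lambda>g. \<phi> (mul g (s *\<^sub>R v)))" if "\<bar>s\<bar> \<le> 1" for s
    by (rule Bochner_Integration.integrable_bound[OF C_int[of B0]])
      (use that zero B0 in \<open>auto simp: indicator_def\<close>)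
  fix Y :: "nat \<Rightarrow> real"
  assume Y: "\<And>n. Y n \<noteq> 0" "\<And>n. \<bar>Y n\<bar> \<le> 1" and Y_lim: "Y \<longlonglongrightarrow> 0"
  define q where "q n g = (\<phi> (mul g (Y n *\<^sub>R v)) - \<phi> g) / Y n" for n g
  have "(\<lambda>n. \<integral>g. q n g *\<^sub>R ph \<xi> g \<partial>lborel) \<longlonglongrightarrow> (\<integral>g. ?d g *\<^sub>R ph \<xi> g \<partial>lborel)"
  proof (rule integral_dominated_convergence[OF _ _ C_int[of B]])
    show "(\<lambda>g. ?d g *\<^sub>R ph \<xi> g) \<in> borel_measurable lborel"
      using test_fun_measurable[OF test_fun_left_inv_deriv[OF \<phi>, of v]] by simp
    show "(\<lambda>g. q n g *\<^sub>R ph \<xi> g) \<in> borel_measurable lborel" for n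
      unfolding q_def by simp
    have "(\<lambda>n. q n g) \<longlonglongrightarrow> ?d g" for g
    proof -
      have "((\<lambda>h. (\<phi> (mul g ((0 + h) *\<^sub>R v)) - \<phi> (mul g (0 *\<^sub>R v))) / h) \<longlongrightarrow> ?d g) (at 0)"
        using curve_has_real_derivative[OF smooth, of g v 0] by (simp add: DERIV_def)
      moreover have "filterlim Y (at 0) sequentially"
        using Y Y_lim by (simp add: filterlim_at)
      ultimately have "(\<lambda>n. (\<phi> (mul g ((0 + Y n) *\<^sub>R v)) - \<phi> (mul g (0 *\<^sub>R v))) / Y n) \<longlonglongrightarrow> ?d g"
        by (rule filterlim_compose)
      then show ?thesis
        by (simp add: q_def)
    qed
    then show "AE g in lborel. (\<lambda>n. q n g *\<^sub>R ph \<xi> g) \<longlonglongrightarrow> ?d g *\<^sub>R ph \<xi> g"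
      by (intro AE_I2 tendsto_scaleR tendsto_const)
    have "\<bar>q n g\<bar> \<le> B * indicator C g" for n g
    proof (cases "g \<in> C")
      case True
      have "norm (\<phi> (mul g (Y n *\<^sub>R v)) - \<phi> (mul g (0 *\<^sub>R v))) \<le> B * norm (Y n - 0)"
        by (rule field_differentiable_bound[of UNIV])
          (use B curve_has_real_derivative[OF smooth, of g v] in auto)
      then show ?thesis
        using True Y(1)[of n] by (simp add: q_def divide_le_eq)
    next
      case False
      then show ?thesis
        using zero[OF False Y(2)[of n]] zero[OF False, of 0] by (simp add: q_def)
    qed
    then show "AE g in lborel. norm (q n g *\<^sub>R ph \<xi> g) \<le> B * indicator C g" for n
      by simp
  qed
  moreover have "(\<integral>g. q n g *\<^sub>R ph \<xi> g \<partial>lborel) = ((\<integral>g. \<phi> (mul g (Y n *\<^sub>R v)) *\<^sub>R ph \<xi> g \<partial>lborel) -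
      (\<integral>g. \<phi> (mul g (0 *\<^sub>R v)) *\<^sub>R ph \<xi> g \<partial>lborel)) /\<^sub>R Y n" for n
  proof -
    have "q n g *\<^sub>R ph \<xi> g = inverse (Y n) *\<^sub>R (\<phi> (mul g (Y n *\<^sub>R v)) *\<^sub>R ph \<xi> g - \<phi> g *\<^sub>R ph \<xi> g)" for g
      by (simp add: q_def divide_inverse mult.commute scaleR_diff_left[symmetric])
    then show ?thesis
      using integrable_ph[OF int[OF Y(2)[of n]], of \<xi>] integrable_ph[OF test_fun_integrable[OF \<phi>], of \<xi>] by simp
  qed
  ultimately show "(\<lambda>n. ((\<integral>g. \<phi> (mul g (Y n *\<^sub>R v)) *\<^sub>R ph \<xi> g \<partial>lborel) -
      (\<integral>g. \<phi> (mul g (0 *\<^sub>R v)) *\<^sub>R ph \<xi> g \<partial>lborel)) /\<^sub>R Y n) \<longlonglongrightarrow> K \<xi> ?d"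
    by (simp add: K_def)
qed

text \<open>No bump function is constructed: the domain of the generator is dense and test functions form a core.\<close>

lemma exists_test_fun: "\<exists>\<phi> (x::'a). test_fun \<phi> \<and> \<phi> x \<noteq> 0"
proof -
  define u :: "'a \<Rightarrow> real" where "u x = max 0 (1 - 1 * infdist x {0})" for x
  have "C0_fun u"
    unfolding u_def by (rule C0_fun_bump) auto
  from generator_dense[OF this, of "1 / 4"] obtain w w' where
    w: "(w, w') \<in> generator_C0 P" "\<And>x. \<bar>w x - u x\<bar> \<le> 1 / 4" by auto
  then obtain \<phi> where \<phi>: "\<And>n::nat. test_fun (\<phi> n)" "uniform_limit UNIV \<phi> w sequentially"
    unfolding generator_eq laplacian_closure_C0_def by auto
  have "\<forall>\<^sub>F n in sequentially. \<forall>x\<in>UNIV. dist (\<phi> n x) (w x) < 1 / 4"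
    by (rule uniform_limitD[OF \<phi>(2)]) simp
  then obtain n where "dist (\<phi> n 0) (w 0) < 1 / 4"
    by (auto simp: eventually_sequentially)
  moreover have "u 0 = 1"
    by (simp add: u_def)
  ultimately have "\<phi> n 0 \<noteq> 0"
    using w(2)[of 0] by (auto simp: dist_real_def)
  with \<phi>(1)[of n] show ?thesis
    by (intro exI[of _ "\<phi> n"] exI[of _ 0]) simp
qed

text \<open>Test functions are real, so the modulus of a test function \<open>\<phi>\<close> is
  recovered from two pairings: multiplying its square by the cosine and the sine of the phase, the
  real part of the first plus the imaginary part of the second is the integral of the square of
  \<open>\<phi>\<close>.\<close>

lemma exists_K_nonzero: "\<exists>\<psi>. test_fun \<psi> \<and> K \<xi> \<psi> \<noteq> 0"
proof (rule ccontr)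
  assume "\<not> ?thesis"
  then have K0: "K \<xi> \<psi> = 0" if "test_fun \<psi>" for \<psi>
    using that by blast
  obtain \<phi> :: "'a \<Rightarrow> real" and x0 where \<phi>: "test_fun \<phi>" "\<phi> x0 \<noteq> 0"
    using exists_test_fun by blast
  define l where "l g = \<xi> \<bullet> pr g" for g
  have l: "bounded_linear l"
    unfolding l_def using linear_pr by (intro bounded_linear_inner_right_comp) (simp add: linear_conv_bounded_linear)
  have smooth: "smooth_on UNIV \<phi>" "smooth_on UNIV (\<lambda>x. cos (l x))" "smooth_on UNIV (\<lambda>x. sin (l x))"
    using \<phi>(1) Ck_on_cos_sin[OF l] by (auto simp: test_fun_def smooth_on_def)
  let ?c = "\<lambda>x. \<phi> x * \<phi> x * cos (l x)" and ?s = "\<lambda>x. \<phi> x * \<phi> x * sin (l x)"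
  have test: "test_fun ?c" "test_fun ?s"
    by (intro test_fun_mult_smooth \<phi> smooth)+
  have "integrable lborel (\<lambda>g. Re (?c g *\<^sub>R ph \<xi> g))" "(\<integral>g. Re (?c g *\<^sub>R ph \<xi> g) \<partial>lborel) = 0"
    using integrable_ph[OF test_fun_integrable[OF test(1)], of \<xi>] K0[OF test(1)]
    by (auto simp only: K_def integral_Re integrable_Re zero_complex.simps)
  moreover have "integrable lborel (\<lambda>g. Im (?s g *\<^sub>R ph \<xi> g))" "(\<integral>g. Im (?s g *\<^sub>R ph \<xi> g) \<partial>lborel) = 0"
    using integrable_ph[OF test_fun_integrable[OF test(2)], of \<xi>] K0[OF test(2)]
    by (auto simp only: K_def integral_Im integrable_Im zero_complex.simps)
  ultimately have "(\<integral>g. Re (?c g *\<^sub>R ph \<xi> g) + Im (?s g *\<^sub>R ph \<xi> g) \<partial>lborel) = 0"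
    "integrable lborel (\<lambda>g. Re (?c g *\<^sub>R ph \<xi> g) + Im (?s g *\<^sub>R ph \<xi> g))"
    by simp_all
  moreover have "Re (?c g *\<^sub>R ph \<xi> g) + Im (?s g *\<^sub>R ph \<xi> g) = (\<phi> g)\<^sup>2" for g
  proof -
    have "Re (?c g *\<^sub>R ph \<xi> g) + Im (?s g *\<^sub>R ph \<xi> g) = (\<phi> g)\<^sup>2 * ((cos (l g))\<^sup>2 + (sin (l g))\<^sup>2)"
      by (simp add: ph_def l_def[symmetric] power2_eq_square algebra_simps
          del: sin_cos_squared_add sin_cos_squared_add2 sin_cos_squared_add3)
    then show ?thesis by simp
  qed
  ultimately have "(\<integral>g. (\<phi> g)\<^sup>2 \<partial>lborel) = 0" "integrable lborel (\<lambda>g. (\<phi> g)\<^sup>2)"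
    by simp_all
  then have "AE g in lborel. (\<phi> g)\<^sup>2 = 0"
    using integral_nonneg_eq_0_iff_AE[of lborel "\<lambda>g. (\<phi> g)\<^sup>2"] by simp
  then have "AE g in lborel. \<phi> g = 0"
    by simp
  then have "\<phi> = (\<lambda>_. 0)"
    by (intro continuous_AE_eq_lborel test_fun_continuous[OF \<phi>(1)] continuous_on_const)
  with \<phi>(2) show False by simp
qed

text \<open>\<open>a i\<close> is the derivative at \<open>0\<close> of the modulus along \<open>e i\<close>; conservation of mass will force it to vanish.\<close>

lemma K_left_inv_deriv:
  obtains a where "\<And>\<phi> \<xi>. test_fun \<phi> \<Longrightarrow> K \<xi> (left_inv_deriv mul (e i) \<phi>) = Complex a (- (\<xi> $ i)) * K \<xi> \<phi>"
proof -
  obtain \<psi> where \<psi>: "test_fun \<psi>" "K 0 \<psi> \<noteq> 0"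
    using exists_K_nonzero by blast
  \<comment> \<open>Dividing the shifted pairing at frequency zero by \<open>K 0 \<psi>\<close>
    leaves \<open>D\<close> alone. So differentiability of the modulus along \<open>e i\<close>
    comes from that of the pairing, with derivative \<open>k\<close>.\<close>
  define k where "k = K 0 (left_inv_deriv mul (e i) \<psi>) / K 0 \<psi>"
  have "((\<lambda>s. D (- (s *\<^sub>R e i)) *\<^sub>R K 0 \<psi>) has_vector_derivative K 0 (left_inv_deriv mul (e i) \<psi>)) (at 0)"
    using K_shift_derivative[OF \<psi>(1), of "e i" 0] unfolding K_shift[OF \<psi>(1)] by simp
  from has_vector_derivative_mult_left[OF this, of "inverse (K 0 \<psi>)"]
  have "((\<lambda>s. (D (- (s *\<^sub>R e i)) *\<^sub>R K 0 \<psi>) * inverse (K 0 \<psi>)) has_vector_derivative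
      K 0 (left_inv_deriv mul (e i) \<psi>) * inverse (K 0 \<psi>)) (at 0)" .
  then have "((\<lambda>s. complex_of_real (D (- (s *\<^sub>R e i)))) has_vector_derivative k) (at 0)"
  proof -
    have "(d *\<^sub>R K 0 \<psi>) * inverse (K 0 \<psi>) = complex_of_real d" for d
      using \<psi>(2) by (simp add: scaleR_conv_of_real mult.assoc)
    then show ?thesis
      using \<open>(_ has_vector_derivative _ * inverse _) (at 0)\<close> by (simp only: k_def divide_inverse)
  qed
  from bounded_linear.has_vector_derivative[OF bounded_linear_Re this]
  have dD: "((\<lambda>s. D (- (s *\<^sub>R e i))) has_vector_derivative Re k) (at 0)"
    by simp
  have D0: "D 0 = 1"
    using p_left[of 1 0 0 0] p_pos[of 1 0 0] by simp
  show ?thesis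
  proof (rule that)
    fix \<phi> :: "'a \<Rightarrow> real" and \<xi> assume \<phi>: "test_fun \<phi>"
    have ph: "ph \<xi> (- (s *\<^sub>R e i)) = cis (- (s * \<xi> $ i))" for s
      by (simp add: ph_def pr_uminus pr_e inner_axis)
    have "((\<lambda>s. ph \<xi> (- (s *\<^sub>R e i))) has_vector_derivative - (\<xi> $ i) *\<^sub>R \<i>) (at 0)"
    proof -
      have "((\<lambda>s. of_real (cos (- (s * \<xi> $ i))) + of_real (sin (- (s * \<xi> $ i))) * \<i>) has_vector_derivative
          of_real 0 + of_real (- (\<xi> $ i)) * \<i>) (at 0)"
        by (intro has_vector_derivative_add has_vector_derivative_mult_left has_vector_derivative_of_real)
          (auto intro!: derivative_eq_intros)
      then show ?thesis
        by (simp add: ph cis.code Complex_eq mult.commute scaleR_conv_of_real)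
    qed
    from has_vector_derivative_scaleR[OF dD[unfolded has_real_derivative_iff_has_vector_derivative[symmetric]] this]
    have "((\<lambda>s. D (- (s *\<^sub>R e i)) *\<^sub>R ph \<xi> (- (s *\<^sub>R e i))) has_vector_derivative Complex (Re k) (- (\<xi> $ i))) (at 0)"
      by (simp add: D0 Complex_eq scaleR_conv_of_real add.commute mult.commute[of \<i>])
    from has_vector_derivative_mult_left[OF this, of "K \<xi> \<phi>"]
    have "((\<lambda>s. \<integral>g. \<phi> (mul g (s *\<^sub>R e i)) *\<^sub>R ph \<xi> g \<partial>lborel) has_vector_derivative Complex (Re k) (- (\<xi> $ i)) * K \<xi> \<phi>) (at 0)"
      unfolding K_shift[OF \<phi>] by simp
    then show "K \<xi> (left_inv_deriv mul (e i) \<phi>) = Complex (Re k) (- (\<xi> $ i)) * K \<xi> \<phi>"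
      using K_shift_derivative[OF \<phi>] vector_derivative_unique_at by blast
  qed
qed

lemma K_horizontal_laplacian:
  obtains a where "\<And>\<phi> \<xi>. test_fun \<phi> \<Longrightarrow>
    K \<xi> (horizontal_laplacian mul e \<phi>) = (\<Sum>i\<in>UNIV. (Complex (a i) (- (\<xi> $ i)))\<^sup>2) * K \<xi> \<phi>"
proof -
  have "\<forall>i. \<exists>a. \<forall>\<phi> \<xi>. test_fun \<phi> \<longrightarrow> K \<xi> (left_inv_deriv mul (e i) \<phi>) = Complex a (- (\<xi> $ i)) * K \<xi> \<phi>"
    by (intro allI, rule K_left_inv_deriv) blast
  then obtain a where a: "\<And>i \<phi> \<xi>. test_fun \<phi> \<Longrightarrow> K \<xi> (left_inv_deriv mul (e i) \<phi>) = Complex (a i) (- (\<xi> $ i)) * K \<xi> \<phi>"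
    by metis
  show ?thesis
  proof (rule that)
    fix \<phi> :: "'a \<Rightarrow> real" and \<xi> assume \<phi>: "test_fun \<phi>"
    have "K \<xi> (horizontal_laplacian mul e \<phi>) = (\<Sum>i\<in>UNIV. K \<xi> (left_inv_deriv mul (e i) (left_inv_deriv mul (e i) \<phi>)))"
      unfolding horizontal_laplacian_def[abs_def]
      by (rule K_sum) (intro test_fun_integrable test_fun_left_inv_deriv \<phi>)
    then show "K \<xi> (horizontal_laplacian mul e \<phi>) = (\<Sum>i\<in>UNIV. (Complex (a i) (- (\<xi> $ i)))\<^sup>2) * K \<xi> \<phi>"
      by (simp add: a test_fun_left_inv_deriv \<phi> sum_distrib_right power2_eq_square mult.assoc)
  qed
qed

section \<open>Time evolution of the pairing and the eigenvalue of the kernel\<close>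

lemma test_fun_generator: "test_fun \<psi> \<Longrightarrow> (\<psi>, horizontal_laplacian mul e \<psi>) \<in> generator_C0 P"
  unfolding generator_eq laplacian_closure_C0_def mem_Collect_eq prod.case
  by (intro conjI exI[of _ "\<lambda>n. \<psi>"]) (simp_all add: test_fun_C0 test_fun_horizontal_laplacian uniform_limit_const)

text \<open>Supplies the product measurability for the exchange of the time and group integrals in
  \<open>c_exponential\<close>.\<close>

lemma P_jointly_continuous:
  assumes u: "C0_fun u"
  shows "continuous_on ({0..} \<times> UNIV) (\<lambda>x. P (fst x) u (snd x))"
  unfolding continuous_on_iff
proof (intro ballI allI impI)
  fix z :: "real \<times> 'a" and \<epsilon> :: real assume z: "z \<in> {0..} \<times> UNIV" and \<epsilon>: "\<epsilon> > 0"
  then have \<epsilon>2: "\<epsilon> / 2 > 0" and s: "fst z \<ge> 0" by auto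
  from P_uniformly_continuous[OF u \<epsilon>2] obtain d1 where d1: "d1 > 0"
    "\<And>s t x. s \<ge> 0 \<Longrightarrow> t \<ge> 0 \<Longrightarrow> \<bar>s - t\<bar> < d1 \<Longrightarrow> \<bar>P s u x - P t u x\<bar> \<le> \<epsilon> / 2" by blast
  have "continuous_on UNIV (P (fst z) u)"
    using P_C0[OF s u] by (simp add: C0_fun_def)
  then obtain d2 where d2: "d2 > 0" "\<And>x. dist x (snd z) < d2 \<Longrightarrow> dist (P (fst z) u x) (P (fst z) u (snd z)) < \<epsilon> / 2"
    using \<epsilon>2 unfolding continuous_on_iff by (metis UNIV_I)
  show "\<exists>d>0. \<forall>z'\<in>{0..} \<times> UNIV. dist z' z < d \<longrightarrow> dist (P (fst z') u (snd z')) (P (fst z) u (snd z)) < \<epsilon>"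
  proof (intro exI[of _ "min d1 d2"] conjI ballI impI)
    fix z' :: "real \<times> 'a" assume z': "z' \<in> {0..} \<times> UNIV" "dist z' z < min d1 d2"
    have "\<bar>P (fst z') u (snd z') - P (fst z) u (snd z')\<bar> \<le> \<epsilon> / 2"
      using z' s dist_fst_le[of z' z] by (intro d1(2)) (auto simp: dist_real_def)
    moreover have "dist (P (fst z) u (snd z')) (P (fst z) u (snd z)) < \<epsilon> / 2"
      using z' dist_snd_le[of z' z] by (intro d2(2)) simp
    ultimately show "dist (P (fst z') u (snd z')) (P (fst z) u (snd z)) < \<epsilon>"
      unfolding dist_real_def by linarith
  qed (use d1 d2 in auto)
qed

text \<open>The fundamental theorem of calculus for \<open>exp (- B * s) * P s \<psi> g\<close> at a
  fixed point \<open>g\<close>; the exponential absorbs the expected eigenvalue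
  \<open>B\<close>.\<close>

lemma P_eigen_integral:
  assumes t: "t \<ge> 0" and \<psi>: "test_fun \<psi>"
  shows "(\<integral>s. indicator {0..t} s *\<^sub>R (exp (- B * s) * P s (\<lambda>x. horizontal_laplacian mul e \<psi> x - B * \<psi> x) g) \<partial>lborel)
    = exp (- B * t) * P t \<psi> g - \<psi> g"
proof -
  let ?L = "horizontal_laplacian mul e \<psi>"
  let ?\<eta> = "\<lambda>x. ?L x - B * \<psi> x"
  have C0: "C0_fun \<psi>" "C0_fun ?L" "C0_fun ?\<eta>"
    by (intro test_fun_C0 \<psi> test_fun_horizontal_laplacian test_fun_diff)+
  have "(\<integral>s. indicator {0..t} s *\<^sub>R (exp (- B * s) * P s ?\<eta> g) \<partial>lborel) = exp (- B * t) * P t \<psi> g - exp (- B * 0) * P 0 \<psi> g"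
  proof (rule integral_FTC_atLeastAtMost[OF t])
    fix s assume s: "0 \<le> s" "s \<le> t"
    have "((\<lambda>s. P s \<psi> g) has_real_derivative P s ?L g) (at s within {0..t})"
      by (rule DERIV_subset[OF P_has_derivative[OF test_fun_generator[OF \<psi>] s(1)]]) auto
    then have "((\<lambda>s. exp (- B * s) * P s \<psi> g) has_real_derivative exp (- B * s) * (P s ?L g - B * P s \<psi> g)) (at s within {0..t})"
      by (auto intro!: derivative_eq_intros simp: algebra_simps)
    moreover have "P s ?\<eta> g = P s ?L g - B * P s \<psi> g"
      using P_lincomb[OF s(1) C0(2,1), of 1 "- B"] by simp
    ultimately show "((\<lambda>s. exp (- B * s) * P s \<psi> g) has_vector_derivative exp (- B * s) * P s ?\<eta> g) (at s within {0..t})"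
      by (simp add: has_real_derivative_iff_has_vector_derivative)
  next
    show "continuous_on {0..t} (\<lambda>s. exp (- B * s) * P s ?\<eta> g)"
      by (intro continuous_intros continuous_on_subset[OF P_continuous[OF C0(3)]]) auto
  qed
  then show ?thesis
    by (simp add: P_0 C0)
qed

text \<open>The function \<open>\<eta>\<close> pairs to zero with the character, and
  \<open>P_pairing\<close> keeps this so for every \<open>P s \<eta>\<close>, whatever the value of
  \<open>c s \<xi>\<close>. Integrating \<open>P_eigen_integral\<close> against the character
  therefore kills the time integral, and \<open>c\<close> is found without being
  differentiated.\<close>

lemma c_exponential:
  assumes B: "\<And>\<psi>. test_fun \<psi> \<Longrightarrow> K \<xi> (horizontal_laplacian mul e \<psi>) = of_real B * K \<xi> \<psi>" and t: "t > 0"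
  shows "c t \<xi> = exp (B * t)"
proof -
  obtain \<psi> where \<psi>: "test_fun \<psi>" "K \<xi> \<psi> \<noteq> 0"
    using exists_K_nonzero by blast
  let ?L = "horizontal_laplacian mul e \<psi>"
  define \<eta> where "\<eta> = (\<lambda>x. ?L x - B * \<psi> x)"
  have \<eta>: "test_fun \<eta>"
    unfolding \<eta>_def by (intro test_fun_diff test_fun_horizontal_laplacian \<psi>)
  have K\<eta>: "K \<xi> \<eta> = 0"
    using K_lincomb[of ?L \<psi> \<xi> 1 "- B"] test_fun_integrable[OF test_fun_horizontal_laplacian[OF \<psi>(1), of e]]
      test_fun_integrable[OF \<psi>(1)] B[OF \<psi>(1)] by (simp add: \<eta>_def scaleR_conv_of_real)
  have KP: "K \<xi> (P s \<eta>) = 0" if "s \<ge> 0" for s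
    using that P_pairing(3)[OF _ \<eta>, of s \<xi>] K\<eta> P_0[OF test_fun_C0[OF \<eta>]] by (cases "s = 0") auto
  have P_int: "integrable lborel (P s \<eta>)" if "s \<ge> 0" for s
    using that P_pairing(1)[OF _ \<eta>, of s] test_fun_integrable[OF \<eta>] P_0[OF test_fun_C0[OF \<eta>]] by (cases "s = 0") auto
  have P_L1: "(\<integral>g. \<bar>P s \<eta> g\<bar> \<partial>lborel) \<le> (\<integral>g. \<bar>\<eta> g\<bar> \<partial>lborel)" if "s \<ge> 0" for s
    using that P_pairing(2)[OF _ \<eta>, of s] P_0[OF test_fun_C0[OF \<eta>]] by (cases "s = 0") auto
  \<comment> \<open>The indicator puts the time interval into the integrand, so that Fubini runs
    over the full product of Lebesgue measures.\<close>
  define w where "w s g = indicator {0..t} s *\<^sub>R (exp (- B * s) * P s \<eta> g)" for s g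
  have w_meas: "(\<lambda>x. w (fst x) (snd x)) \<in> borel_measurable (lborel \<Otimes>\<^sub>M lborel)"
  proof -
    have "(\<lambda>x. indicator ({0..t} \<times> UNIV) x *\<^sub>R (exp (- B * fst x) * P (fst x) \<eta> (snd x))) \<in> borel_measurable (borel :: (real \<times> 'a) measure)"
      by (intro borel_measurable_continuous_on_indicator continuous_intros
          continuous_on_subset[OF P_jointly_continuous[OF test_fun_C0[OF \<eta>]]] borel_closed closed_Times) auto
    moreover have "indicator ({0..t} \<times> UNIV) x = (indicator {0..t} (fst x) :: real)" for x :: "real \<times> 'a"
      by (cases x) (auto simp: indicator_def)
    ultimately show ?thesis
      by (simp add: lborel_prod w_def)
  qed
  have w_int: "integrable lborel (w s)" for s
    using P_int[of s] by (cases "s \<in> {0..t}") (simp_all add: w_def[abs_def])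
  have int: "integrable (lborel \<Otimes>\<^sub>M lborel) (\<lambda>(s, g). w s g *\<^sub>R ph \<xi> g)"
  proof (rule lborel_pair.Fubini_integrable)
    have ph_meas: "(\<lambda>x. ph \<xi> (snd x)) \<in> borel_measurable (lborel \<Otimes>\<^sub>M lborel)"
      by simp
    show "(\<lambda>(s, g). w s g *\<^sub>R ph \<xi> g) \<in> borel_measurable (lborel \<Otimes>\<^sub>M lborel)"
      unfolding case_prod_unfold by (intro borel_measurable_scaleR w_meas ph_meas)
    have "integrable lborel (\<lambda>s. \<integral>g. \<bar>w s g\<bar> \<partial>lborel)"
    proof (rule Bochner_Integration.integrable_bound)
      show "integrable lborel (\<lambda>s. indicator {0..t} s *\<^sub>R (exp (\<bar>B\<bar> * t) * (\<integral>g. \<bar>\<eta> g\<bar> \<partial>lborel)))"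
        using t by (intro borel_integrable_compact) auto
      show "(\<lambda>s. \<integral>g. \<bar>w s g\<bar> \<partial>lborel) \<in> borel_measurable lborel"
        using w_meas by (intro lborel.borel_measurable_lebesgue_integral) (simp add: case_prod_unfold)
      have "(\<integral>g. \<bar>w s g\<bar> \<partial>lborel) \<le> indicator {0..t} s *\<^sub>R (exp (\<bar>B\<bar> * t) * (\<integral>g. \<bar>\<eta> g\<bar> \<partial>lborel))" for s
      proof (cases "s \<in> {0..t}")
        case True
        have "- B * s \<le> \<bar>B\<bar> * t"
          using True by (intro mult_mono) auto
        moreover have "(\<integral>g. \<bar>w s g\<bar> \<partial>lborel) = exp (- B * s) * (\<integral>g. \<bar>P s \<eta> g\<bar> \<partial>lborel)"
          using True by (simp add: w_def abs_mult)
        ultimately show ?thesis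
          using True P_L1[of s] by (auto intro!: mult_mono integral_nonneg_AE)
      qed (simp add: w_def)
      then show "AE s in lborel. norm (\<integral>g. \<bar>w s g\<bar> \<partial>lborel) \<le> norm (indicator {0..t} s *\<^sub>R (exp (\<bar>B\<bar> * t) * (\<integral>g. \<bar>\<eta> g\<bar> \<partial>lborel)))"
        by (intro AE_I2) (simp add: abs_of_nonneg integral_nonneg_AE order_trans[OF _ abs_ge_self])
    qed
    then show "integrable lborel (\<lambda>x. \<integral>y. norm (case (x, y) of (s, g) \<Rightarrow> w s g *\<^sub>R ph \<xi> g) \<partial>lborel)"
      by simp
    show "AE x in lborel. integrable lborel (\<lambda>y. case (x, y) of (s, g) \<Rightarrow> w s g *\<^sub>R ph \<xi> g)"
      by (simp add: integrable_ph w_int)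
  qed
  have "exp (- B * t) *\<^sub>R K \<xi> (P t \<psi>) + (- 1) *\<^sub>R K \<xi> \<psi> = K \<xi> (\<lambda>g. exp (- B * t) * P t \<psi> g + (- 1) * \<psi> g)"
    by (intro K_lincomb[symmetric] P_pairing(1)[OF t \<psi>(1)] test_fun_integrable[OF \<psi>(1)])
  also have "\<dots> = K \<xi> (\<lambda>g. \<integral>s. w s g \<partial>lborel)"
    using P_eigen_integral[OF less_imp_le[OF t] \<psi>(1), of B] by (simp add: w_def \<eta>_def)
  also have "\<dots> = (\<integral>g. (\<integral>s. w s g *\<^sub>R ph \<xi> g \<partial>lborel) \<partial>lborel)"
    unfolding K_def
  proof (intro Bochner_Integration.integral_cong[OF refl] integral_scaleR_left[symmetric])
    fix g
    show "integrable lborel (\<lambda>s. w s g)"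
      unfolding w_def
      by (intro borel_integrable_compact continuous_intros continuous_on_subset[OF P_continuous[OF test_fun_C0[OF \<eta>]]]) auto
  qed
  also have "\<dots> = (\<integral>s. (\<integral>g. w s g *\<^sub>R ph \<xi> g \<partial>lborel) \<partial>lborel)"
    by (rule lborel_pair.Fubini_integral[OF int])
  also have "\<dots> = (\<integral>s. 0 \<partial>(lborel :: real measure))"
  proof (rule Bochner_Integration.integral_cong[OF refl])
    fix s
    have "(\<integral>g. w s g *\<^sub>R ph \<xi> g \<partial>lborel) = (indicator {0..t} s * exp (- B * s)) *\<^sub>R K \<xi> (P s \<eta>)"
      unfolding K_def integral_scaleR_right[symmetric] by (simp add: w_def mult.assoc)
    then show "(\<integral>g. w s g *\<^sub>R ph \<xi> g \<partial>lborel) = 0"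
      using KP[of s] by (cases "s \<in> {0..t}") auto
  qed
  finally have "exp (- B * t) *\<^sub>R (c t \<xi> * K \<xi> \<psi>) = K \<xi> \<psi>"
    by (simp add: P_pairing(3)[OF t \<psi>(1)])
  then have "(of_real (exp (- B * t)) * c t \<xi>) * K \<xi> \<psi> = 1 * K \<xi> \<psi>"
    by (simp add: scaleR_conv_of_real mult.assoc)
  then have 1: "of_real (exp (- B * t)) * c t \<xi> = 1"
    using mult_right_cancel[OF \<psi>(2)] by blast
  have "c t \<xi> = of_real (exp (B * t) * exp (- B * t)) * c t \<xi>"
    by (simp flip: exp_add)
  also have "\<dots> = of_real (exp (B * t)) * (of_real (exp (- B * t)) * c t \<xi>)"
    by (simp only: of_real_mult mult.assoc)
  finally show ?thesis
    by (simp only: 1 mult_1_right)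
qed

theorem c_eq:
  assumes t: "t > 0"
  shows "c t \<xi> = exp (- t * (norm \<xi>)\<^sup>2)"
proof -
  obtain a where a: "\<And>\<phi> \<xi>. test_fun \<phi> \<Longrightarrow>
    K \<xi> (horizontal_laplacian mul e \<phi>) = (\<Sum>i\<in>UNIV. (Complex (a i) (- (\<xi> $ i)))\<^sup>2) * K \<xi> \<phi>"
    by (rule K_horizontal_laplacian) blast
  have sq: "(Complex x 0)\<^sup>2 = of_real (x\<^sup>2)" "(Complex 0 x)\<^sup>2 = of_real (- x\<^sup>2)" for x
    by (simp_all add: power2_eq_square complex_eq_iff)
  \<comment> \<open>At frequency zero the candidate eigenvalue is real, as
    \<open>c_exponential\<close> requires; for other frequencies this is known only once every
    \<open>a i\<close> vanishes. A sum of real squares whose exponential is at most 1 must be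
    zero.\<close>
  have "c 1 0 = exp ((\<Sum>i\<in>UNIV. (a i)\<^sup>2) * 1)"
    by (rule c_exponential) (simp_all add: a sq)
  then have "exp (\<Sum>i\<in>UNIV. (a i)\<^sup>2) = mass 1"
    by (simp only: c_0 of_real_eq_iff mult_1_right)
  with mass_bounds(2)[of 1] have "exp (\<Sum>i\<in>UNIV. (a i)\<^sup>2) \<le> 1"
    by simp
  then have "(\<Sum>i\<in>UNIV. (a i)\<^sup>2) \<le> 0"
    by (simp only: exp_le_one_iff)
  then have a0: "a i = 0" for i
    by (metis (mono_tags) UNIV_I finite order_antisym power2_eq_iff_nonneg sum_nonneg sum_nonneg_eq_0_iff zero_eq_power2 zero_le_power2)
  have "c t \<xi> = exp (- (norm \<xi>)\<^sup>2 * t)"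
  proof (rule c_exponential[OF _ t])
    fix \<psi> :: "'a \<Rightarrow> real" assume "test_fun \<psi>"
    moreover have "(\<Sum>i\<in>UNIV. - (\<xi> $ i)\<^sup>2) = - (norm \<xi>)\<^sup>2"
      unfolding power2_norm_eq_inner inner_vec_def by (simp add: sum_negf power2_eq_square)
    then have "(\<Sum>i\<in>UNIV. complex_of_real (- (\<xi> $ i)\<^sup>2)) = of_real (- (norm \<xi>)\<^sup>2)"
      by (simp only: of_real_sum[symmetric])
    ultimately show "K \<xi> (horizontal_laplacian mul e \<psi>) = of_real (- (norm \<xi>)\<^sup>2) * K \<xi> \<psi>"
      by (simp add: a a0 sq del: of_real_minus of_real_power)
  qed
  then show ?thesis
    by (simp add: mult.commute)
qed

end

section \<open>Gaussian integrals and translation-invariant measures\<close>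

text \<open>A rescaling of the characteristic function of the standard normal distribution.\<close>

lemma gaussian_fourier_real:
  assumes s: "s > 0"
  shows "integrable lborel (\<lambda>x::real. exp (- s * x\<^sup>2) *\<^sub>R cis (x * y))"
    and "(\<integral>x. exp (- s * x\<^sup>2) *\<^sub>R cis (x * y) \<partial>lborel) = sqrt (pi / s) * exp (- (y\<^sup>2 / (4 * s)))"
proof -
  \<comment> \<open>Chosen so that half the square of \<open>k * x\<close> is \<open>s\<close> times
    the square of \<open>x\<close>.\<close>
  define k where "k = sqrt (2 * s)"
  have k: "k > 0" "k\<^sup>2 = 2 * s"
    using s by (auto simp: k_def)
  define F where "F x = std_normal_density x *\<^sub>R cis (y / k * x)" for x
  have F_k: "F (0 + k * x) = (1 / sqrt (2 * pi)) *\<^sub>R (exp (- s * x\<^sup>2) *\<^sub>R cis (x * y))" for x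
    using k by (simp add: F_def std_normal_density_def power_mult_distrib mult.commute)
  have "integrable lborel std_normal_density"
    by (rule integrable_normal_density) simp
  moreover have "F \<in> borel_measurable lborel"
    unfolding F_def cis_conv_exp by measurable
  ultimately have "integrable lborel F"
    by (rule Bochner_Integration.integrable_bound) (simp add: F_def)
  then have int: "integrable lborel (\<lambda>x. F (0 + k * x))"
    by (rule lborel_integrable_real_affine) (use k in simp)
  from integrable_scaleR_right[OF this, of "sqrt (2 * pi)"]
  show "integrable lborel (\<lambda>x. exp (- s * x\<^sup>2) *\<^sub>R cis (x * y))"
    unfolding F_k scaleR_scaleR by simp
  have "(\<integral>x. F x \<partial>lborel) = char std_normal_distribution (y / k)"
    unfolding char_def F_def by (subst integral_density) (auto simp: cis_conv_exp)
  also have "\<dots> = exp (- (y\<^sup>2 / (4 * s)))"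
    unfolding char_std_normal_distribution using k by (simp add: power_divide)
  finally have "of_real (exp (- (y\<^sup>2 / (4 * s)))) = \<bar>k\<bar> *\<^sub>R (\<integral>x. F (0 + k * x) \<partial>lborel)"
    using lborel_integral_real_affine[of k F 0] k by simp
  also have "\<dots> = (k / sqrt (2 * pi)) *\<^sub>R (\<integral>x. exp (- s * x\<^sup>2) *\<^sub>R cis (x * y) \<partial>lborel)"
    unfolding F_k integral_scaleR_right using k by simp
  finally have "(sqrt (2 * pi) / k) *\<^sub>R complex_of_real (exp (- (y\<^sup>2 / (4 * s)))) =
      (\<integral>x. exp (- s * x\<^sup>2) *\<^sub>R cis (x * y) \<partial>lborel)"
    using k by simp
  moreover have "sqrt (2 * pi) / k = sqrt (pi / s)"
    by (simp add: k_def real_sqrt_mult real_sqrt_divide)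
  ultimately show "(\<integral>x. exp (- s * x\<^sup>2) *\<^sub>R cis (x * y) \<partial>lborel) = sqrt (pi / s) * exp (- (y\<^sup>2 / (4 * s)))"
    by (simp add: scaleR_conv_of_real)
qed

lemma cis_sum: "finite I \<Longrightarrow> cis (\<Sum>i\<in>I. f i) = (\<Prod>i\<in>I. cis (f i))"
  by (induction I rule: finite_induct) (auto simp: cis_mult[symmetric])

lemma norm_power2_Basis: "(norm x)\<^sup>2 = (\<Sum>b\<in>Basis. (x \<bullet> b)\<^sup>2)" for x :: "'a::euclidean_space"
  unfolding power2_norm_eq_inner by (subst euclidean_inner) (simp add: power2_eq_square)

lemma gaussian_fourier:
  fixes z :: "'a::euclidean_space"
  assumes s: "s > 0"
  shows "integrable lborel (\<lambda>x. exp (- s * (norm x)\<^sup>2) *\<^sub>R cis (x \<bullet> z))"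
    and "(\<integral>x. exp (- s * (norm x)\<^sup>2) *\<^sub>R cis (x \<bullet> z) \<partial>lborel) =
      (pi / s) powr (real DIM('a) / 2) * exp (- ((norm z)\<^sup>2 / (4 * s)))"
proof -
  interpret product_sigma_finite "\<lambda>_::'a. lborel :: real measure" ..
  define F where "F = (\<lambda>x. exp (- s * (norm x)\<^sup>2) *\<^sub>R cis (x \<bullet> z))"
  define h where "h b y = exp (- s * y\<^sup>2) *\<^sub>R cis (y * (z \<bullet> b))" for b and y :: real
  have h: "integrable lborel (h b)"
    "(\<integral>y. h b y \<partial>lborel) = sqrt (pi / s) * exp (- ((z \<bullet> b)\<^sup>2 / (4 * s)))" for b
    unfolding h_def by (rule gaussian_fourier_real[OF s])+
  have F_prod: "F (\<Sum>b\<in>Basis. x b *\<^sub>R b) = (\<Prod>b\<in>Basis. h b (x b))" for x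
  proof -
    let ?x = "\<Sum>b\<in>Basis. x b *\<^sub>R b"
    have xb: "?x \<bullet> b = x b" if "b \<in> Basis" for b
      using that by simp
    have "?x \<bullet> z = (\<Sum>b\<in>Basis. x b * (z \<bullet> b))"
      by (subst euclidean_inner) (simp add: xb)
    moreover have "(norm ?x)\<^sup>2 = (\<Sum>b\<in>Basis. (x b)\<^sup>2)"
      by (simp add: norm_power2_Basis xb)
    ultimately have "F ?x = exp (\<Sum>b\<in>Basis. - s * (x b)\<^sup>2) *\<^sub>R cis (\<Sum>b\<in>Basis. x b * (z \<bullet> b))"
      by (simp add: F_def sum_distrib_left sum_negf)
    also have "\<dots> = (\<Prod>b\<in>Basis. h b (x b))"
      by (simp add: exp_sum cis_sum h_def scaleR_conv_of_real prod.distrib)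
    finally show ?thesis .
  qed
  have meas: "(\<lambda>f. \<Sum>b\<in>Basis. f b *\<^sub>R b) \<in> measurable (\<Pi>\<^sub>M b\<in>Basis. lborel) (borel :: 'a measure)"
    by measurable
  have F_meas: "F \<in> borel_measurable borel"
    unfolding F_def cis_conv_exp by (intro borel_measurable_continuous_onI continuous_intros)
  have "integrable (\<Pi>\<^sub>M b\<in>Basis. lborel) (\<lambda>x. \<Prod>b\<in>Basis. h b (x b))"
    by (rule product_integrable_prod) (auto intro: h)
  then show "integrable lborel F"
    by (subst lborel_eq, subst integrable_distr_eq[OF meas F_meas]) (simp add: F_prod)
  have "(\<integral>x. F x \<partial>lborel) = (\<integral>x. (\<Prod>b\<in>Basis. h b (x b)) \<partial>(\<Pi>\<^sub>M b\<in>Basis. lborel))"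
    by (subst lborel_eq, subst integral_distr[OF meas F_meas]) (simp add: F_prod)
  also have "\<dots> = (\<Prod>b\<in>(Basis::'a set). complex_of_real (sqrt (pi / s) * exp (- ((z \<bullet> b)\<^sup>2 / (4 * s)))))"
    by (subst product_integral_prod) (auto intro: h(1) simp: h(2))
  also have "\<dots> = of_real (sqrt (pi / s) ^ DIM('a) * exp (\<Sum>b\<in>Basis. - ((z \<bullet> b)\<^sup>2 / (4 * s))))"
    by (simp add: prod.distrib exp_sum)
  also have "(\<Sum>b\<in>Basis. - ((z \<bullet> b)\<^sup>2 / (4 * s))) = - ((norm z)\<^sup>2 / (4 * s))"
    by (simp add: norm_power2_Basis sum_negf sum_divide_distrib)
  also have "sqrt (pi / s) ^ DIM('a) = (pi / s) powr (real DIM('a) / 2)"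
    using s by (simp add: powr_half_sqrt[symmetric] powr_power mult.commute)
  finally show "(\<integral>x. F x \<partial>lborel) = (pi / s) powr (real DIM('a) / 2) * exp (- ((norm z)\<^sup>2 / (4 * s)))"
    by simp
qed

lemma nn_integral_exp_norm:
  "(\<integral>\<^sup>+x. ennreal (exp (- (norm x)\<^sup>2)) \<partial>(lborel :: 'b::euclidean_space measure)) = ennreal (sqrt pi) ^ DIM('b)"
proof -
  have int: "integrable lborel (\<lambda>x::real. exp (- x\<^sup>2))"
    using integrable_Re[OF gaussian_fourier_real(1)[of 1 0]] by simp
  have "(\<integral>x. exp (- x\<^sup>2) \<partial>(lborel :: real measure)) = sqrt pi"
    using integral_Re[OF gaussian_fourier_real(1)[of 1 0]] gaussian_fourier_real(2)[of 1 0] by simp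
  with int have real: "(\<integral>\<^sup>+x. ennreal (exp (- x\<^sup>2)) \<partial>(lborel :: real measure)) = ennreal (sqrt pi)"
    by (simp add: nn_integral_eq_integral)
  have "(\<integral>\<^sup>+x. ennreal (exp (- (norm x)\<^sup>2)) \<partial>(lborel :: 'b measure)) =
      (\<integral>\<^sup>+x. (\<Prod>b\<in>(Basis :: 'b set). ennreal (exp (- (x \<bullet> b)\<^sup>2))) \<partial>lborel)"
    by (simp add: norm_power2_Basis sum_negf[symmetric] exp_sum prod_ennreal del: sum_negf)
  also have "\<dots> = (\<Prod>b\<in>(Basis :: 'b set). ennreal (sqrt pi))"
    unfolding real[symmetric] by (rule nn_integral_lborel_prod) auto
  finally show ?thesis
    by simp
qed

section \<open>Uniqueness of translation-invariant measures\<close>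

lemma nn_integral_lborel_translate:
  fixes a :: "'a::euclidean_space"
  assumes "F \<in> borel_measurable borel"
  shows "(\<integral>\<^sup>+x. F (a + x) \<partial>lborel) = (\<integral>\<^sup>+x. F x \<partial>lborel)"
  by (subst (2) lborel_distr_plus[of a, symmetric]) (simp add: nn_integral_distr assms)

lemma nn_integral_PiM_translate:
  fixes a :: "'i \<Rightarrow> real"
  assumes I: "finite I" and F: "F \<in> borel_measurable (\<Pi>\<^sub>M i\<in>I. lborel)"
  shows "(\<integral>\<^sup>+x. F (\<lambda>i\<in>I. a i + x i) \<partial>(\<Pi>\<^sub>M i\<in>I. lborel)) = (\<integral>\<^sup>+x. F x \<partial>(\<Pi>\<^sub>M i\<in>I. lborel))"
proof -
  interpret product_sigma_finite "\<lambda>_::'i. lborel :: real measure" ..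
  let ?M = "\<Pi>\<^sub>M i\<in>I. lborel :: real measure" and ?T = "\<lambda>x. \<lambda>i\<in>I. a i + x i"
  have T: "?T \<in> measurable ?M ?M"
    by measurable
  have "distr ?M ?M ?T = ?M"
  proof (rule PiM_eqI[OF I])
    fix A :: "'i \<Rightarrow> real set" assume A: "\<And>i. i \<in> I \<Longrightarrow> A i \<in> sets lborel"
    have vim: "(+) (a i) -` A i \<in> sets lborel" "emeasure lborel ((+) (a i) -` A i) = emeasure lborel (A i)" if "i \<in> I" for i
    proof -
      show "(+) (a i) -` A i \<in> sets lborel"
        using measurable_sets_borel[of "(+) (a i)" borel "A i"] A[OF that] by simp
      have "emeasure (distr lborel borel ((+) (a i))) (A i) = emeasure lborel ((+) (a i) -` A i)"
        using A[OF that] by (subst emeasure_distr) auto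
      then show "emeasure lborel ((+) (a i) -` A i) = emeasure lborel (A i)"
        by (simp add: lborel_distr_plus)
    qed
    have "?T -` (Pi\<^sub>E I A) \<inter> space ?M = Pi\<^sub>E I (\<lambda>i. (+) (a i) -` A i)"
      by (auto simp: space_PiM PiE_iff)
    then have "emeasure (distr ?M ?M ?T) (Pi\<^sub>E I A) = emeasure ?M (Pi\<^sub>E I (\<lambda>i. (+) (a i) -` A i))"
      using A I by (subst emeasure_distr[OF T]) (auto intro!: sets_PiM_I_finite)
    also have "\<dots> = (\<Prod>i\<in>I. emeasure lborel ((+) (a i) -` A i))"
      using I vim by (intro emeasure_PiM) auto
    also have "\<dots> = (\<Prod>i\<in>I. emeasure lborel (A i))"
      using vim by (intro prod.cong) auto
    finally show "emeasure (distr ?M ?M ?T) (Pi\<^sub>E I A) = (\<Prod>i\<in>I. emeasure lborel (A i))" .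
  qed simp
  then have "(\<integral>\<^sup>+x. F x \<partial>?M) = (\<integral>\<^sup>+x. F x \<partial>distr ?M ?M ?T)"
    by simp
  also have "\<dots> = (\<integral>\<^sup>+x. F (?T x) \<partial>?M)"
    by (rule nn_integral_distr[OF T]) (simp add: F)
  finally show ?thesis ..
qed

text \<open>Both sides of Fubini for \<open>F x * w (y - x)\<close>, using translation invariance in either variable.\<close>

lemma translation_invariant_eq_lborel:
  fixes M :: "'a::euclidean_space measure" and w :: "'a \<Rightarrow> ennreal"
  assumes "sigma_finite_measure M" and sets: "sets M = sets borel"
    and inv: "\<And>F a. F \<in> borel_measurable borel \<Longrightarrow> (\<integral>\<^sup>+x. F (a + x) \<partial>M) = (\<integral>\<^sup>+x. F x \<partial>M)"
    and w: "w \<in> borel_measurable borel" "\<And>x. w (- x) = w x"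
    and C: "(\<integral>\<^sup>+x. w x \<partial>M) = C" "(\<integral>\<^sup>+x. w x \<partial>lborel) = C" "C \<noteq> 0" "C \<noteq> \<infinity>"
    and F: "F \<in> borel_measurable borel"
  shows "(\<integral>\<^sup>+x. F x \<partial>M) = (\<integral>\<^sup>+x. F x \<partial>lborel)"
proof -
  interpret M: sigma_finite_measure M by fact
  interpret pair_sigma_finite M lborel ..
  have [measurable]: "w \<in> borel_measurable borel" "F \<in> borel_measurable borel" "F \<in> borel_measurable M" "w \<in> borel_measurable M"
    using w(1) F measurable_cong_sets[OF sets refl, of borel] by auto
  have "(\<integral>\<^sup>+y. F x * w (- x + y) \<partial>lborel) = F x * C" for x
    by (subst nn_integral_cmult, measurable) (simp only: nn_integral_lborel_translate[OF w(1)] C(2))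
  then have "C * (\<integral>\<^sup>+x. F x \<partial>M) = (\<integral>\<^sup>+x. (\<integral>\<^sup>+y. F x * w (- x + y) \<partial>lborel) \<partial>M)"
    by (simp only: mult.commute[of C] nn_integral_multc \<open>F \<in> borel_measurable M\<close>)
  also have "\<dots> = (\<integral>\<^sup>+y. (\<integral>\<^sup>+x. F x * w (- x + y) \<partial>M) \<partial>lborel)"
  proof (rule Fubini'[symmetric])
    have "(\<lambda>(x, y). F x * w (- x + y)) \<in> borel_measurable (borel \<Otimes>\<^sub>M borel)"
      by measurable
    moreover have "sets (M \<Otimes>\<^sub>M lborel) = sets (borel \<Otimes>\<^sub>M borel :: ('a \<times> 'a) measure)"
      by (rule sets_pair_measure_cong[OF sets]) simp
    ultimately show "(\<lambda>(x, y). F x * w (- x + y)) \<in> borel_measurable (M \<Otimes>\<^sub>M lborel)"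
      using measurable_cong_sets by blast
  qed
  also have "\<dots> = (\<integral>\<^sup>+y. (\<integral>\<^sup>+x. F (y + x) * w x \<partial>M) \<partial>lborel)"
  proof (rule nn_integral_cong)
    fix y
    have "(\<lambda>x. F x * w (- x + y)) \<in> borel_measurable borel"
      by measurable
    from inv[OF this, of y] show "(\<integral>\<^sup>+x. F x * w (- x + y) \<partial>M) = (\<integral>\<^sup>+x. F (y + x) * w x \<partial>M)"
      by (simp add: w(2))
  qed
  also have "\<dots> = (\<integral>\<^sup>+x. (\<integral>\<^sup>+y. F (y + x) * w x \<partial>lborel) \<partial>M)"
  proof (rule Fubini')
    have "(\<lambda>(x, y). F (y + x) * w x) \<in> borel_measurable (borel \<Otimes>\<^sub>M borel)"
      by measurable
    moreover have "sets (M \<Otimes>\<^sub>M lborel) = sets (borel \<Otimes>\<^sub>M borel :: ('a \<times> 'a) measure)"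
      by (rule sets_pair_measure_cong[OF sets]) simp
    ultimately show "(\<lambda>(x, y). F (y + x) * w x) \<in> borel_measurable (M \<Otimes>\<^sub>M lborel)"
      using measurable_cong_sets by blast
  qed
  also have "\<dots> = C * (\<integral>\<^sup>+y. F y \<partial>lborel)"
  proof -
    have "(\<integral>\<^sup>+y. F (y + x) * w x \<partial>lborel) = (\<integral>\<^sup>+y. F y \<partial>lborel) * w x" for x
      by (subst nn_integral_multc, measurable) (simp only: add.commute[of _ x] nn_integral_lborel_translate[OF F])
    then show ?thesis
      by (simp only: nn_integral_cmult \<open>w \<in> borel_measurable M\<close> C(1) mult.commute[of C])
  qed
  finally show ?thesis
    using C(3,4) by (simp add: ennreal_mult_cancel_left)
qed

text \<open>For densities with values in \<open>ennreal\<close> only nonnegative integrands are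
  convenient. Functions vanishing at infinity are bounded, so both parts of \<open>u\<close> are
  integrable and may be treated separately.\<close>

lemma measure_eqI_C0_nn:
  fixes M N :: "'a::euclidean_space measure"
  assumes fin: "finite_measure M" "finite_measure N" and sets: "sets M = sets borel" "sets N = sets borel"
    and eq: "\<And>u. C0_fun u \<Longrightarrow> (\<And>x. u x \<ge> 0) \<Longrightarrow> (\<integral>\<^sup>+x. ennreal (u x) \<partial>M) = (\<integral>\<^sup>+x. ennreal (u x) \<partial>N)"
  shows "M = N"
proof (rule measure_eqI_C0[OF fin sets])
  fix u :: "'a \<Rightarrow> real" assume u: "C0_fun u"
  define up um where "up = (\<lambda>x. max (u x) 0)" and "um = (\<lambda>x. max (- u x) 0)"
  have C0: "C0_fun up" "C0_fun um"
    using u tendsto_max[of u 0 at_infinity "\<lambda>_. 0" 0] tendsto_max[of "\<lambda>x. - u x" 0 at_infinity "\<lambda>_. 0" 0] tendsto_minus[of u 0 at_infinity]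
    by (auto simp: C0_fun_def up_def um_def intro!: continuous_intros)
  obtain B where B: "\<And>x. \<bar>u x\<bar> \<le> B"
  proof -
    have cont: "continuous_on UNIV u" and lim: "(u \<longlongrightarrow> 0) at_infinity"
      using u by (auto simp: C0_fun_def)
    from lim have "\<forall>\<^sub>F x in at_infinity. dist (u x) 0 < 1"
      by (rule tendstoD) simp
    then obtain R where R: "\<And>x. norm x \<ge> R \<Longrightarrow> \<bar>u x\<bar> < 1"
      unfolding eventually_at_infinity by auto
    have "compact (u ` cball 0 R)"
      by (intro compact_continuous_image continuous_on_subset[OF cont]) auto
    from compact_imp_bounded[OF this] obtain B where "\<forall>y\<in>u ` cball 0 R. norm y \<le> B"
      unfolding bounded_iff ..
    then have "\<bar>u x\<bar> \<le> max B 1" for x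
      using R[of x] by (cases "norm x \<le> R") (auto simp: le_max_iff_disj intro: less_imp_le)
    then show ?thesis
      by (rule that)
  qed
  have *: "(\<integral>x. u x \<partial>L) = enn2real (\<integral>\<^sup>+x. ennreal (up x) \<partial>L) - enn2real (\<integral>\<^sup>+x. ennreal (um x) \<partial>L)"
    if L: "finite_measure L" "sets L = sets borel" for L
  proof -
    have int: "integrable L v" if "C0_fun v" "\<And>x. \<bar>v x\<bar> \<le> B" for v
    proof (rule finite_measure.integrable_const_bound[OF L(1)])
      show "v \<in> borel_measurable L"
        using that(1) unfolding measurable_cong_sets[OF L(2) refl, of borel] C0_fun_def
        by (intro borel_measurable_continuous_onI) simp
    qed (use that in auto)
    have B0: "B \<ge> 0"
      using B[of 0] by linarith
    have "\<bar>up x\<bar> \<le> B" "\<bar>um x\<bar> \<le> B" for x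
      using B[of x] B0 by (auto simp: up_def um_def)
    then have "integrable L up" "integrable L um"
      by (auto intro: int[OF C0(1)] int[OF C0(2)])
    moreover have "u = (\<lambda>x. up x - um x)"
      by (auto simp: up_def um_def fun_eq_iff)
    ultimately have "(\<integral>x. u x \<partial>L) = (\<integral>x. up x \<partial>L) - (\<integral>x. um x \<partial>L)"
      by (metis Bochner_Integration.integral_diff)
    also have "(\<integral>x. up x \<partial>L) = enn2real (\<integral>\<^sup>+x. ennreal (up x) \<partial>L)"
      using \<open>integrable L up\<close> by (intro integral_eq_nn_integral) (auto simp: up_def)
    also have "(\<integral>x. um x \<partial>L) = enn2real (\<integral>\<^sup>+x. ennreal (um x) \<partial>L)"
      using \<open>integrable L um\<close> by (intro integral_eq_nn_integral) (auto simp: um_def)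
    finally show ?thesis .
  qed
  show "(\<integral>x. u x \<partial>M) = (\<integral>x. u x \<partial>N)"
    unfolding *[OF fin(1) sets(1)] *[OF fin(2) sets(2)]
    using eq[OF C0(1)] eq[OF C0(2)] by (simp add: up_def um_def)
qed

section \<open>Logarithmic coordinates as a product\<close>

text \<open>The heat kernel of Euclidean space, with Fourier transform
  \<open>exp (- s * (norm x)\<^sup>2)\<close>; \<open>gauss_fourier\<close> is the inversion
  formula.\<close>

definition gauss :: "real \<Rightarrow> real^'m::finite \<Rightarrow> real" where
  "gauss s z = (4 * pi * s) powr (- (real CARD('m) / 2)) * exp (- ((norm z)\<^sup>2 / (4 * s)))"

lemma gauss_pos: "s > 0 \<Longrightarrow> gauss s z > 0"
  by (simp add: gauss_def)

lemma gauss_uminus [simp]: "gauss s (- z) = gauss s z"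
  by (simp add: gauss_def)

lemma gauss_measurable [measurable]: "gauss s \<in> borel_measurable borel"
  unfolding gauss_def[abs_def] by measurable

lemma gauss_fourier:
  fixes z :: "real^'m::finite"
  assumes s: "s > 0"
  shows "(\<integral>x. exp (- s * (norm x)\<^sup>2) *\<^sub>R cis (x \<bullet> z) \<partial>lborel) = (2 * pi) ^ CARD('m) * gauss s z"
proof -
  have "(2 * pi) ^ CARD('m) * (4 * pi * s) powr (- (real CARD('m) / 2)) = (pi / s) powr (real CARD('m) / 2)"
  proof -
    have "(2 * pi) ^ CARD('m) = (4 * pi * pi) powr (real CARD('m) / 2)"
    proof -
      have "(4 * pi * pi) powr (real CARD('m) / 2) = ((2 * pi) powr 2) powr (real CARD('m) / 2)"
        by (simp add: power2_eq_square mult.assoc)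
      then show ?thesis
        by (simp only: powr_powr) (simp add: powr_realpow)
    qed
    moreover have "(4 * pi * s) powr (- (real CARD('m) / 2)) = (1 / (4 * pi * s)) powr (real CARD('m) / 2)"
      using s by (simp add: powr_minus powr_divide inverse_eq_divide)
    moreover have "(4 * pi * pi) * (1 / (4 * pi * s)) = pi / s"
      using s by simp
    ultimately show ?thesis
      using s by (simp only: powr_mult[symmetric])
  qed
  then show ?thesis
    unfolding gaussian_fourier(2)[OF s] gauss_def by (simp flip: of_real_mult of_real_power)
qed

lemma nn_integral_gauss:
  assumes s: "s > 0"
  shows "(\<integral>\<^sup>+z. ennreal (gauss s z) \<partial>(lborel :: (real^'m::finite) measure)) = 1"
proof -
  define \<tau> where "\<tau> = 1 / (4 * s)"
  have \<tau>: "\<tau> > 0"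
    using s by (simp add: \<tau>_def)
  let ?k = "(4 * pi * s) powr (- (real CARD('m) / 2))"
  have g: "gauss s z = ?k * exp (- \<tau> * (norm z)\<^sup>2)" for z :: "real^'m"
    by (simp add: gauss_def \<tau>_def)
  have int: "integrable lborel (\<lambda>z::real^'m. exp (- \<tau> * (norm z)\<^sup>2))"
    using integrable_Re[OF gaussian_fourier(1)[OF \<tau>, of "0::real^'m"]] by simp
  have "(\<integral>z. exp (- \<tau> * (norm z)\<^sup>2) \<partial>(lborel :: (real^'m) measure)) =
      Re (\<integral>x. exp (- \<tau> * (norm x)\<^sup>2) *\<^sub>R cis (x \<bullet> (0::real^'m)) \<partial>lborel)"
    by (subst integral_Re[symmetric, OF gaussian_fourier(1)[OF \<tau>]]) simp
  also have "\<dots> = (4 * pi * s) powr (real CARD('m) / 2)"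
    unfolding gaussian_fourier(2)[OF \<tau>] by (simp add: \<tau>_def mult_ac)
  finally have "(\<integral>z. gauss s z \<partial>(lborel :: (real^'m) measure)) = ?k * (4 * pi * s) powr (real CARD('m) / 2)"
    unfolding g by simp
  also have "\<dots> = 1"
    using s by (simp flip: powr_add)
  finally have "(\<integral>z. gauss s z \<partial>(lborel :: (real^'m) measure)) = 1" .
  moreover have "integrable lborel (gauss s :: real^'m \<Rightarrow> real)"
    unfolding g[abs_def] using int by simp
  ultimately show ?thesis
    by (subst nn_integral_eq_integral) (simp_all add: less_imp_le[OF gauss_pos[OF s]])
qed

section \<open>Lebesgue measure in logarithmic coordinates and the Gaussian averages of the
  kernel\<close>

context carnot_heat
begin

abbreviation lp :: "real^'m \<Rightarrow> (nat \<Rightarrow> real) \<Rightarrow> 'a" where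
  "lp \<equiv> log_point e f"

sublocale \<sigma>: product_sigma_finite "\<lambda>_::nat. lborel :: real measure" ..

lemma sigma_finite_fibre: "sigma_finite_measure (Pi\<^sub>M {..<DIM('a) - CARD('m)} (\<lambda>_. lborel :: real measure))"
  by (rule \<sigma>.sigma_finite) simp

lemma f_orthonormal: "k < (DIM('a) - CARD('m)) \<Longrightarrow> l < (DIM('a) - CARD('m)) \<Longrightarrow> f k \<bullet> f l = (if k = l then 1 else 0)"
  using adapted by (simp add: adapted_basis_def)

lemma f_e_orthogonal:
  assumes "k < (DIM('a) - CARD('m))"
  shows "f k \<bullet> e i = 0"
proof -
  obtain j where "j \<in> {2..r}" "f k \<in> V j"
    using adapted assms by (auto simp: adapted_basis_def)
  moreover have "\<forall>i\<in>{1..r}. \<forall>j\<in>{1..r}. i \<noteq> j \<longrightarrow> (\<forall>x\<in>V i. \<forall>y\<in>V j. x \<bullet> y = 0)"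
    using carnot_group unfolding carnot_group_def by blast
  then have "j \<in> {1..r} \<Longrightarrow> 1 \<in> {1..r} \<Longrightarrow> j \<noteq> 1 \<Longrightarrow> x \<in> V j \<Longrightarrow> y \<in> V 1 \<Longrightarrow> x \<bullet> y = 0" for x y
    by blast
  ultimately show ?thesis
    using e_first_layer[of i] by simp
qed

lemma inner_lp_e: "lp z \<sigma> \<bullet> e i = z $ i"
  by (simp add: log_point_def inner_add_left inner_sum_left e_orthonormal f_e_orthogonal if_distrib cong: if_cong)

lemma inner_lp_f: "k < (DIM('a) - CARD('m)) \<Longrightarrow> lp z \<sigma> \<bullet> f k = \<sigma> k"
  by (simp add: log_point_def inner_add_left inner_sum_left f_orthonormal f_e_orthogonal inner_commute[of "e _"] if_distrib cong: if_cong)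

lemma pr_lp [simp]: "pr (lp z \<sigma>) = z"
  by (simp add: pr_def inner_lp_e vec_eq_iff)

lemma lp_add: "lp (z + z') (\<lambda>k. \<sigma> k + \<sigma>' k) = lp z \<sigma> + lp z' \<sigma>'"
  by (simp add: log_point_def scaleR_add_left sum.distrib)

lemma lp_restrict: "lp z (\<lambda>k\<in>{..<DIM('a) - CARD('m)}. \<sigma> k) = lp z \<sigma>"
  by (simp add: log_point_def)

text \<open>Both basis families together are orthonormal, hence independent. The first claim makes
  the truncated subtraction a genuine one; then the family has \<open>DIM('a)\<close> members and
  spans.\<close>

lemma card_le_dim: "CARD('m) \<le> DIM('a)" and lp_surj: "\<exists>z \<sigma>. x = lp z \<sigma>"
proof -
  have e_inj: "inj e"
    by (rule injI) (metis e_orthonormal zero_neq_one)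
  have f_inj: "inj_on f {..<DIM('a) - CARD('m)}"
    by (rule inj_onI) (metis f_orthonormal lessThan_iff zero_neq_one)
  let ?B = "range e \<union> f ` {..<DIM('a) - CARD('m)}"
  have orth: "pairwise orthogonal ?B"
    unfolding pairwise_def orthogonal_def
    using e_orthonormal f_orthonormal f_e_orthogonal by (auto simp: inner_commute[of "e _" "f _"])
  have nz: "0 \<notin> ?B"
    using e_orthonormal f_orthonormal by (metis (no_types, lifting) UnE imageE inner_zero_left lessThan_iff zero_neq_one)
  have ind: "independent ?B"
    by (rule pairwise_orthogonal_independent[OF orth nz])
  show le: "CARD('m) \<le> DIM('a)"
    using independent_card_le[of "range e"] independent_mono[OF ind, of "range e"] card_image[OF e_inj] by simp
  have disj: "range e \<inter> f ` {..<DIM('a) - CARD('m)} = {}"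
    using f_e_orthogonal e_orthonormal by (auto simp: image_iff) (metis zero_neq_one)
  have "card ?B = DIM('a)"
    using le card_image[OF e_inj] card_image[OF f_inj] by (subst card_Un_disjoint[OF _ _ disj]) auto
  then have span: "span ?B = UNIV"
    using card_ge_dim_independent[of ?B UNIV] ind by (auto simp: dim_UNIV)
  define y where "y = x - lp (pr x) (\<lambda>k. x \<bullet> f k)"
  have "y \<bullet> b = 0" if "b \<in> ?B" for b
    using that by (auto simp: y_def inner_diff_left inner_lp_e inner_lp_f pr_def)
  then have "y \<bullet> y = 0"
    using orthogonal_to_span[of y ?B y] span by (auto simp: orthogonal_def)
  then have "x = lp (pr x) (\<lambda>k. x \<bullet> f k)"
    by (simp add: y_def)
  then show "\<exists>z \<sigma>. x = lp z \<sigma>"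
    by blast
qed

lemma norm_lp: "(norm (lp z \<sigma>))\<^sup>2 = (norm z)\<^sup>2 + (\<Sum>k<(DIM('a) - CARD('m)). (\<sigma> k)\<^sup>2)"
proof -
  have "lp z \<sigma> \<bullet> lp z \<sigma> = (\<Sum>i\<in>UNIV. z $ i * (lp z \<sigma> \<bullet> e i)) + (\<Sum>k<(DIM('a) - CARD('m)). \<sigma> k * (lp z \<sigma> \<bullet> f k))"
    by (subst (2) log_point_def) (simp add: inner_add_right inner_sum_right)
  also have "\<dots> = z \<bullet> z + (\<Sum>k<(DIM('a) - CARD('m)). (\<sigma> k)\<^sup>2)"
    by (simp add: inner_lp_e inner_lp_f inner_vec_def power2_eq_square)
  finally show ?thesis
    by (simp add: power2_norm_eq_inner)
qed

lemma lp_measurable_pair [measurable]: "(\<lambda>x. lp (fst x) (snd x)) \<in> borel_measurable (borel \<Otimes>\<^sub>M (Pi\<^sub>M {..<DIM('a) - CARD('m)} (\<lambda>_. lborel)))"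
proof -
  have [measurable]: "(\<lambda>z::real^'m. z $ i) \<in> borel_measurable borel" for i
    by (intro borel_measurable_continuous_onI continuous_intros)
  have [measurable]: "(\<lambda>x. snd x k) \<in> borel_measurable ((borel :: (real^'m) measure) \<Otimes>\<^sub>M (Pi\<^sub>M {..<DIM('a) - CARD('m)} (\<lambda>_. lborel)))" if "k \<in> {..<DIM('a) - CARD('m)}" for k
    using that by measurable
  show ?thesis
    unfolding log_point_def by measurable
qed

lemma lp_measurable [measurable]: "lp z \<in> borel_measurable (Pi\<^sub>M {..<DIM('a) - CARD('m)} (\<lambda>_. lborel))"
  using measurable_compose[OF measurable_Pair1' lp_measurable_pair, of z] by simp

text \<open>The image of the product measure under \<open>lp\<close> is translation invariant, since
  \<open>lp\<close> is additive and onto. It agrees with Lebesgue measure on one Gaussian weight,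
  and that fixes the normalisation.\<close>

lemma nn_integral_coordinates:
  assumes F: "F \<in> borel_measurable borel"
  shows "(\<integral>\<^sup>+x. F x \<partial>lborel) = (\<integral>\<^sup>+z. (\<integral>\<^sup>+\<sigma>. F (lp z \<sigma>) \<partial>(Pi\<^sub>M {..<DIM('a) - CARD('m)} (\<lambda>_. lborel))) \<partial>lborel)"
proof -
  interpret S: sigma_finite_measure "Pi\<^sub>M {..<DIM('a) - CARD('m)} (\<lambda>_. lborel :: real measure)"
    by (rule sigma_finite_fibre)
  define M where "M = distr (lborel \<Otimes>\<^sub>M (Pi\<^sub>M {..<DIM('a) - CARD('m)} (\<lambda>_. lborel))) borel (\<lambda>x. lp (fst x) (snd x))"
  have lp_meas: "(\<lambda>x. lp (fst x) (snd x)) \<in> borel_measurable (lborel \<Otimes>\<^sub>M (Pi\<^sub>M {..<DIM('a) - CARD('m)} (\<lambda>_. lborel)))"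
    using lp_measurable_pair by (simp cong: measurable_cong_sets)
  have M_int: "(\<integral>\<^sup>+x. F x \<partial>M) = (\<integral>\<^sup>+z. (\<integral>\<^sup>+\<sigma>. F (lp z \<sigma>) \<partial>(Pi\<^sub>M {..<DIM('a) - CARD('m)} (\<lambda>_. lborel))) \<partial>lborel)" if F: "F \<in> borel_measurable borel" for F
  proof -
    have "(\<integral>\<^sup>+x. F x \<partial>M) = (\<integral>\<^sup>+x. F (lp (fst x) (snd x)) \<partial>(lborel \<Otimes>\<^sub>M (Pi\<^sub>M {..<DIM('a) - CARD('m)} (\<lambda>_. lborel))))"
      unfolding M_def by (rule nn_integral_distr[OF lp_meas]) (simp add: F)
    also have "\<dots> = (\<integral>\<^sup>+z. (\<integral>\<^sup>+\<sigma>. F (lp z \<sigma>) \<partial>(Pi\<^sub>M {..<DIM('a) - CARD('m)} (\<lambda>_. lborel))) \<partial>lborel)"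
      by (subst S.nn_integral_fst[symmetric]) (use measurable_compose[OF lp_meas F] in simp_all)
    finally show ?thesis .
  qed
  define w where "w x = ennreal (exp (- (norm x)\<^sup>2))" for x :: 'a
  have w_meas: "w \<in> borel_measurable borel"
    unfolding w_def by measurable
  have w_M: "(\<integral>\<^sup>+x. w x \<partial>M) = ennreal (sqrt pi) ^ DIM('a)"
  proof -
    have "(\<integral>\<^sup>+\<sigma>. w (lp z \<sigma>) \<partial>(Pi\<^sub>M {..<DIM('a) - CARD('m)} (\<lambda>_. lborel))) = ennreal (exp (- (norm z)\<^sup>2)) * ennreal (sqrt pi) ^ (DIM('a) - CARD('m))" for z
    proof -
      have "w (lp z \<sigma>) = ennreal (exp (- (norm z)\<^sup>2)) * (\<Prod>k<(DIM('a) - CARD('m)). ennreal (exp (- (\<sigma> k)\<^sup>2)))" for \<sigma>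
      proof -
        have "exp (- (norm (lp z \<sigma>))\<^sup>2) = exp (- (norm z)\<^sup>2) * (\<Prod>k<DIM('a) - CARD('m). exp (- (\<sigma> k)\<^sup>2))"
          by (simp add: norm_lp sum_negf flip: exp_add exp_sum)
        then show ?thesis
          by (simp only: w_def ennreal_mult exp_ge_zero prod_nonneg prod_ennreal)
      qed
      then have "(\<integral>\<^sup>+\<sigma>. w (lp z \<sigma>) \<partial>(Pi\<^sub>M {..<DIM('a) - CARD('m)} (\<lambda>_. lborel))) = ennreal (exp (- (norm z)\<^sup>2)) * (\<integral>\<^sup>+\<sigma>. (\<Prod>k<(DIM('a) - CARD('m)). ennreal (exp (- (\<sigma> k)\<^sup>2))) \<partial>(Pi\<^sub>M {..<DIM('a) - CARD('m)} (\<lambda>_. lborel)))"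
        by (simp add: nn_integral_cmult)
      also have "(\<integral>\<^sup>+\<sigma>. (\<Prod>k<(DIM('a) - CARD('m)). ennreal (exp (- (\<sigma> k)\<^sup>2))) \<partial>(Pi\<^sub>M {..<DIM('a) - CARD('m)} (\<lambda>_. lborel))) = (\<Prod>k<(DIM('a) - CARD('m)). ennreal (sqrt pi))"
        using nn_integral_exp_norm[where 'b=real] by (subst \<sigma>.product_nn_integral_prod) simp_all
      finally show ?thesis
        by simp
    qed
    then have "(\<integral>\<^sup>+x. w x \<partial>M) = ennreal (sqrt pi) ^ CARD('m) * ennreal (sqrt pi) ^ (DIM('a) - CARD('m))"
      by (simp add: M_int[OF w_meas] nn_integral_multc nn_integral_exp_norm)
    then show ?thesis
      using card_le_dim by (simp flip: power_add)
  qed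
  have sets_M: "sets M = sets borel" and space_M: "space M = UNIV"
    by (simp_all add: M_def)
  \<comment> \<open>On the ball of radius \<open>n\<close> the weight \<open>w\<close> is bounded
    below by a positive constant, so its finite integral bounds the measure of the ball.\<close>
  have "sigma_finite_measure M"
  proof
    show "\<exists>A. countable A \<and> A \<subseteq> sets M \<and> \<Union> A = space M \<and> (\<forall>a\<in>A. emeasure M a \<noteq> \<infinity>)"
    proof (intro exI[of _ "range (\<lambda>n. cball 0 (real n))"] conjI ballI)
      show "\<Union> (range (\<lambda>n. cball 0 (real n))) = space M"
        by (auto simp: space_M intro: real_arch_simple)
      fix a assume "a \<in> range (\<lambda>n. cball (0::'a) (real n))"
      then obtain n where a: "a = cball 0 (real n)" by blast
      have "emeasure M a = (\<integral>\<^sup>+x. indicator a x \<partial>M)"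
        by (simp add: sets_M a)
      also have "\<dots> \<le> (\<integral>\<^sup>+x. ennreal (exp ((real n)\<^sup>2)) * w x \<partial>M)"
      proof (rule nn_integral_mono)
        fix x
        show "indicator a x \<le> ennreal (exp ((real n)\<^sup>2)) * w x"
        proof (cases "x \<in> a")
          case True
          then have "(norm x)\<^sup>2 \<le> (real n)\<^sup>2"
            by (simp add: a)
          then have "1 \<le> exp ((real n)\<^sup>2) * exp (- (norm x)\<^sup>2)"
            by (simp flip: exp_add)
          then show ?thesis
            using True by (simp add: w_def flip: ennreal_mult)
        qed simp
      qed
      also have "\<dots> = ennreal (exp ((real n)\<^sup>2)) * ennreal (sqrt pi) ^ DIM('a)"
      proof -
        have "w \<in> borel_measurable M"
          unfolding measurable_cong_sets[OF sets_M refl, of borel] by (rule w_meas)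
        then show ?thesis
          by (simp add: nn_integral_cmult w_M)
      qed
      also have "\<dots> < \<infinity>"
        by (simp add: ennreal_power flip: ennreal_mult)
      finally show "emeasure M a \<noteq> \<infinity>"
        by simp
    qed (auto simp: sets_M)
  qed
  then have "(\<integral>\<^sup>+x. F x \<partial>M) = (\<integral>\<^sup>+x. F x \<partial>lborel)"
  proof (rule translation_invariant_eq_lborel[OF _ sets_M _ w_meas _ w_M])
    show "w (- x) = w x" for x
      by (simp add: w_def)
    show "(\<integral>\<^sup>+x. w x \<partial>lborel) = ennreal (sqrt pi) ^ DIM('a)"
      unfolding w_def by (rule nn_integral_exp_norm)
    show "ennreal (sqrt pi) ^ DIM('a) \<noteq> 0" "ennreal (sqrt pi) ^ DIM('a) \<noteq> \<infinity>"
      by (simp_all add: ennreal_power)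
    show "F \<in> borel_measurable borel" by (rule F)
    fix F :: "'a \<Rightarrow> ennreal" and a assume F: "F \<in> borel_measurable borel"
    obtain z0 \<sigma>0 where a: "a = lp z0 \<sigma>0"
      using lp_surj by blast
    have "(\<lambda>x. F (a + x)) \<in> borel_measurable borel"
      using F by measurable
    from M_int[OF this] have "(\<integral>\<^sup>+x. F (a + x) \<partial>M) = (\<integral>\<^sup>+z. (\<integral>\<^sup>+\<sigma>. F (a + lp z \<sigma>) \<partial>(Pi\<^sub>M {..<DIM('a) - CARD('m)} (\<lambda>_. lborel))) \<partial>lborel)" .
    \<comment> \<open>Additivity of \<open>lp\<close> splits the translation: its fibre part is
      absorbed by invariance of the fibre measure here, its first-layer part by invariance in
      \<open>z\<close> next.\<close>
    also have "\<dots> = (\<integral>\<^sup>+z. (\<integral>\<^sup>+\<sigma>. F (lp (z0 + z) \<sigma>) \<partial>(Pi\<^sub>M {..<DIM('a) - CARD('m)} (\<lambda>_. lborel))) \<partial>lborel)"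
    proof (rule nn_integral_cong)
      fix z
      have "F (a + lp z \<sigma>) = F (lp (z0 + z) (\<lambda>k\<in>{..<DIM('a) - CARD('m)}. \<sigma>0 k + \<sigma> k))" for \<sigma>
        unfolding lp_restrict lp_add a ..
      then show "(\<integral>\<^sup>+\<sigma>. F (a + lp z \<sigma>) \<partial>(Pi\<^sub>M {..<DIM('a) - CARD('m)} (\<lambda>_. lborel))) = (\<integral>\<^sup>+\<sigma>. F (lp (z0 + z) \<sigma>) \<partial>(Pi\<^sub>M {..<DIM('a) - CARD('m)} (\<lambda>_. lborel)))"
        using nn_integral_PiM_translate[of "{..<DIM('a) - CARD('m)}" "\<lambda>\<sigma>. F (lp (z0 + z) \<sigma>)" \<sigma>0] measurable_compose[OF lp_measurable F]
        by simp
    qed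
    also have "\<dots> = (\<integral>\<^sup>+z. (\<integral>\<^sup>+\<sigma>. F (lp z \<sigma>) \<partial>(Pi\<^sub>M {..<DIM('a) - CARD('m)} (\<lambda>_. lborel))) \<partial>lborel)"
    proof (rule nn_integral_lborel_translate)
      show "(\<lambda>z. \<integral>\<^sup>+\<sigma>. F (lp z \<sigma>) \<partial>(Pi\<^sub>M {..<DIM('a) - CARD('m)} (\<lambda>_. lborel))) \<in> borel_measurable borel"
        using measurable_compose[OF lp_measurable_pair F] by (intro S.borel_measurable_nn_integral) (simp add: case_prod_unfold)
    qed
    also have "\<dots> = (\<integral>\<^sup>+x. F x \<partial>M)"
      by (rule M_int[OF F, symmetric])
    finally show "(\<integral>\<^sup>+x. F (a + x) \<partial>M) = (\<integral>\<^sup>+x. F x \<partial>M)" .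
  qed
  then show ?thesis
    by (simp add: M_int[OF F])
qed

text \<open>Writing the Gaussian as a Fourier integral makes the double integral absolutely
  convergent. Integrating over the group first yields \<open>c t x\<close>, which multiplies the
  factor for time \<open>s\<close> into the one for time \<open>s + t\<close>.\<close>

lemma nn_integral_p_gauss:
  assumes t: "t > 0" and s: "s > 0"
  shows "(\<integral>\<^sup>+g. ennreal (p 0 g t) * ennreal (gauss s (pr g - a)) \<partial>lborel) = ennreal (gauss (s + t) a)"
proof -
  let ?k = "(2 * pi) ^ CARD('m)"
  define E where "E s x = exp (- s * (norm x)\<^sup>2)" for s and x :: "real^'m"
  have E_int: "integrable lborel (E s)" if "s > 0" for s
    using integrable_Re[OF gaussian_fourier(1)[OF that, of "0::real^'m"]] by (simp add: E_def[abs_def])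
  have E_meas: "E s \<in> borel_measurable borel" for s
    unfolding E_def[abs_def] by measurable
  have four: "(\<integral>x. E s x *\<^sub>R cis (x \<bullet> z) \<partial>lborel) = ?k * gauss s z" if "s > 0" for s and z :: "real^'m"
    unfolding E_def by (rule gauss_fourier[OF that])
  have int: "integrable (lborel \<Otimes>\<^sub>M lborel) (\<lambda>(x, g). (p 0 g t * E s x) *\<^sub>R (ph x g * cis (- (x \<bullet> a))))"
  proof (rule lborel_pair.Fubini_integrable)
    have "continuous_on UNIV (\<lambda>(x, g). (p 0 g t * E s x) *\<^sub>R (ph x g * cis (- (x \<bullet> a))))"
      unfolding split_beta ph_def E_def cis_conv_exp
      by (intro continuous_intros p_continuous[OF t])
    then show "(\<lambda>(x, g). (p 0 g t * E s x) *\<^sub>R (ph x g * cis (- (x \<bullet> a)))) \<in> borel_measurable (lborel \<Otimes>\<^sub>M lborel)"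
      unfolding lborel_prod by (simp add: borel_measurable_continuous_onI)
    have "(\<integral>g. norm ((p 0 g t * E s x) *\<^sub>R (ph x g * cis (- (x \<bullet> a)))) \<partial>lborel) = mass t * E s x" for x
      using p_pos[OF t, THEN less_imp_le] by (simp add: norm_mult abs_mult E_def mass_def)
    then show "integrable lborel (\<lambda>x. \<integral>y. norm (case (x, y) of (x, g) \<Rightarrow> (p 0 g t * E s x) *\<^sub>R (ph x g * cis (- (x \<bullet> a)))) \<partial>lborel)"
      using E_int[OF s] by simp
    have "integrable lborel (\<lambda>g. (E s x *\<^sub>R cis (- (x \<bullet> a))) * (p 0 g t *\<^sub>R ph x g))" for x
      by (intro integrable_mult_right integrable_ph integrable_p[OF t])
    then show "AE x in lborel. integrable lborel (\<lambda>y. case (x, y) of (x, g) \<Rightarrow> (p 0 g t * E s x) *\<^sub>R (ph x g * cis (- (x \<bullet> a))))"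
      by (simp add: mult_ac)
  qed
  have inner_g: "(\<integral>x. (p 0 g t * E s x) *\<^sub>R (ph x g * cis (- (x \<bullet> a))) \<partial>lborel) = of_real (?k * (p 0 g t * gauss s (pr g - a)))" for g
  proof -
    have "(p 0 g t * E s x) *\<^sub>R (ph x g * cis (- (x \<bullet> a))) = p 0 g t *\<^sub>R (E s x *\<^sub>R cis (x \<bullet> (pr g - a)))" for x
      by (simp add: ph_def cis_mult inner_diff_right)
    then show ?thesis
      by (simp only: integral_scaleR_right four[OF s]) (simp add: scaleR_conv_of_real mult_ac)
  qed
  have inner_x: "(\<integral>g. (p 0 g t * E s x) *\<^sub>R (ph x g * cis (- (x \<bullet> a))) \<partial>lborel) = E (s + t) x *\<^sub>R cis (x \<bullet> (- a))" for x
  proof -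
    have "(p 0 g t * E s x) *\<^sub>R (ph x g * cis (- (x \<bullet> a))) = (E s x *\<^sub>R cis (x \<bullet> (- a))) * (p 0 g t *\<^sub>R ph x g)" for g
      by (simp add: mult_ac)
    then have "(\<integral>g. (p 0 g t * E s x) *\<^sub>R (ph x g * cis (- (x \<bullet> a))) \<partial>lborel) = (E s x *\<^sub>R cis (x \<bullet> (- a))) * c t x"
      unfolding c_def by (simp only: integral_mult_right_zero)
    moreover have "E s x * exp (- t * (norm x)\<^sup>2) = E (s + t) x"
      by (simp add: E_def algebra_simps flip: exp_add)
    ultimately show ?thesis
      unfolding c_eq[OF t] by (simp add: scaleR_conv_of_real mult_ac flip: of_real_mult)
  qed
  have Re_int: "integrable lborel (\<lambda>g. ?k * (p 0 g t * gauss s (pr g - a)))"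
    using integrable_Re[OF lborel_pair.integrable_snd[OF int]] by (simp only: inner_g Re_complex_of_real)
  have "of_real (\<integral>g. ?k * (p 0 g t * gauss s (pr g - a)) \<partial>lborel) =
      (\<integral>g. (\<integral>x. (p 0 g t * E s x) *\<^sub>R (ph x g * cis (- (x \<bullet> a))) \<partial>lborel) \<partial>lborel)"
    unfolding inner_g by (rule integral_complex_of_real[symmetric])
  also have "\<dots> = (\<integral>x. (\<integral>g. (p 0 g t * E s x) *\<^sub>R (ph x g * cis (- (x \<bullet> a))) \<partial>lborel) \<partial>lborel)"
    by (rule lborel_pair.Fubini_integral[OF int])
  also have "\<dots> = ?k * gauss (s + t) (- a)"
    unfolding inner_x using four[of "s + t" "- a"] s t by simp
  also have "gauss (s + t) (- a) = gauss (s + t) a"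
    by (rule gauss_uminus)
  finally have "?k * (\<integral>g. p 0 g t * gauss s (pr g - a) \<partial>lborel) = ?k * gauss (s + t) a"
    by (simp only: integral_mult_right_zero of_real_mult[symmetric] of_real_eq_iff)
  then have "(\<integral>g. p 0 g t * gauss s (pr g - a) \<partial>lborel) = gauss (s + t) a"
    by simp
  moreover have "integrable lborel (\<lambda>g. p 0 g t * gauss s (pr g - a))"
  proof -
    have k0: "?k \<noteq> 0"
      by simp
    have "inverse ?k * (?k * x) = x" for x
      unfolding mult.assoc[symmetric] left_inverse[OF k0] by simp
    then show ?thesis
      using integrable_mult_right[OF Re_int, of "inverse ?k"] by (simp only:)
  qed
  ultimately have "(\<integral>\<^sup>+g. ennreal (p 0 g t * gauss s (pr g - a)) \<partial>lborel) = ennreal (gauss (s + t) a)"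
    by (subst nn_integral_eq_integral) (simp_all add: less_imp_le[OF p_pos[OF t]] less_imp_le[OF gauss_pos[OF s]])
  moreover have "ennreal (p 0 g t * gauss s (pr g - a)) = ennreal (p 0 g t) * ennreal (gauss s (pr g - a))" for g
    by (intro ennreal_mult less_imp_le[OF p_pos[OF t]] less_imp_le[OF gauss_pos[OF s]])
  ultimately show ?thesis
    by simp
qed

end

section \<open>Integrals over fibres\<close>

lemma nn_integral_lborel_affine:
  fixes a :: "'a::euclidean_space"
  assumes F: "F \<in> borel_measurable borel" and c: "c > 0"
  shows "(\<integral>\<^sup>+z. F z \<partial>lborel) = ennreal (c ^ DIM('a)) * (\<integral>\<^sup>+y. F (a + c *\<^sub>R y) \<partial>lborel)"
  using F c by (subst lborel_affine[of c a]) (simp_all add: nn_integral_density nn_integral_distr nn_integral_cmult)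

section \<open>Fibre integrals of the kernel: upper bound and covariance under translations\<close>

context carnot_heat
begin

lemma continuous_on_lp: "continuous_on S (\<lambda>z. lp z \<sigma>)"
  unfolding log_point_def by (intro continuous_intros)

lemma tendsto_lp: "Y \<longlonglongrightarrow> z \<Longrightarrow> (\<lambda>n. lp (Y n) \<sigma>) \<longlonglongrightarrow> lp z \<sigma>"
  by (rule continuous_on_tendsto_compose[OF continuous_on_lp[of UNIV]]) auto

text \<open>Valued in \<open>ennreal\<close>, since finiteness of the fibre integral at a given
  \<open>z\<close> is part of what is to be shown.\<close>

definition q :: "'a \<Rightarrow> real^'m \<Rightarrow> real \<Rightarrow> ennreal" where
  "q g z t = (\<integral>\<^sup>+\<sigma>. ennreal (p g (lp z \<sigma>) t) \<partial>(Pi\<^sub>M {..<DIM('a) - CARD('m)} (\<lambda>_. lborel)))"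

lemma borel_measurable_fibre_integral:
  assumes "F \<in> borel_measurable borel"
  shows "(\<lambda>z. \<integral>\<^sup>+\<sigma>. F (lp z \<sigma>) \<partial>(Pi\<^sub>M {..<DIM('a) - CARD('m)} (\<lambda>_. lborel))) \<in> borel_measurable borel"
proof -
  interpret S: sigma_finite_measure "Pi\<^sub>M {..<DIM('a) - CARD('m)} (\<lambda>_. lborel :: real measure)"
    by (rule sigma_finite_fibre)
  show ?thesis
    using measurable_compose[OF lp_measurable_pair assms] by (intro S.borel_measurable_nn_integral) (simp add: case_prod_unfold)
qed

lemma q_measurable [measurable]: "t > 0 \<Longrightarrow> (\<lambda>z. q g z t) \<in> borel_measurable borel"
  unfolding q_def by (rule borel_measurable_fibre_integral) simp

lemma p_lp_measurable [measurable]: "t > 0 \<Longrightarrow> (\<lambda>\<sigma>. p g (lp z \<sigma>) t) \<in> borel_measurable (Pi\<^sub>M {..<DIM('a) - CARD('m)} (\<lambda>_. lborel))"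
  by (rule measurable_compose[OF lp_measurable p_measurable(2)])

lemma nn_integral_q:
  assumes t: "t > 0" and w: "w \<in> borel_measurable borel"
  shows "(\<integral>\<^sup>+z. q g z t * w z \<partial>lborel) = (\<integral>\<^sup>+x. ennreal (p g x t) * w (pr x) \<partial>lborel)"
proof -
  have [measurable]: "pr \<in> borel_measurable borel"
    by (intro borel_measurable_continuous_onI continuous_on_pr continuous_on_id)
  have "(\<integral>\<^sup>+x. ennreal (p g x t) * w (pr x) \<partial>lborel) = (\<integral>\<^sup>+z. (\<integral>\<^sup>+\<sigma>. ennreal (p g (lp z \<sigma>) t) * w (pr (lp z \<sigma>)) \<partial>(Pi\<^sub>M {..<DIM('a) - CARD('m)} (\<lambda>_. lborel))) \<partial>lborel)"
    by (rule nn_integral_coordinates) (use t w in measurable)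
  also have "\<dots> = (\<integral>\<^sup>+z. q g z t * w z \<partial>lborel)"
    using t by (simp add: q_def nn_integral_multc)
  finally show ?thesis ..
qed

lemma q_gauss:
  assumes "t > 0" "s > 0"
  shows "(\<integral>\<^sup>+z. q 0 z t * ennreal (gauss s (z - a)) \<partial>lborel) = ennreal (gauss (s + t) a)"
  using nn_integral_q[OF assms(1), of "\<lambda>z. ennreal (gauss s (z - a))" 0] nn_integral_p_gauss[OF assms, of a] by simp

text \<open>Fatou on the fibre. The constant \<open>b\<close> is carried along because the lemma is
  applied under an integral with a Gaussian weight.\<close>

lemma q_lower_semicontinuous:
  assumes t: "t > 0" and Y: "Y \<longlonglongrightarrow> z" and b: "b \<ge> 0"
  shows "q g z t * ennreal b \<le> liminf (\<lambda>n. q g (Y n) t * ennreal b)"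
proof -
  have q_b: "q g z t * ennreal b = (\<integral>\<^sup>+\<sigma>. ennreal (p g (lp z \<sigma>) t * b) \<partial>(Pi\<^sub>M {..<DIM('a) - CARD('m)} (\<lambda>_. lborel)))" for z
    unfolding q_def using t b p_pos[OF t, THEN less_imp_le] by (simp add: nn_integral_multc ennreal_mult)
  have "continuous_on UNIV (\<lambda>x. p g x t)"
    by (intro p_continuous[OF t] continuous_intros)
  then have "(\<lambda>n. p g (lp (Y n) \<sigma>) t) \<longlonglongrightarrow> p g (lp z \<sigma>) t" for \<sigma>
    by (rule continuous_on_tendsto_compose[OF _ tendsto_lp[OF Y]]) auto
  then have "(\<lambda>n. ennreal (p g (lp (Y n) \<sigma>) t * b)) \<longlonglongrightarrow> ennreal (p g (lp z \<sigma>) t * b)" for \<sigma>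
    by (intro tendsto_ennrealI tendsto_mult tendsto_const)
  from lim_imp_Liminf[OF _ this]
  have "q g z t * ennreal b = (\<integral>\<^sup>+\<sigma>. liminf (\<lambda>n. ennreal (p g (lp (Y n) \<sigma>) t * b)) \<partial>(Pi\<^sub>M {..<DIM('a) - CARD('m)} (\<lambda>_. lborel)))"
    unfolding q_b by simp
  also have "\<dots> \<le> liminf (\<lambda>n. q g (Y n) t * ennreal b)"
    unfolding q_b using t by (intro nn_integral_liminf) simp
  finally show ?thesis .
qed

text \<open>Average \<open>q\<close> around \<open>a\<close> with Gaussians shrinking to a point; by
  \<open>q_gauss\<close> the averages tend to \<open>gauss t a\<close>. After rescaling, the weight
  is the fixed profile \<open>gauss 1\<close>, so that Fatou in \<open>y\<close> combines with lower
  semicontinuity at \<open>a\<close>.\<close>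

lemma q_le_gauss:
  assumes t: "t > 0"
  shows "q 0 a t \<le> ennreal (gauss t a)"
proof -
  define r where "r n = 1 / real (Suc n)" for n
  have r: "r n > 0" for n
    by (simp add: r_def)
  have r_lim: "r \<longlonglongrightarrow> 0"
    unfolding r_def by real_asymp
  have scale: "(\<integral>\<^sup>+y. q 0 (a + r n *\<^sub>R y) t * ennreal (gauss 1 y) \<partial>lborel) = ennreal (gauss ((r n)\<^sup>2 + t) a)" for n
  proof -
    \<comment> \<open>The Jacobian of \<open>y \<mapsto> a + r n *\<^sub>R y\<close> exactly
      compensates the normalisation of the Gaussian with time parameter
      \<open>(r n)\<^sup>2\<close>.\<close>
    have "(r n) ^ CARD('m) * gauss ((r n)\<^sup>2) (r n *\<^sub>R y) = gauss 1 y" for y :: "real^'m"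
    proof -
      have "(4 * pi * (r n)\<^sup>2) powr (- (real CARD('m) / 2)) = (4 * pi) powr (- (real CARD('m) / 2)) * ((r n) powr 2) powr (- (real CARD('m) / 2))"
        using r[of n] by (simp add: powr_mult)
      also have "((r n) powr 2) powr (- (real CARD('m) / 2)) = inverse (r n ^ CARD('m))"
        unfolding powr_powr using r[of n] by (simp add: powr_minus powr_realpow)
      finally show ?thesis
        using r[of n] by (simp add: gauss_def power_mult_distrib)
    qed
    then have g: "ennreal (r n ^ CARD('m)) * ennreal (gauss ((r n)\<^sup>2) (r n *\<^sub>R y)) = ennreal (gauss 1 y)" for y :: "real^'m"
      using r[of n] by (subst ennreal_mult[symmetric]) (simp_all add: less_imp_le gauss_pos)
    have "ennreal (gauss ((r n)\<^sup>2 + t) a) = (\<integral>\<^sup>+z. q 0 z t * ennreal (gauss ((r n)\<^sup>2) (z - a)) \<partial>lborel)"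
      using q_gauss[OF t, of "(r n)\<^sup>2" a] r[of n] by simp
    also have "\<dots> = ennreal (r n ^ DIM(real^'m)) * (\<integral>\<^sup>+y. q 0 (a + r n *\<^sub>R y) t * ennreal (gauss ((r n)\<^sup>2) (a + r n *\<^sub>R y - a)) \<partial>lborel)"
      by (rule nn_integral_lborel_affine[OF _ r]) (use t in measurable)
    also have "\<dots> = (\<integral>\<^sup>+y. ennreal (r n ^ CARD('m)) * (q 0 (a + r n *\<^sub>R y) t * ennreal (gauss ((r n)\<^sup>2) (r n *\<^sub>R y))) \<partial>lborel)"
      using t by (subst nn_integral_cmult) (simp_all)
    also have "\<dots> = (\<integral>\<^sup>+y. q 0 (a + r n *\<^sub>R y) t * ennreal (gauss 1 y) \<partial>lborel)"
      unfolding mult.left_commute[of "ennreal (r n ^ CARD('m))"] g ..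
    finally show ?thesis ..
  qed
  have "q 0 a t = (\<integral>\<^sup>+y. q 0 a t * ennreal (gauss 1 y) \<partial>(lborel :: (real^'m) measure))"
    by (simp add: nn_integral_cmult nn_integral_gauss)
  also have "\<dots> \<le> (\<integral>\<^sup>+y. liminf (\<lambda>n. q 0 (a + r n *\<^sub>R y) t * ennreal (gauss 1 y)) \<partial>lborel)"
  proof (intro nn_integral_mono q_lower_semicontinuous[OF t] less_imp_le[OF gauss_pos])
    fix y :: "real^'m"
    have "(\<lambda>n. a + r n *\<^sub>R y) \<longlonglongrightarrow> a + 0 *\<^sub>R y"
      by (intro tendsto_intros r_lim)
    then show "(\<lambda>n. a + r n *\<^sub>R y) \<longlonglongrightarrow> a"
      by simp
  qed simp
  also have "\<dots> \<le> liminf (\<lambda>n. \<integral>\<^sup>+y. q 0 (a + r n *\<^sub>R y) t * ennreal (gauss 1 y) \<partial>lborel)"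
    using t by (intro nn_integral_liminf) measurable
  also have "\<dots> = ennreal (gauss t a)"
    unfolding scale
  proof (rule lim_imp_Liminf[OF _ tendsto_ennrealI])
    have "(\<lambda>n. gauss ((r n)\<^sup>2 + t) a) \<longlonglongrightarrow> gauss (0\<^sup>2 + t) a"
      unfolding gauss_def using t by (intro tendsto_intros r_lim) auto
    then show "(\<lambda>n. gauss ((r n)\<^sup>2 + t) a) \<longlonglongrightarrow> gauss t a"
      by simp
  qed simp
  finally show ?thesis .
qed

lemma nn_integral_p:
  assumes t: "t > 0"
  shows "(\<integral>\<^sup>+x. ennreal (p g x t) \<partial>lborel) = 1"
proof -
  have "complex_of_real (mass t) = 1"
    using c_eq[OF t, of 0] by (simp add: c_0)
  then have "mass t = 1"
    by (simp only: of_real_eq_1_iff)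
  then show ?thesis
    using p_mass[OF t, of g] integrable_p[OF t, of g] p_pos[OF t, THEN less_imp_le] by (simp add: nn_integral_eq_integral)
qed

text \<open>A function that lies below the Gaussian everywhere and has the same total integral 1 can
  differ from it only on a null set.\<close>

lemma q_AE_eq_gauss:
  assumes t: "t > 0"
  shows "AE z in lborel. q 0 z t = ennreal (gauss t z)"
proof -
  have q1: "(\<integral>\<^sup>+z. q 0 z t \<partial>lborel) = 1"
    using nn_integral_q[OF t, of "\<lambda>_. 1" 0] nn_integral_p[OF t] by simp
  have "AE z in lborel. ennreal (gauss t z) \<le> q 0 z t"
  proof (rule ccontr)
    assume "\<not> ?thesis"
    then have "(\<integral>\<^sup>+z. q 0 z t \<partial>lborel) < (\<integral>\<^sup>+z. ennreal (gauss t z) \<partial>(lborel :: (real^'m) measure))"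
      using t q1 by (intro nn_integral_less) (auto intro: q_le_gauss)
    then show False
      using q1 nn_integral_gauss[OF t, where 'm='m] by simp
  qed
  then show ?thesis
    by eventually_elim (intro antisym q_le_gauss[OF t])
qed

text \<open>A point of the support has bounded norm, and its fibre coordinates are inner products
  with unit vectors. So one box carries all fibres of \<open>H\<close>, and domination is uniform in
  \<open>z\<close>.\<close>

lemma fibre_integral_continuous:
  fixes H :: "'a \<Rightarrow> real"
  assumes H: "continuous_on UNIV H" "compact (closure {x. H x \<noteq> 0})"
  shows "integrable (Pi\<^sub>M {..<DIM('a) - CARD('m)} (\<lambda>_. lborel)) (\<lambda>\<sigma>. H (lp z \<sigma>))"
    and "continuous_on UNIV (\<lambda>z. \<integral>\<sigma>. H (lp z \<sigma>) \<partial>(Pi\<^sub>M {..<DIM('a) - CARD('m)} (\<lambda>_. lborel)))"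
proof -
  let ?I = "{..<DIM('a) - CARD('m)}"
  obtain R where R: "\<And>x. x \<in> closure {x. H x \<noteq> 0} \<Longrightarrow> norm x \<le> R"
    using compact_imp_bounded[OF H(2)] unfolding bounded_iff by blast
  have "compact (H ` closure {x. H x \<noteq> 0})"
    by (intro compact_continuous_image continuous_on_subset[OF H(1)] H(2)) auto
  from compact_imp_bounded[OF this] obtain B where B: "\<forall>y\<in>H ` closure {x. H x \<noteq> 0}. norm y \<le> B"
    unfolding bounded_iff ..
  define w :: "(nat \<Rightarrow> real) \<Rightarrow> real" where "w \<sigma> = \<bar>B\<bar> * indicator (Pi\<^sub>E ?I (\<lambda>_. {-R..R})) \<sigma>" for \<sigma>
  have w_int: "integrable (Pi\<^sub>M {..<DIM('a) - CARD('m)} (\<lambda>_. lborel)) w"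
  proof -
    have "Pi\<^sub>E ?I (\<lambda>_. {-R..R}) \<in> sets (Pi\<^sub>M {..<DIM('a) - CARD('m)} (\<lambda>_. lborel))"
      by (intro sets_PiM_I_finite) auto
    moreover have "emeasure (Pi\<^sub>M {..<DIM('a) - CARD('m)} (\<lambda>_. lborel)) (Pi\<^sub>E ?I (\<lambda>_. {-R..R})) = (\<Prod>k\<in>?I. emeasure lborel {-R..R})"
      by (rule \<sigma>.emeasure_PiM) auto
    moreover have "(\<Prod>k\<in>?I. emeasure lborel {-R..R}) < \<infinity>"
      using emeasure_lborel_cbox_finite[of "-R" R] by (simp add: power_less_top_ennreal)
    ultimately show ?thesis
      unfolding w_def[abs_def] by (intro integrable_mult_right) simp
  qed
  have bound: "norm (H (lp z \<sigma>)) \<le> w \<sigma>" if \<sigma>: "\<sigma> \<in> space (Pi\<^sub>M {..<DIM('a) - CARD('m)} (\<lambda>_. lborel))" for z \<sigma>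
  proof (cases "lp z \<sigma> \<in> closure {x. H x \<noteq> 0}")
    case True
    have "\<bar>\<sigma> k\<bar> \<le> R" if k: "k \<in> ?I" for k
    proof -
      have "norm (f k) = 1"
        using f_orthonormal[of k k] k by (simp add: norm_eq_1)
      then have "\<bar>\<sigma> k\<bar> \<le> norm (lp z \<sigma>)"
        using Cauchy_Schwarz_ineq2[of "lp z \<sigma>" "f k"] k by (simp add: inner_lp_f)
      then show ?thesis
        using R[OF True] by simp
    qed
    then have "\<sigma> \<in> Pi\<^sub>E ?I (\<lambda>_. {-R..R})"
      using \<sigma> by (auto simp: space_PiM PiE_iff abs_le_iff minus_le_iff)
    moreover have "norm (H (lp z \<sigma>)) \<le> \<bar>B\<bar>"
      using B True by (meson abs_ge_self image_eqI order_trans)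
    ultimately show ?thesis
      by (simp add: w_def)
  next
    case False
    then show ?thesis
      using zero_outside_support[of "lp z \<sigma>" H] by (simp add: w_def)
  qed
  have meas: "(\<lambda>\<sigma>. H (lp z \<sigma>)) \<in> borel_measurable (Pi\<^sub>M {..<DIM('a) - CARD('m)} (\<lambda>_. lborel))" for z
    by (rule measurable_compose[OF lp_measurable borel_measurable_continuous_onI[OF H(1)]])
  have w_nn: "w \<sigma> \<ge> 0" for \<sigma>
    by (simp add: w_def)
  show "integrable (Pi\<^sub>M {..<DIM('a) - CARD('m)} (\<lambda>_. lborel)) (\<lambda>\<sigma>. H (lp z \<sigma>))"
    by (rule Bochner_Integration.integrable_bound[OF w_int meas]) (intro AE_I2, use bound w_nn in simp)
  show "continuous_on UNIV (\<lambda>z. \<integral>\<sigma>. H (lp z \<sigma>) \<partial>(Pi\<^sub>M {..<DIM('a) - CARD('m)} (\<lambda>_. lborel)))"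
  proof (rule continuous_on_sequentiallyI)
    fix Y :: "nat \<Rightarrow> real^'m" and z assume Y: "Y \<longlonglongrightarrow> z"
    show "(\<lambda>n. \<integral>\<sigma>. H (lp (Y n) \<sigma>) \<partial>(Pi\<^sub>M {..<DIM('a) - CARD('m)} (\<lambda>_. lborel))) \<longlonglongrightarrow> (\<integral>\<sigma>. H (lp z \<sigma>) \<partial>(Pi\<^sub>M {..<DIM('a) - CARD('m)} (\<lambda>_. lborel)))"
    proof (rule integral_dominated_convergence[OF meas meas w_int])
      show "AE \<sigma> in (Pi\<^sub>M {..<DIM('a) - CARD('m)} (\<lambda>_. lborel)). (\<lambda>n. H (lp (Y n) \<sigma>)) \<longlonglongrightarrow> H (lp z \<sigma>)"
        by (intro AE_I2 continuous_on_tendsto_compose[OF H(1)] tendsto_lp[OF Y]) auto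
    qed (intro AE_I2 bound)
  qed
qed

text \<open>The two sides agree for almost every \<open>z\<close> by left invariance on the whole group, hence for every \<open>z\<close> by continuity.\<close>

lemma fibre_left_compact_support:
  fixes H :: "'a \<Rightarrow> real"
  assumes H: "continuous_on UNIV H" "compact (closure {x. H x \<noteq> 0})" "\<And>x. H x \<ge> 0"
  shows "(\<integral>\<^sup>+\<sigma>. ennreal (H (mul h (lp z \<sigma>))) \<partial>(Pi\<^sub>M {..<DIM('a) - CARD('m)} (\<lambda>_. lborel))) = ennreal (D h) * (\<integral>\<^sup>+\<sigma>. ennreal (H (lp (pr h + z) \<sigma>)) \<partial>(Pi\<^sub>M {..<DIM('a) - CARD('m)} (\<lambda>_. lborel)))"
proof -
  have Hh: "continuous_on UNIV (\<lambda>x. H (mul h x))"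
    by (rule continuous_on_compose2[OF H(1) smooth_on_continuous[OF smooth_left_mul]]) auto
  note cont1 = fibre_integral_continuous[OF Hh compact_support_left_translate[OF H(2)]]
    and cont2 = fibre_integral_continuous[OF H(1,2)]
  define a where "a z = (\<integral>\<sigma>. H (mul h (lp z \<sigma>)) \<partial>(Pi\<^sub>M {..<DIM('a) - CARD('m)} (\<lambda>_. lborel)))" for z
  define b where "b z = D h * (\<integral>\<sigma>. H (lp (pr h + z) \<sigma>) \<partial>(Pi\<^sub>M {..<DIM('a) - CARD('m)} (\<lambda>_. lborel)))" for z
  have a_eq: "ennreal (a z) = (\<integral>\<^sup>+\<sigma>. ennreal (H (mul h (lp z \<sigma>))) \<partial>(Pi\<^sub>M {..<DIM('a) - CARD('m)} (\<lambda>_. lborel)))" for z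
    unfolding a_def using H(3) by (intro nn_integral_eq_integral[symmetric] cont1(1)) simp
  have b_eq: "ennreal (b z) = ennreal (D h) * (\<integral>\<^sup>+\<sigma>. ennreal (H (lp (pr h + z) \<sigma>)) \<partial>(Pi\<^sub>M {..<DIM('a) - CARD('m)} (\<lambda>_. lborel)))" for z
    unfolding b_def using H(3) D_pos[of h] cont2(1)
    by (subst nn_integral_eq_integral) (simp_all add: ennreal_mult integral_nonneg_AE less_imp_le)
  have a_cont: "continuous_on UNIV a" and b_cont: "continuous_on UNIV b"
    unfolding a_def b_def
    by (auto intro!: cont1(2) continuous_on_mult continuous_on_compose2[OF cont2(2)] continuous_intros)
  have [measurable]: "H \<in> borel_measurable borel" "a \<in> borel_measurable borel" "b \<in> borel_measurable borel"
    using H(1) a_cont b_cont by (auto intro: borel_measurable_continuous_onI)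
  have [measurable]: "pr \<in> borel_measurable borel"
    by (intro borel_measurable_continuous_onI continuous_on_pr continuous_on_id)
  have "density lborel (\<lambda>z. ennreal (a z)) = density lborel (\<lambda>z. ennreal (b z))"
  proof (rule measure_eqI)
    fix A assume "A \<in> sets (density lborel (\<lambda>z. ennreal (a z)))"
    then have A [measurable]: "A \<in> sets borel"
      by simp
    \<comment> \<open>\<open>pr\<close> turns left translation by \<open>h\<close> into the shift by
      \<open>pr h\<close>; with this offset the indicator tests \<open>z\<close> itself after the
      translation.\<close>
    define F where "F x = ennreal (H x) * indicator A (pr x - pr h)" for x
    have F [measurable]: "F \<in> borel_measurable borel"
      unfolding F_def by measurable
    have F': "(\<lambda>x. F (mul h x)) \<in> borel_measurable borel"
      by measurable
    have "emeasure (density lborel (\<lambda>z. ennreal (a z))) A = (\<integral>\<^sup>+z. ennreal (a z) * indicator A z \<partial>lborel)"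
      by (simp add: emeasure_density)
    also have "\<dots> = (\<integral>\<^sup>+z. (\<integral>\<^sup>+\<sigma>. F (mul h (lp z \<sigma>)) \<partial>(Pi\<^sub>M {..<DIM('a) - CARD('m)} (\<lambda>_. lborel))) \<partial>lborel)"
    proof (rule nn_integral_cong)
      fix z
      have "F (mul h (lp z \<sigma>)) = ennreal (H (mul h (lp z \<sigma>))) * indicator A z" for \<sigma>
        by (simp add: F_def pr_mul)
      then show "ennreal (a z) * indicator A z = (\<integral>\<^sup>+\<sigma>. F (mul h (lp z \<sigma>)) \<partial>(Pi\<^sub>M {..<DIM('a) - CARD('m)} (\<lambda>_. lborel)))"
        unfolding a_eq by (simp only:) (rule nn_integral_multc[symmetric], measurable)
    qed
    also have "\<dots> = (\<integral>\<^sup>+x. F (mul h x) \<partial>lborel)"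
      by (rule nn_integral_coordinates[OF F', symmetric])
    also have "\<dots> = ennreal (D h) * (\<integral>\<^sup>+z. (\<integral>\<^sup>+\<sigma>. F (lp z \<sigma>) \<partial>(Pi\<^sub>M {..<DIM('a) - CARD('m)} (\<lambda>_. lborel))) \<partial>lborel)"
      unfolding nn_integral_left[OF F] nn_integral_coordinates[OF F] ..
    also have "(\<integral>\<^sup>+z. (\<integral>\<^sup>+\<sigma>. F (lp z \<sigma>) \<partial>(Pi\<^sub>M {..<DIM('a) - CARD('m)} (\<lambda>_. lborel))) \<partial>lborel) = (\<integral>\<^sup>+z. (\<integral>\<^sup>+\<sigma>. F (lp (pr h + z) \<sigma>) \<partial>(Pi\<^sub>M {..<DIM('a) - CARD('m)} (\<lambda>_. lborel))) \<partial>lborel)"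
      by (rule nn_integral_lborel_translate[symmetric, OF borel_measurable_fibre_integral[OF F]])
    also have "ennreal (D h) * \<dots> = (\<integral>\<^sup>+z. ennreal (D h) * (\<integral>\<^sup>+\<sigma>. F (lp (pr h + z) \<sigma>) \<partial>(Pi\<^sub>M {..<DIM('a) - CARD('m)} (\<lambda>_. lborel))) \<partial>lborel)"
      using borel_measurable_fibre_integral[OF F] by (intro nn_integral_cmult[symmetric]) simp
    also have "\<dots> = (\<integral>\<^sup>+z. ennreal (b z) * indicator A z \<partial>lborel)"
    proof (rule nn_integral_cong)
      fix z
      have "F (lp (pr h + z) \<sigma>) = ennreal (H (lp (pr h + z) \<sigma>)) * indicator A z" for \<sigma>
        by (simp add: F_def)
      then have "(\<integral>\<^sup>+\<sigma>. F (lp (pr h + z) \<sigma>) \<partial>(Pi\<^sub>M {..<DIM('a) - CARD('m)} (\<lambda>_. lborel))) = (\<integral>\<^sup>+\<sigma>. ennreal (H (lp (pr h + z) \<sigma>)) \<partial>(Pi\<^sub>M {..<DIM('a) - CARD('m)} (\<lambda>_. lborel))) * indicator A z"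
        by (simp only:) (rule nn_integral_multc, measurable)
      then show "ennreal (D h) * (\<integral>\<^sup>+\<sigma>. F (lp (pr h + z) \<sigma>) \<partial>(Pi\<^sub>M {..<DIM('a) - CARD('m)} (\<lambda>_. lborel))) = ennreal (b z) * indicator A z"
        unfolding b_eq by (simp only: mult.assoc)
    qed
    also have "\<dots> = emeasure (density lborel (\<lambda>z. ennreal (b z))) A"
      by (simp add: emeasure_density)
    finally show "emeasure (density lborel (\<lambda>z. ennreal (a z))) A = emeasure (density lborel (\<lambda>z. ennreal (b z))) A" .
  qed simp
  then have "AE z in lborel. ennreal (a z) = ennreal (b z)"
    by (intro sigma_finite_measure.density_unique_iff[OF sigma_finite_lborel, THEN iffD1]) auto
  moreover have "a z \<ge> 0" "b z \<ge> 0" for z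
    using H(3) D_pos[of h] by (auto simp: a_def b_def less_imp_le intro!: integral_nonneg_AE mult_nonneg_nonneg)
  ultimately have "AE z in lborel. a z = b z"
    by simp
  then have "a = b"
    by (rule continuous_AE_eq_lborel[OF a_cont b_cont])
  then show ?thesis
    unfolding a_eq[symmetric] b_eq[symmetric] by simp
qed

text \<open>Monotone convergence from the compactly supported case, with multipliers
  \<open>u n\<close> that increase to 1.\<close>

lemma fibre_left:
  fixes H :: "'a \<Rightarrow> real"
  assumes H: "continuous_on UNIV H" "\<And>x. H x \<ge> 0"
  shows "(\<integral>\<^sup>+\<sigma>. ennreal (H (mul h (lp z \<sigma>))) \<partial>(Pi\<^sub>M {..<DIM('a) - CARD('m)} (\<lambda>_. lborel))) = ennreal (D h) * (\<integral>\<^sup>+\<sigma>. ennreal (H (lp (pr h + z) \<sigma>)) \<partial>(Pi\<^sub>M {..<DIM('a) - CARD('m)} (\<lambda>_. lborel)))"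
proof -
  define u where "u n x = max 0 (1 - 1 * infdist x (cball (0::'a) (real n)))" for n x
  have u_bounds: "0 \<le> u n x" for n x
    by (simp add: u_def)
  have u_cont: "continuous_on UNIV (u n)" for n
    unfolding u_def by (intro continuous_intros)
  have u_mono: "u n x \<le> u n' x" if "n \<le> n'" for n n' x
  proof -
    have "infdist x (cball 0 (real n')) \<le> infdist x (cball 0 (real n))"
      using that by (intro infdist_mono) auto
    then show ?thesis
      by (simp add: u_def)
  qed
  have u_lim: "(\<lambda>n. u n x) \<longlonglongrightarrow> 1" for x
  proof (rule tendsto_eventually)
    obtain N where "norm x \<le> real N"
      using real_arch_simple by blast
    then have "u n x = 1" if "n \<ge> N" for n
      using that by (simp add: u_def)
    then show "\<forall>\<^sub>F n in sequentially. u n x = 1"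
      by (auto simp: eventually_sequentially)
  qed
  \<comment> \<open>Locally this name hides the pairing with characters.\<close>
  define K where "K n x = H x * u n x" for n x
  have K: "continuous_on UNIV (K n)" "K n x \<ge> 0" for n x
    unfolding K_def using H u_bounds u_cont by (auto intro!: continuous_on_mult)
  have K_supp: "compact (closure {x. K n x \<noteq> 0})" for n
  proof (rule compact_support_mono)
    show "compact (closure {x. u n x \<noteq> 0})"
      unfolding u_def by (rule bump_compact_support) auto
    fix x assume "x \<notin> closure {x. u n x \<noteq> 0}"
    then have "u n x = 0"
      by (rule zero_outside_support)
    then show "K n x = 0"
      by (simp add: K_def)
  qed
  have K_meas: "K n \<in> borel_measurable borel" for n
    by (rule borel_measurable_continuous_onI[OF K(1)])
  have K_mono: "ennreal (K n x) \<le> ennreal (K n' x)" if "n \<le> n'" for n n' x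
    using u_mono[OF that] H(2) by (intro ennreal_leI) (simp add: K_def mult_left_mono)
  have K_lim: "(\<lambda>n. ennreal (K n x)) \<longlonglongrightarrow> ennreal (H x)" for x
    using tendsto_mult[OF tendsto_const u_lim, of "H x" x] unfolding K_def by (intro tendsto_ennrealI) simp
  have lim: "(\<lambda>n. \<integral>\<^sup>+\<sigma>. ennreal (K n (a \<sigma>)) \<partial>(Pi\<^sub>M {..<DIM('a) - CARD('m)} (\<lambda>_. lborel))) \<longlonglongrightarrow> (\<integral>\<^sup>+\<sigma>. ennreal (H (a \<sigma>)) \<partial>(Pi\<^sub>M {..<DIM('a) - CARD('m)} (\<lambda>_. lborel)))"
    if a: "a \<in> borel_measurable (Pi\<^sub>M {..<DIM('a) - CARD('m)} (\<lambda>_. lborel))" for a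
  proof (rule nn_integral_LIMSEQ)
    show "incseq (\<lambda>n \<sigma>. ennreal (K n (a \<sigma>)))"
      by (intro incseq_SucI le_funI K_mono) simp
    show "(\<lambda>\<sigma>. ennreal (K n (a \<sigma>))) \<in> borel_measurable (Pi\<^sub>M {..<DIM('a) - CARD('m)} (\<lambda>_. lborel))" for n
      by (rule measurable_compose[OF measurable_compose[OF a K_meas] measurable_ennreal])
  qed (rule K_lim)
  have "(\<lambda>n. \<integral>\<^sup>+\<sigma>. ennreal (K n (mul h (lp z \<sigma>))) \<partial>(Pi\<^sub>M {..<DIM('a) - CARD('m)} (\<lambda>_. lborel))) \<longlonglongrightarrow> (\<integral>\<^sup>+\<sigma>. ennreal (H (mul h (lp z \<sigma>))) \<partial>(Pi\<^sub>M {..<DIM('a) - CARD('m)} (\<lambda>_. lborel)))"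
    by (rule lim[OF measurable_compose[OF lp_measurable left_mul_measurable]])
  moreover have "(\<lambda>n. ennreal (D h) * (\<integral>\<^sup>+\<sigma>. ennreal (K n (lp (pr h + z) \<sigma>)) \<partial>(Pi\<^sub>M {..<DIM('a) - CARD('m)} (\<lambda>_. lborel)))) \<longlonglongrightarrow>
      ennreal (D h) * (\<integral>\<^sup>+\<sigma>. ennreal (H (lp (pr h + z) \<sigma>)) \<partial>(Pi\<^sub>M {..<DIM('a) - CARD('m)} (\<lambda>_. lborel)))"
    by (intro ennreal_tendsto_cmult lim lp_measurable) simp
  moreover have "(\<integral>\<^sup>+\<sigma>. ennreal (K n (mul h (lp z \<sigma>))) \<partial>(Pi\<^sub>M {..<DIM('a) - CARD('m)} (\<lambda>_. lborel))) =
      ennreal (D h) * (\<integral>\<^sup>+\<sigma>. ennreal (K n (lp (pr h + z) \<sigma>)) \<partial>(Pi\<^sub>M {..<DIM('a) - CARD('m)} (\<lambda>_. lborel)))" for n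
    by (rule fibre_left_compact_support[OF K(1) K_supp K(2)])
  ultimately show ?thesis
    by (simp add: LIMSEQ_unique)
qed

text \<open>Translate the fibre by \<open>- g\<close>. The modulus appears once through the kernel,
  by \<open>p_left\<close>, and once through the fibre measure, by \<open>fibre_left\<close>; being
  positive and finite, it cancels.\<close>

lemma q_translate:
  assumes t: "t > 0"
  shows "q g z t = q 0 (z - pr g) t"
proof -
  have "continuous_on UNIV (\<lambda>x. p (mul (- g) g) x t)"
    by (intro p_continuous[OF t] continuous_intros)
  then have "(\<integral>\<^sup>+\<sigma>. ennreal (p (mul (- g) g) (mul (- g) (lp z \<sigma>)) t) \<partial>(Pi\<^sub>M {..<DIM('a) - CARD('m)} (\<lambda>_. lborel))) = ennreal (D (- g)) * q 0 (- pr g + z) t"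
    using fibre_left[of "\<lambda>x. p (mul (- g) g) x t" "- g" z] p_pos[OF t, THEN less_imp_le] by (simp add: q_def pr_uminus)
  moreover have "(\<integral>\<^sup>+\<sigma>. ennreal (p (mul (- g) g) (mul (- g) (lp z \<sigma>)) t) \<partial>(Pi\<^sub>M {..<DIM('a) - CARD('m)} (\<lambda>_. lborel))) = ennreal (D (- g)) * q g z t"
    unfolding p_left[OF t] q_def using t D_pos[of "- g"] p_pos[OF t, THEN less_imp_le]
    by (subst nn_integral_cmult[symmetric]) (simp_all add: ennreal_mult less_imp_le)
  ultimately have "ennreal (D (- g)) * q g z t = ennreal (D (- g)) * q 0 (z - pr g) t"
    by simp
  then show ?thesis
    using D_pos[of "- g"] by (simp add: ennreal_mult_cancel_left)
qed

section \<open>Chapman-Kolmogorov and the lower bound\<close>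

lemma nn_integral_P:
  assumes t: "t > 0" and u: "C0_fun u" "\<And>x. u x \<ge> 0"
  shows "(\<integral>\<^sup>+x. ennreal (p g x t) * ennreal (u x) \<partial>lborel) = ennreal (P t u g)"
proof -
  have "(\<integral>\<^sup>+x. ennreal (p g x t * u x) \<partial>lborel) = ennreal (P t u g)"
    using p_integral[OF t u(1), of g] p_pos[OF t, THEN less_imp_le] u(2)
    by (subst nn_integral_eq_integral) (auto simp: has_bochner_integral_iff)
  then show ?thesis
    using p_pos[OF t, THEN less_imp_le] u(2) by (simp add: ennreal_mult)
qed

lemma p_measurable_pair [measurable]: "t > 0 \<Longrightarrow> (\<lambda>x. p (fst x) (snd x) t) \<in> borel_measurable (borel \<Otimes>\<^sub>M borel)"
  unfolding borel_prod by (rule p_measurable(1))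

text \<open>The semigroup law identifies the two densities in the last argument only almost
  everywhere. Approaching \<open>g0\<close> through points of equality, Fatou on the left and
  continuity of \<open>p\<close> on the right keep the inequality at every point.\<close>

lemma chapman_kolmogorov_le:
  assumes s: "s > 0" and t: "t > 0"
  shows "(\<integral>\<^sup>+k. ennreal (p g k s) * ennreal (p k g0 t) \<partial>lborel) \<le> ennreal (p g g0 (s + t))"
proof -
  have st: "s + t > 0" using s t by simp
  define R where "R x = (\<integral>\<^sup>+k. ennreal (p g k s) * ennreal (p k x t) \<partial>lborel)" for x
  have pair: "(\<lambda>(x, k). ennreal (p g k s) * ennreal (p k x t)) \<in> borel_measurable (borel \<Otimes>\<^sub>M borel)"
  proof -
    have "(\<lambda>z. p g (snd z) s) \<in> borel_measurable (borel \<Otimes>\<^sub>M borel :: ('a \<times> 'a) measure)"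
      using measurable_compose[OF measurable_snd p_measurable(2)[OF s]] .
    moreover have "(\<lambda>z. p (snd z) (fst z) t) \<in> borel_measurable (borel \<Otimes>\<^sub>M borel :: ('a \<times> 'a) measure)"
      using t p_measurable_pair[OF t] by (simp only: p_sym[OF t, of "snd _"])
    ultimately show ?thesis
      unfolding case_prod_unfold by measurable
  qed
  have R_meas [measurable]: "R \<in> borel_measurable borel"
    unfolding R_def using pair by (intro lborel.borel_measurable_nn_integral) simp
  have R_int: "(\<integral>\<^sup>+x. R x * w x \<partial>lborel) = (\<integral>\<^sup>+k. ennreal (p g k s) * (\<integral>\<^sup>+x. ennreal (p k x t) * w x \<partial>lborel) \<partial>lborel)"
    if w [measurable]: "w \<in> borel_measurable borel" for w
  proof -
    have "(\<integral>\<^sup>+x. R x * w x \<partial>lborel) = (\<integral>\<^sup>+x. (\<integral>\<^sup>+k. ennreal (p g k s) * ennreal (p k x t) * w x \<partial>lborel) \<partial>lborel)"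
      unfolding R_def using s t by (simp add: nn_integral_multc)
    also have "\<dots> = (\<integral>\<^sup>+k. (\<integral>\<^sup>+x. ennreal (p g k s) * ennreal (p k x t) * w x \<partial>lborel) \<partial>lborel)"
    proof (rule lborel_pair.Fubini'[symmetric])
      have "(\<lambda>(x, k). (ennreal (p g k s) * ennreal (p k x t)) * w x) \<in> borel_measurable (borel \<Otimes>\<^sub>M borel)"
        using pair unfolding case_prod_unfold by measurable
      then show "(\<lambda>(x, k). ennreal (p g k s) * ennreal (p k x t) * w x) \<in> borel_measurable (lborel \<Otimes>\<^sub>M lborel)"
        by simp
    qed
    also have "\<dots> = (\<integral>\<^sup>+k. ennreal (p g k s) * (\<integral>\<^sup>+x. ennreal (p k x t) * w x \<partial>lborel) \<partial>lborel)"
      using t by (simp add: nn_integral_cmult mult.assoc)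
    finally show ?thesis .
  qed
  have "density lborel R = \<nu> (s + t) g"
  proof (rule measure_eqI_C0_nn)
    have "(\<integral>\<^sup>+x. R x \<partial>lborel) = 1"
      using R_int[of "\<lambda>_. 1"] by (simp add: nn_integral_p s t)
    then show "finite_measure (density lborel R)"
      by (intro finite_measureI) (simp add: emeasure_density)
    show "finite_measure (\<nu> (s + t) g)"
      by (rule finite_measure_\<nu>[OF st])
    fix u :: "'a \<Rightarrow> real" assume u: "C0_fun u" "\<And>x. u x \<ge> 0"
    have [measurable]: "u \<in> borel_measurable borel"
      using u(1) by (simp add: C0_fun_def borel_measurable_continuous_onI)
    have "P t u k \<ge> 0" for k
      using p_integral[OF t u(1), of k] p_pos[OF t, THEN less_imp_le] u(2)
      by (metis (no_types, lifting) has_bochner_integral_iff integral_nonneg_AE AE_I2 mult_nonneg_nonneg)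
    then have "(\<integral>\<^sup>+x. ennreal (u x) \<partial>density lborel R) = ennreal (P s (P t u) g)"
      using R_int[of "\<lambda>x. ennreal (u x)"] s t u by (simp add: nn_integral_density nn_integral_P P_C0)
    also have "\<dots> = (\<integral>\<^sup>+x. ennreal (u x) \<partial>\<nu> (s + t) g)"
      using nn_integral_P[OF st u, of g] st s t u(1) by (simp add: \<nu>_def nn_integral_density P_add)
    finally show "(\<integral>\<^sup>+x. ennreal (u x) \<partial>density lborel R) = (\<integral>\<^sup>+x. ennreal (u x) \<partial>\<nu> (s + t) g)" .
  qed simp_all
  then have AE: "AE x in lborel. R x = ennreal (p g x (s + t))"
    unfolding \<nu>_def using st by (intro sigma_finite_measure.density_unique_iff[OF sigma_finite_lborel, THEN iffD1]) auto
  \<comment> \<open>Every ball has positive measure and so meets the set of full measure where the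
    densities agree.\<close>
  have "\<exists>x\<in>ball g0 (1 / real (Suc n)). R x = ennreal (p g x (s + t))" for n
  proof (rule ccontr)
    assume "\<not> ?thesis"
    with AE have "AE x in lborel. x \<notin> ball g0 (1 / real (Suc n))"
      by (auto elim: eventually_mono)
    then have "emeasure lborel (ball g0 (1 / real (Suc n))) = 0"
      by (subst (asm) AE_iff_measurable[OF _ refl]) (auto simp: ball_def)
    then show False
      using content_ball_pos[of "1 / real (Suc n)" g0] by (simp add: measure_def)
  qed
  then obtain Y where Y: "\<And>n. Y n \<in> ball g0 (1 / real (Suc n))" "\<And>n. R (Y n) = ennreal (p g (Y n) (s + t))"
    by metis
  have Y_lim: "Y \<longlonglongrightarrow> g0"
  proof (rule metric_LIMSEQ_I)
    fix \<epsilon> :: real assume "\<epsilon> > 0"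
    then obtain N where N: "1 / real (Suc N) < \<epsilon>"
      using nat_approx_posE by blast
    have "dist (Y n) g0 < \<epsilon>" if "n \<ge> N" for n
    proof -
      have "dist (Y n) g0 < 1 / real (Suc n)"
        using Y(1)[of n] by (simp add: dist_commute)
      also have "\<dots> \<le> 1 / real (Suc N)"
        using that by (simp add: frac_le)
      finally show ?thesis
        using N by simp
    qed
    then show "\<exists>N. \<forall>n\<ge>N. dist (Y n) g0 < \<epsilon>"
      by blast
  qed
  have "R g0 = (\<integral>\<^sup>+k. liminf (\<lambda>n. ennreal (p g k s * p k (Y n) t)) \<partial>lborel)"
    unfolding R_def
  proof (rule nn_integral_cong)
    fix k
    have "continuous_on UNIV (\<lambda>x. p k x t)"
      by (intro p_continuous[OF t] continuous_intros)
    then have "(\<lambda>n. p k (Y n) t) \<longlonglongrightarrow> p k g0 t"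
      by (rule continuous_on_tendsto_compose[OF _ Y_lim]) auto
    then have "(\<lambda>n. ennreal (p g k s * p k (Y n) t)) \<longlonglongrightarrow> ennreal (p g k s * p k g0 t)"
      by (intro tendsto_ennrealI tendsto_mult tendsto_const)
    from lim_imp_Liminf[OF _ this] show "ennreal (p g k s) * ennreal (p k g0 t) = liminf (\<lambda>n. ennreal (p g k s * p k (Y n) t))"
      using p_pos[OF s, THEN less_imp_le] p_pos[OF t, THEN less_imp_le] by (simp add: ennreal_mult)
  qed
  also have "\<dots> \<le> liminf (\<lambda>n. \<integral>\<^sup>+k. ennreal (p g k s * p k (Y n) t) \<partial>lborel)"
    using s t by (intro nn_integral_liminf) simp
  also have "\<dots> = liminf (\<lambda>n. ennreal (p g (Y n) (s + t)))"
    using Y(2) p_pos[OF s, THEN less_imp_le] p_pos[OF t, THEN less_imp_le] by (simp add: R_def ennreal_mult)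
  also have "\<dots> = ennreal (p g g0 (s + t))"
  proof (rule lim_imp_Liminf[OF _ tendsto_ennrealI])
    have "continuous_on UNIV (\<lambda>x. p g x (s + t))"
      by (intro p_continuous[OF st] continuous_intros)
    then show "(\<lambda>n. p g (Y n) (s + t)) \<longlonglongrightarrow> p g g0 (s + t)"
      by (rule continuous_on_tendsto_compose[OF _ Y_lim]) auto
  qed simp
  finally show ?thesis
    by (simp add: R_def)
qed

text \<open>With \<open>t = s + s\<close> the Gaussian at time \<open>t\<close> is an average of
  \<open>q\<close> at time \<open>s\<close> against \<open>gauss s\<close>. Once that Gaussian is
  replaced by \<open>q\<close>, the expression is a Chapman-Kolmogorov integral over the fibre above
  \<open>z\<close>.\<close>

lemma gauss_le_q:
  assumes t: "t > 0"
  shows "ennreal (gauss t z) \<le> q 0 z t"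
proof -
  define s where "s = t / 2"
  have s: "s > 0" and t_eq: "t = s + s"
    using t by (auto simp: s_def)
  note [measurable] = q_measurable[OF s, of 0]
  interpret S: sigma_finite_measure "Pi\<^sub>M {..<DIM('a) - CARD('m)} (\<lambda>_. lborel :: real measure)"
    by (rule sigma_finite_fibre)
  interpret SS: pair_sigma_finite "lborel :: 'a measure" "Pi\<^sub>M {..<DIM('a) - CARD('m)} (\<lambda>_. lborel :: real measure)" ..
  have "ennreal (gauss t z) = (\<integral>\<^sup>+y. q 0 y s * ennreal (gauss s (y - z)) \<partial>lborel)"
    unfolding t_eq by (rule q_gauss[OF s s, symmetric])
  also have "\<dots> = (\<integral>\<^sup>+y. q 0 (z + y) s * ennreal (gauss s y) \<partial>lborel)"
    by (subst nn_integral_lborel_translate[symmetric, of _ z]) simp_all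
  also have "\<dots> = (\<integral>\<^sup>+y. q 0 (z - y) s * ennreal (gauss s y) \<partial>lborel)"
    by (subst nn_integral_lborel_uminus[symmetric]) simp_all
  \<comment> \<open>The almost-everywhere identity is applied in the variable of integration
    \<open>y\<close>; the other factor then becomes exactly the fibre integral over
    \<open>z\<close>, by \<open>q_translate\<close>.\<close>
  also have "\<dots> = (\<integral>\<^sup>+y. q 0 y s * q 0 (z - y) s \<partial>lborel)"
    by (rule nn_integral_cong_AE) (use q_AE_eq_gauss[OF s] in \<open>eventually_elim, simp add: mult.commute\<close>)
  also have "\<dots> = (\<integral>\<^sup>+k. ennreal (p 0 k s) * q 0 (z - pr k) s \<partial>lborel)"
    by (rule nn_integral_q[OF s]) simp
  also have "\<dots> = (\<integral>\<^sup>+k. (\<integral>\<^sup>+\<sigma>. ennreal (p 0 k s) * ennreal (p k (lp z \<sigma>) s) \<partial>(Pi\<^sub>M {..<DIM('a) - CARD('m)} (\<lambda>_. lborel))) \<partial>lborel)"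
    unfolding q_translate[OF s, symmetric] unfolding q_def using s by (simp add: nn_integral_cmult)
  also have "\<dots> = (\<integral>\<^sup>+\<sigma>. (\<integral>\<^sup>+k. ennreal (p 0 k s) * ennreal (p k (lp z \<sigma>) s) \<partial>lborel) \<partial>(Pi\<^sub>M {..<DIM('a) - CARD('m)} (\<lambda>_. lborel)))"
  proof (rule SS.Fubini'[symmetric])
    have 1: "(\<lambda>x. p 0 (fst x) s) \<in> borel_measurable (lborel \<Otimes>\<^sub>M (Pi\<^sub>M {..<DIM('a) - CARD('m)} (\<lambda>_. lborel)))"
      by (rule measurable_compose[OF measurable_fst]) (use s in simp)
    have "(\<lambda>x. (fst x, lp z (snd x))) \<in> measurable (lborel \<Otimes>\<^sub>M (Pi\<^sub>M {..<DIM('a) - CARD('m)} (\<lambda>_. lborel))) (borel \<Otimes>\<^sub>M borel)"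
      by (intro measurable_Pair measurable_compose[OF measurable_snd lp_measurable]) simp
    from measurable_compose[OF this p_measurable_pair[OF s]]
    have 2: "(\<lambda>x. p (fst x) (lp z (snd x)) s) \<in> borel_measurable (lborel \<Otimes>\<^sub>M (Pi\<^sub>M {..<DIM('a) - CARD('m)} (\<lambda>_. lborel)))"
      by simp
    show "(\<lambda>(k, \<sigma>). ennreal (p 0 k s) * ennreal (p k (lp z \<sigma>) s)) \<in> borel_measurable (lborel \<Otimes>\<^sub>M (Pi\<^sub>M {..<DIM('a) - CARD('m)} (\<lambda>_. lborel)))"
      unfolding case_prod_unfold using 1 2 by (intro borel_measurable_times_ennreal measurable_compose[OF _ measurable_ennreal])
  qed
  also have "\<dots> \<le> q 0 z t"
    unfolding q_def t_eq by (intro nn_integral_mono chapman_kolmogorov_le s)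
  finally show ?thesis .
qed

theorem q_eq_gauss: "t > 0 \<Longrightarrow> q g z t = ennreal (gauss t (z - pr g))"
  unfolding q_translate[of t g z] by (intro antisym q_le_gauss gauss_le_q)

text \<open>Finiteness of \<open>q\<close> turns the nonnegative integral into a Bochner integral,
  and symmetry of \<open>p\<close> moves the fibre variable to the first argument.\<close>

theorem heat_kernel_fibre_integral:
  assumes t: "t > 0"
  shows "(\<integral>\<sigma>. p (lp z \<sigma>) g t \<partial>(Pi\<^sub>M {..<DIM('a) - CARD('m)} (\<lambda>_. lborel))) = gauss t (z - pr g)"
proof -
  have "(\<integral>\<sigma>. p g (lp z \<sigma>) t \<partial>(Pi\<^sub>M {..<DIM('a) - CARD('m)} (\<lambda>_. lborel))) = enn2real (q g z t)"
    unfolding q_def using t p_pos[OF t, THEN less_imp_le] by (intro integral_eq_nn_integral) auto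
  then show ?thesis
    using gauss_pos[OF t, of "z - pr g"] by (simp add: q_eq_gauss[OF t] p_sym[OF t, of _ g])
qed

end

theorem theorem4p1:
  fixes mul :: "'a::euclidean_space \<Rightarrow> 'a \<Rightarrow> 'a"
    and r :: nat and V :: "nat \<Rightarrow> 'a set"
    and e :: "'m::finite \<Rightarrow> 'a" and f :: "nat \<Rightarrow> 'a"
    and P :: "real \<Rightarrow> ('a \<Rightarrow> real) \<Rightarrow> 'a \<Rightarrow> real"
    and p :: "'a \<Rightarrow> 'a \<Rightarrow> real \<Rightarrow> real"
    and z z' :: "real^'m" and \<sigma>' :: "nat \<Rightarrow> real" and t :: real
  assumes "carnot_group mul r V"
    and "adapted_basis r V e f"
    and "heat_semigroup mul e P"
    and "heat_kernel P p"
    and "t > 0"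
  shows "(LINT \<sigma> | Pi\<^sub>M {..<DIM('a) - CARD('m)} (\<lambda>_. lborel).
            p (log_point e f z \<sigma>) (log_point e f z' \<sigma>') t)
         = (4 * pi * t) powr (- (real CARD('m) / 2)) * exp (- ((norm (z - z'))\<^sup>2 / (4 * t)))"
proof -
  interpret carnot_heat mul r V e f P p
    using assms by unfold_locales
  show ?thesis
    using heat_kernel_fibre_integral[OF assms(5), of z "log_point e f z' \<sigma>'"] by (simp add: gauss_def)
qed

end
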